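(* Let $X\subset B(H_0,K_0)$ be an operator space and let $T\subset B(H_0,K_0)$ be the TRO generated by $X$. If a rectangular operator state $\phi:X\to B(H,K)$ is a boundary representation for $X$, then $\mathcal S(\phi):\mathcal S(X)\to B(K\oplus H)$ is a boundary representation for the Paulsen system $\mathcal S(X)$.
   Context: A ternary ring of operators (TRO) is a norm closed subspace $T\subset B(H_0,K_0)$ with $xy^*z\in T$ for all $x,y,z\in T$. A triple morphism is a linear map $\theta$ between TROs with $\theta(xy^*z)=\theta(x)\theta(y)^*\theta(z)$; a representation of $T$ is a triple morphism $\theta:T\to B(H,K)$ for Hilbert spaces $H,K$. It is irreducible if, whenever $p\in B(H)$, $q\in B(K)$ are projections with $q\theta(t)=\theta(t)p$ for all $t\in T$, either $p=0,q=0$ or $p=1,q=1$. A linear map $\phi$ from an operator space $X$ to $B(H,K)$ is nondegenerate if, whenever $p\in B(H)$, $q\in B(K)$ are projections with $q\phi(x)=\phi(x)p=0$ for all $x\in X$, one has $p=0$ and $q=0$. A rectangular operator state on an operator space $X$ is a nondegenerate completely contractive linear map $\phi:X\to B(H,K)$ with $\|\phi\|_{cb}=1$. If $X$ generates the TRO $T$, a rectangular operator state $\phi$ on $X$ has the unique extension property if any rectangular operator state of $T$ whose restriction to $X$ is $\phi$ is automatically a triple morphism. It is a boundary representation for $X$ if it has the unique extension property and its unique extension to $T$ is an irreducible representation of $T$. The Paulsen system of $X\subset B(H_0,K_0)$ is the operator system $\mathcal S(X)=\left\{\begin{bmatrix} \lambda I_{K_0} & x \\ y^* & \mu I_{H_0}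 \end{bmatrix}:x,y\in X,\ \lambda,\mu\in\mathbb C\right\}\subset B(K_0\oplus H_0)$. For a completely contractive $\phi:X\to B(H,K)$, $\mathcal S(\phi):\mathcal S(X)\to B(K\oplus H)$ is the unital completely positive (UCP) map $\begin{bmatrix} \lambda I_{K_0} & x \\ y^* & \mu I_{H_0} \end{bmatrix}\mapsto\begin{bmatrix} \lambda I_K & \phi(x) \\ \phi(y)^* & \mu I_H \end{bmatrix}$. A UCP map $\Psi:S\to B(L)$ on an operator system $S$ is a boundary representation for $S$ if it has exactly one UCP extension to $C^*(S)$ and this extension is an irreducible $*$-representation of $C^*(S)$. *)

theory Defs
  imports "HOL-Analysis.Analysis"
begin

section \<open>Complex Hilbert spaces\<close>

class complex_vector = real_vector +
  fixes scaleC :: "complex \<Rightarrow> 'a \<Rightarrow> 'a"  (infixr \<open>*\<^sub>C\<close> 75)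
  assumes scaleC_add_right: "c *\<^sub>C (x + y) = c *\<^sub>C x + c *\<^sub>C y"
    and scaleC_add_left: "(c + d) *\<^sub>C x = c *\<^sub>C x + d *\<^sub>C x"
    and scaleC_scaleC: "c *\<^sub>C (d *\<^sub>C x) = (c * d) *\<^sub>C x"
    and scaleR_scaleC: "r *\<^sub>R x = complex_of_real r *\<^sub>C x"

text \<open>
  The inner product \<open>cinner\<close> is linear in the first argument. Its real part is the library's
  real inner product, so that norm, topology and completeness are those of \<^class>\<open>real_inner\<close>
  and \<^class>\<open>complete_space\<close>.
\<close>

class chilbert_space = complex_vector + real_inner + complete_space +
  fixes cinner :: "'a \<Rightarrow> 'a \<Rightarrow> complex"
  assumes cinner_commute: "cinner x y = cnj (cinner y x)"
    and cinner_add_left: "cinner (x + y) z = cinner x z + cinner y z"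
    and cinner_scaleC_left: "cinner (c *\<^sub>C x) y = c * cinner x y"
    and Re_cinner: "Re (cinner x y) = inner x y"

lemma cinner_self: "cinner (x::'a::chilbert_space) x = complex_of_real ((norm x)\<^sup>2)"
proof (rule complex_eqI)
  have "Im (cinner x x) = - Im (cinner x x)"
    using arg_cong[OF cinner_commute[of x x], of Im] by simp
  then show "Im (cinner x x) = Im (complex_of_real ((norm x)\<^sup>2))"
    by simp
qed (simp add: Re_cinner power2_norm_eq_inner)

lemma norm_scaleC: "norm (c *\<^sub>C (x::'a::chilbert_space)) = cmod c * norm x"
proof -
  have "complex_of_real ((norm (c *\<^sub>C x))\<^sup>2) = c * (cnj c * cnj (cinner x x))"
    unfolding cinner_self[symmetric] cinner_scaleC_left
    by (subst cinner_commute) (simp add: cinner_scaleC_left)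
  also have "\<dots> = complex_of_real ((cmod c * norm x)\<^sup>2)"
    by (simp add: cinner_self power_mult_distrib complex_norm_square del: of_real_power)
  finally have "(norm (c *\<^sub>C x))\<^sup>2 = (cmod c * norm x)\<^sup>2"
    using of_real_eq_iff by blast
  then show ?thesis
    by (simp add: power2_eq_iff_nonneg)
qed

lemma bounded_linear_scaleC: "bounded_linear (\<lambda>x::'a::chilbert_space. c *\<^sub>C x)"
  by (rule bounded_linear_intro[where K="cmod c"])
    (simp_all add: scaleC_add_right scaleR_scaleC scaleC_scaleC norm_scaleC mult.commute)

lemma scaleC_zero_right: "c *\<^sub>C (0::'a::chilbert_space) = 0"
  by (metis bounded_linear_scaleC linear_simps(3))

lemma scaleC_minus_right: "c *\<^sub>C (- x::'a::chilbert_space) = - (c *\<^sub>C x)"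
  by (metis bounded_linear_scaleC linear_simps(4))

lemma scaleC_diff_right: "c *\<^sub>C (x - y::'a::chilbert_space) = c *\<^sub>C x - c *\<^sub>C y"
  by (metis bounded_linear_scaleC linear_simps(2))

instantiation prod :: (complex_vector, complex_vector) complex_vector
begin

definition "c *\<^sub>C x = (c *\<^sub>C fst x, c *\<^sub>C snd x)"

instance
  by standard
    (simp_all add: scaleC_prod_def scaleC_add_right scaleC_add_left scaleC_scaleC scaleR_scaleC
      prod_eq_iff)

end

text \<open>The product of two Hilbert spaces is their Hilbert space direct sum.\<close>

instantiation prod :: (chilbert_space, chilbert_space) chilbert_space
begin

definition "cinner x y = cinner (fst x) (fst y) + cinner (snd x) (snd y)"

instance
proof
  fix x y z :: "'a \<times> 'b" and c :: complex
  show "cinner x y = cnj (cinner y x)"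
    unfolding cinner_prod_def by (simp add: cinner_commute[symmetric])
qed (simp_all add: cinner_prod_def cinner_add_left cinner_scaleC_left Re_cinner inner_prod_def
      scaleC_prod_def algebra_simps)

end


section \<open>Bounded operators\<close>

typedef (overloaded) ('a, 'b) cblinfun  (\<open>(_ \<Rightarrow>\<^sub>C\<^sub>L /_)\<close> [22, 21] 21) =
  "{f :: 'a::chilbert_space \<Rightarrow> 'b::chilbert_space.
      bounded_linear f \<and> (\<forall>c x. f (c *\<^sub>C x) = c *\<^sub>C f x)}"
  morphisms cblinfun_apply Abs_cblinfun
  by (rule exI[where x="\<lambda>_. 0"]) (simp add: scaleC_zero_right)

setup_lifting type_definition_cblinfun

declare [[coercion "cblinfun_apply :: ('a::chilbert_space \<Rightarrow>\<^sub>C\<^sub>L 'b::chilbert_space) \<Rightarrow> 'a \<Rightarrow> 'b"]]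

instantiation cblinfun :: (chilbert_space, chilbert_space) real_normed_vector
begin

lift_definition norm_cblinfun :: "'a \<Rightarrow>\<^sub>C\<^sub>L 'b \<Rightarrow> real" is onorm .

lift_definition minus_cblinfun :: "'a \<Rightarrow>\<^sub>C\<^sub>L 'b \<Rightarrow> 'a \<Rightarrow>\<^sub>C\<^sub>L 'b \<Rightarrow> 'a \<Rightarrow>\<^sub>C\<^sub>L 'b"
  is "\<lambda>f g x. f x - g x"
  by (auto intro: bounded_linear_sub simp: scaleC_diff_right)

definition dist_cblinfun :: "'a \<Rightarrow>\<^sub>C\<^sub>L 'b \<Rightarrow> 'a \<Rightarrow>\<^sub>C\<^sub>L 'b \<Rightarrow> real"
  where "dist_cblinfun a b = norm (a - b)"

definition uniformity_cblinfun :: "(('a \<Rightarrow>\<^sub>C\<^sub>L 'b) \<times> ('a \<Rightarrow>\<^sub>C\<^sub>L 'b)) filter"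
  where "uniformity_cblinfun = (INF e\<in>{0 <..}. principal {(x, y). dist x y < e})"

definition open_cblinfun :: "('a \<Rightarrow>\<^sub>C\<^sub>L 'b) set \<Rightarrow> bool"
  where "open_cblinfun S = (\<forall>x\<in>S. \<forall>\<^sub>F (x', y) in uniformity. x' = x \<longrightarrow> y \<in> S)"

lift_definition uminus_cblinfun :: "'a \<Rightarrow>\<^sub>C\<^sub>L 'b \<Rightarrow> 'a \<Rightarrow>\<^sub>C\<^sub>L 'b" is "\<lambda>f x. - f x"
  by (auto intro: bounded_linear_minus simp: scaleC_minus_right)

lift_definition zero_cblinfun :: "'a \<Rightarrow>\<^sub>C\<^sub>L 'b" is "\<lambda>x. 0"
  by (simp add: scaleC_zero_right)

lift_definition plus_cblinfun :: "'a \<Rightarrow>\<^sub>C\<^sub>L 'b \<Rightarrow> 'a \<Rightarrow>\<^sub>C\<^sub>L 'b \<Rightarrow> 'a \<Rightarrow>\<^sub>C\<^sub>L 'b"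
  is "\<lambda>f g x. f x + g x"
  by (auto intro: bounded_linear_add simp: scaleC_add_right)

lift_definition scaleR_cblinfun :: "real \<Rightarrow> 'a \<Rightarrow>\<^sub>C\<^sub>L 'b \<Rightarrow> 'a \<Rightarrow>\<^sub>C\<^sub>L 'b" is "\<lambda>r f x. r *\<^sub>R f x"
  by (rule conjI, blast intro: bounded_linear_compose[OF bounded_linear_scaleR_right])
    (simp add: scaleR_scaleC scaleC_scaleC mult.commute)

definition sgn_cblinfun :: "'a \<Rightarrow>\<^sub>C\<^sub>L 'b \<Rightarrow> 'a \<Rightarrow>\<^sub>C\<^sub>L 'b"
  where "sgn_cblinfun x = scaleR (inverse (norm x)) x"

instance
  apply standard
  unfolding dist_cblinfun_def open_cblinfun_def sgn_cblinfun_def uniformity_cblinfun_def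
  apply (rule refl | (transfer, force simp: onorm_triangle onorm_scaleR onorm_eq_0 algebra_simps))+
  done

end

instantiation cblinfun :: (chilbert_space, chilbert_space) complex_vector
begin

lift_definition scaleC_cblinfun :: "complex \<Rightarrow> 'a \<Rightarrow>\<^sub>C\<^sub>L 'b \<Rightarrow> 'a \<Rightarrow>\<^sub>C\<^sub>L 'b" is "\<lambda>c f x. c *\<^sub>C f x"
  by (auto intro: bounded_linear_compose[OF bounded_linear_scaleC]
      simp: scaleC_scaleC mult.commute)

instance
  by standard
    (transfer, simp add: scaleC_add_right scaleC_add_left scaleC_scaleC scaleR_scaleC)+

end

lift_definition cblinfun_id :: "'a::chilbert_space \<Rightarrow>\<^sub>C\<^sub>L 'a" is "\<lambda>x. x"
  by simp

lift_definition cblinfun_compose ::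
  "'b::chilbert_space \<Rightarrow>\<^sub>C\<^sub>L 'c::chilbert_space \<Rightarrow> 'a::chilbert_space \<Rightarrow>\<^sub>C\<^sub>L 'b \<Rightarrow> 'a \<Rightarrow>\<^sub>C\<^sub>L 'c"
  (infixl \<open>o\<^sub>C\<^sub>L\<close> 67) is "\<lambda>g f x. g (f x)"
  by (auto intro: bounded_linear_compose)

definition adj :: "'a::chilbert_space \<Rightarrow>\<^sub>C\<^sub>L 'b::chilbert_space \<Rightarrow> 'b \<Rightarrow>\<^sub>C\<^sub>L 'a"
  where "adj a = (THE b :: 'b \<Rightarrow>\<^sub>C\<^sub>L 'a. \<forall>x y. cinner (a x) y = cinner x (b y))"

definition is_projection :: "'a::chilbert_space \<Rightarrow>\<^sub>C\<^sub>L 'a \<Rightarrow> bool"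
  where "is_projection p \<longleftrightarrow> p o\<^sub>C\<^sub>L p = p \<and> adj p = p"

text \<open>\<open>op_block a b c d\<close> is the operator matrix with rows \<open>(a, b)\<close> and \<open>(c, d)\<close>.\<close>

lift_definition op_block ::
  "'k::chilbert_space \<Rightarrow>\<^sub>C\<^sub>L 'l::chilbert_space \<Rightarrow> 'h::chilbert_space \<Rightarrow>\<^sub>C\<^sub>L 'l \<Rightarrow>
   'k \<Rightarrow>\<^sub>C\<^sub>L 'm::chilbert_space \<Rightarrow> 'h \<Rightarrow>\<^sub>C\<^sub>L 'm \<Rightarrow> ('k \<times> 'h) \<Rightarrow>\<^sub>C\<^sub>L ('l \<times> 'm)"
  is "\<lambda>a b c d x. (a (fst x) + b (snd x), c (fst x) + d (snd x))"
  by (auto simp: scaleC_prod_def scaleC_add_right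
      intro!: bounded_linear_Pair bounded_linear_add
        bounded_linear_compose[OF _ bounded_linear_fst]
        bounded_linear_compose[OF _ bounded_linear_snd])


section \<open>Linear maps on spaces of operators\<close>

definition csubspace :: "'a::complex_vector set \<Rightarrow> bool"
  where "csubspace S \<longleftrightarrow>
    0 \<in> S \<and> (\<forall>x\<in>S. \<forall>y\<in>S. x + y \<in> S) \<and> (\<forall>c. \<forall>x\<in>S. c *\<^sub>C x \<in> S)"

definition clinear_on :: "'a::complex_vector set \<Rightarrow> ('a \<Rightarrow> 'b::complex_vector) \<Rightarrow> bool"
  where "clinear_on S f \<longleftrightarrow>
    (\<forall>x\<in>S. \<forall>y\<in>S. f (x + y) = f x + f y) \<and> (\<forall>c. \<forall>x\<in>S. f (c *\<^sub>C x) = c *\<^sub>C f x)"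

text \<open>
  An \<open>n \<times> n\<close> matrix of operators from \<open>H\<close> to \<open>K\<close> is a function on pairs of indices, of which only
  the values at indices below \<open>n\<close> matter; likewise for vectors in the direct sum of \<open>n\<close> copies of
  \<open>H\<close>. The norm \<open>op_mat_norm\<close> is the operator norm between these direct sums.
\<close>

type_synonym ('a, 'b) op_mat = "nat \<Rightarrow> nat \<Rightarrow> 'a \<Rightarrow>\<^sub>C\<^sub>L 'b"

definition mats_over :: "nat \<Rightarrow> ('a::chilbert_space \<Rightarrow>\<^sub>C\<^sub>L 'b::chilbert_space) set \<Rightarrow> ('a, 'b) op_mat set"
  where "mats_over n X = {a. \<forall>i<n. \<forall>j<n. a i j \<in> X}"

definition op_mat_norm :: "nat \<Rightarrow> ('a::chilbert_space, 'b::chilbert_space) op_mat \<Rightarrow> real"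
  where "op_mat_norm n a =
    (SUP h\<in>{h. L2_set (\<lambda>j. norm (h j)) {..<n} \<le> 1}.
      L2_set (\<lambda>i. norm (\<Sum>j<n. a i j (h j))) {..<n})"

definition op_mat_positive :: "nat \<Rightarrow> ('a::chilbert_space, 'a) op_mat \<Rightarrow> bool"
  where "op_mat_positive n a \<longleftrightarrow>
    (\<forall>h::nat \<Rightarrow> 'a. (\<Sum>i<n. cinner (\<Sum>j<n. a i j (h j)) (h i)) \<in> \<real>\<^sub>\<ge>\<^sub>0)"

definition cb_norm ::
  "('a::chilbert_space \<Rightarrow>\<^sub>C\<^sub>L 'b::chilbert_space) set \<Rightarrow>
   ('a \<Rightarrow>\<^sub>C\<^sub>L 'b \<Rightarrow> 'c::chilbert_space \<Rightarrow>\<^sub>C\<^sub>L 'd::chilbert_space) \<Rightarrow> ereal"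
  where "cb_norm X \<phi> =
    (SUP n. SUP a\<in>{a \<in> mats_over n X. op_mat_norm n a \<le> 1}.
      ereal (op_mat_norm n (\<lambda>i j. \<phi> (a i j))))"

definition completely_contractive ::
  "('a::chilbert_space \<Rightarrow>\<^sub>C\<^sub>L 'b::chilbert_space) set \<Rightarrow>
   ('a \<Rightarrow>\<^sub>C\<^sub>L 'b \<Rightarrow> 'c::chilbert_space \<Rightarrow>\<^sub>C\<^sub>L 'd::chilbert_space) \<Rightarrow> bool"
  where "completely_contractive X \<phi> \<longleftrightarrow>
    (\<forall>n. \<forall>a\<in>mats_over n X. op_mat_norm n (\<lambda>i j. \<phi> (a i j)) \<le> op_mat_norm n a)"

definition completely_positive ::
  "('a::chilbert_space \<Rightarrow>\<^sub>C\<^sub>L 'a) set \<Rightarrow> ('a \<Rightarrow>\<^sub>C\<^sub>L 'a \<Rightarrow> 'c::chilbert_space \<Rightarrow>\<^sub>C\<^sub>L 'c) \<Rightarrow> bool"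
  where "completely_positive S \<Psi> \<longleftrightarrow>
    (\<forall>n. \<forall>a\<in>mats_over n S. op_mat_positive n a \<longrightarrow> op_mat_positive n (\<lambda>i j. \<Psi> (a i j)))"


section \<open>Ternary rings of operators and rectangular operator states\<close>

text \<open>Operator spaces are not required to be norm closed; closed ones are a special case.\<close>

definition operator_space :: "('a::chilbert_space \<Rightarrow>\<^sub>C\<^sub>L 'b::chilbert_space) set \<Rightarrow> bool"
  where "operator_space X \<longleftrightarrow> csubspace X"

definition is_tro :: "('a::chilbert_space \<Rightarrow>\<^sub>C\<^sub>L 'b::chilbert_space) set \<Rightarrow> bool"
  where "is_tro T \<longleftrightarrow>
    csubspace T \<and> closed T \<and> (\<forall>x\<in>T. \<forall>y\<in>T. \<forall>z\<in>T. x o\<^sub>C\<^sub>L adj y o\<^sub>C\<^sub>L z \<in> T)"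

definition tro_generated ::
  "('a::chilbert_space \<Rightarrow>\<^sub>C\<^sub>L 'b::chilbert_space) set \<Rightarrow> ('a \<Rightarrow>\<^sub>C\<^sub>L 'b) set"
  where "tro_generated X = is_tro hull X"

definition triple_morphism ::
  "('a::chilbert_space \<Rightarrow>\<^sub>C\<^sub>L 'b::chilbert_space) set \<Rightarrow>
   ('a \<Rightarrow>\<^sub>C\<^sub>L 'b \<Rightarrow> 'c::chilbert_space \<Rightarrow>\<^sub>C\<^sub>L 'd::chilbert_space) \<Rightarrow> bool"
  where "triple_morphism T \<theta> \<longleftrightarrow> clinear_on T \<theta> \<and>
    (\<forall>x\<in>T. \<forall>y\<in>T. \<forall>z\<in>T. \<theta> (x o\<^sub>C\<^sub>L adj y o\<^sub>C\<^sub>L z) = \<theta> x o\<^sub>C\<^sub>L adj (\<theta> y) o\<^sub>C\<^sub>L \<theta> z)"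

definition irreducible_triple_rep ::
  "('a::chilbert_space \<Rightarrow>\<^sub>C\<^sub>L 'b::chilbert_space) set \<Rightarrow>
   ('a \<Rightarrow>\<^sub>C\<^sub>L 'b \<Rightarrow> 'c::chilbert_space \<Rightarrow>\<^sub>C\<^sub>L 'd::chilbert_space) \<Rightarrow> bool"
  where "irreducible_triple_rep T \<theta> \<longleftrightarrow> triple_morphism T \<theta> \<and>
    (\<forall>p q. is_projection p \<and> is_projection q \<and> (\<forall>t\<in>T. q o\<^sub>C\<^sub>L \<theta> t = \<theta> t o\<^sub>C\<^sub>L p) \<longrightarrow>
      p = 0 \<and> q = 0 \<or> p = cblinfun_id \<and> q = cblinfun_id)"

definition nondegenerate ::
  "('a::chilbert_space \<Rightarrow>\<^sub>C\<^sub>L 'b::chilbert_space) set \<Rightarrow>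
   ('a \<Rightarrow>\<^sub>C\<^sub>L 'b \<Rightarrow> 'c::chilbert_space \<Rightarrow>\<^sub>C\<^sub>L 'd::chilbert_space) \<Rightarrow> bool"
  where "nondegenerate X \<phi> \<longleftrightarrow>
    (\<forall>p q. is_projection p \<and> is_projection q \<and>
        (\<forall>x\<in>X. q o\<^sub>C\<^sub>L \<phi> x = 0 \<and> \<phi> x o\<^sub>C\<^sub>L p = 0) \<longrightarrow> p = 0 \<and> q = 0)"

definition rectangular_operator_state ::
  "('a::chilbert_space \<Rightarrow>\<^sub>C\<^sub>L 'b::chilbert_space) set \<Rightarrow>
   ('a \<Rightarrow>\<^sub>C\<^sub>L 'b \<Rightarrow> 'c::chilbert_space \<Rightarrow>\<^sub>C\<^sub>L 'd::chilbert_space) \<Rightarrow> bool"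
  where "rectangular_operator_state X \<phi> \<longleftrightarrow>
    clinear_on X \<phi> \<and> nondegenerate X \<phi> \<and> completely_contractive X \<phi> \<and> cb_norm X \<phi> = 1"

definition state_extension ::
  "('a::chilbert_space \<Rightarrow>\<^sub>C\<^sub>L 'b::chilbert_space) set \<Rightarrow> ('a \<Rightarrow>\<^sub>C\<^sub>L 'b) set \<Rightarrow>
   ('a \<Rightarrow>\<^sub>C\<^sub>L 'b \<Rightarrow> 'c::chilbert_space \<Rightarrow>\<^sub>C\<^sub>L 'd::chilbert_space) \<Rightarrow>
   ('a \<Rightarrow>\<^sub>C\<^sub>L 'b \<Rightarrow> 'c \<Rightarrow>\<^sub>C\<^sub>L 'd) \<Rightarrow> bool"
  where "state_extension X T \<phi> \<theta> \<longleftrightarrow>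
    rectangular_operator_state T \<theta> \<and> (\<forall>x\<in>X. \<theta> x = \<phi> x)"

definition unique_extension_property ::
  "('a::chilbert_space \<Rightarrow>\<^sub>C\<^sub>L 'b::chilbert_space) set \<Rightarrow> ('a \<Rightarrow>\<^sub>C\<^sub>L 'b) set \<Rightarrow>
   ('a \<Rightarrow>\<^sub>C\<^sub>L 'b \<Rightarrow> 'c::chilbert_space \<Rightarrow>\<^sub>C\<^sub>L 'd::chilbert_space) \<Rightarrow> bool"
  where "unique_extension_property X T \<phi> \<longleftrightarrow>
    (\<forall>\<theta>. state_extension X T \<phi> \<theta> \<longrightarrow> triple_morphism T \<theta>)"

text \<open>
  The extension in the second conjunct is unique on \<open>T\<close>: by the first conjunct all extensions are
  triple morphisms, and triple morphisms which are contractive and agree on \<open>X\<close> agree on the TRO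
  generated by \<open>X\<close>.
\<close>

definition rectangular_boundary_rep ::
  "('a::chilbert_space \<Rightarrow>\<^sub>C\<^sub>L 'b::chilbert_space) set \<Rightarrow> ('a \<Rightarrow>\<^sub>C\<^sub>L 'b) set \<Rightarrow>
   ('a \<Rightarrow>\<^sub>C\<^sub>L 'b \<Rightarrow> 'c::chilbert_space \<Rightarrow>\<^sub>C\<^sub>L 'd::chilbert_space) \<Rightarrow> bool"
  where "rectangular_boundary_rep X T \<phi> \<longleftrightarrow>
    unique_extension_property X T \<phi> \<and>
    (\<exists>\<theta>. state_extension X T \<phi> \<theta> \<and> irreducible_triple_rep T \<theta>)"


section \<open>Operator systems and the Paulsen system\<close>

definition operator_system :: "('a::chilbert_space \<Rightarrow>\<^sub>C\<^sub>L 'a) set \<Rightarrow> bool"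
  where "operator_system S \<longleftrightarrow> csubspace S \<and> cblinfun_id \<in> S \<and> (\<forall>x\<in>S. adj x \<in> S)"

definition is_cstar_algebra :: "('a::chilbert_space \<Rightarrow>\<^sub>C\<^sub>L 'a) set \<Rightarrow> bool"
  where "is_cstar_algebra A \<longleftrightarrow>
    csubspace A \<and> closed A \<and> (\<forall>x\<in>A. \<forall>y\<in>A. x o\<^sub>C\<^sub>L y \<in> A) \<and> (\<forall>x\<in>A. adj x \<in> A)"

definition cstar_generated :: "('a::chilbert_space \<Rightarrow>\<^sub>C\<^sub>L 'a) set \<Rightarrow> ('a \<Rightarrow>\<^sub>C\<^sub>L 'a) set"
  where "cstar_generated S = is_cstar_algebra hull S"

definition ucp ::
  "('a::chilbert_space \<Rightarrow>\<^sub>C\<^sub>L 'a) set \<Rightarrow> ('a \<Rightarrow>\<^sub>C\<^sub>L 'a \<Rightarrow> 'c::chilbert_space \<Rightarrow>\<^sub>C\<^sub>L 'c) \<Rightarrow> bool"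
  where "ucp S \<Psi> \<longleftrightarrow>
    clinear_on S \<Psi> \<and> \<Psi> cblinfun_id = cblinfun_id \<and> completely_positive S \<Psi>"

definition star_representation ::
  "('a::chilbert_space \<Rightarrow>\<^sub>C\<^sub>L 'a) set \<Rightarrow> ('a \<Rightarrow>\<^sub>C\<^sub>L 'a \<Rightarrow> 'c::chilbert_space \<Rightarrow>\<^sub>C\<^sub>L 'c) \<Rightarrow> bool"
  where "star_representation A \<pi> \<longleftrightarrow> clinear_on A \<pi> \<and>
    (\<forall>x\<in>A. \<forall>y\<in>A. \<pi> (x o\<^sub>C\<^sub>L y) = \<pi> x o\<^sub>C\<^sub>L \<pi> y) \<and> (\<forall>x\<in>A. \<pi> (adj x) = adj (\<pi> x))"

text \<open>The condition \<open>cblinfun_id \<noteq> 0\<close> excludes the representation on the zero space.\<close>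

definition irreducible_star_rep ::
  "('a::chilbert_space \<Rightarrow>\<^sub>C\<^sub>L 'a) set \<Rightarrow> ('a \<Rightarrow>\<^sub>C\<^sub>L 'a \<Rightarrow> 'c::chilbert_space \<Rightarrow>\<^sub>C\<^sub>L 'c) \<Rightarrow> bool"
  where "irreducible_star_rep A \<pi> \<longleftrightarrow> star_representation A \<pi> \<and>
    (cblinfun_id :: 'c \<Rightarrow>\<^sub>C\<^sub>L 'c) \<noteq> 0 \<and>
    (\<forall>p. is_projection p \<and> (\<forall>a\<in>A. p o\<^sub>C\<^sub>L \<pi> a = \<pi> a o\<^sub>C\<^sub>L p) \<longrightarrow> p = 0 \<or> p = cblinfun_id)"

definition ucp_extension ::
  "('a::chilbert_space \<Rightarrow>\<^sub>C\<^sub>L 'a) set \<Rightarrow> ('a \<Rightarrow>\<^sub>C\<^sub>L 'a \<Rightarrow> 'c::chilbert_space \<Rightarrow>\<^sub>C\<^sub>L 'c) \<Rightarrow>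
   ('a \<Rightarrow>\<^sub>C\<^sub>L 'a \<Rightarrow> 'c \<Rightarrow>\<^sub>C\<^sub>L 'c) \<Rightarrow> bool"
  where "ucp_extension S \<Psi> \<Phi> \<longleftrightarrow> ucp (cstar_generated S) \<Phi> \<and> (\<forall>s\<in>S. \<Phi> s = \<Psi> s)"

text \<open>Extensions are total functions, hence uniqueness is asserted on the generated algebra only.\<close>

definition boundary_rep ::
  "('a::chilbert_space \<Rightarrow>\<^sub>C\<^sub>L 'a) set \<Rightarrow> ('a \<Rightarrow>\<^sub>C\<^sub>L 'a \<Rightarrow> 'c::chilbert_space \<Rightarrow>\<^sub>C\<^sub>L 'c) \<Rightarrow> bool"
  where "boundary_rep S \<Psi> \<longleftrightarrow> operator_system S \<and> ucp S \<Psi> \<and>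
    (\<exists>\<Phi>. ucp_extension S \<Psi> \<Phi> \<and>
      (\<forall>\<Phi>'. ucp_extension S \<Psi> \<Phi>' \<longrightarrow> (\<forall>a\<in>cstar_generated S. \<Phi>' a = \<Phi> a)) \<and>
      irreducible_star_rep (cstar_generated S) \<Phi>)"

definition paulsen_system ::
  "('h::chilbert_space \<Rightarrow>\<^sub>C\<^sub>L 'k::chilbert_space) set \<Rightarrow> (('k \<times> 'h) \<Rightarrow>\<^sub>C\<^sub>L ('k \<times> 'h)) set"
  where "paulsen_system X =
    {op_block (\<alpha> *\<^sub>C cblinfun_id) x (adj y) (\<beta> *\<^sub>C cblinfun_id) |\<alpha> \<beta> x y. x \<in> X \<and> y \<in> X}"

text \<open>
  The matrix entries, hence the value of the map, are determined by \<open>s\<close> in the Paulsen system as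
  soon as both underlying spaces are nonzero. This is the case if \<open>X\<close> contains a nonzero operator,
  in particular if \<open>X\<close> has a rectangular operator state.
\<close>

definition paulsen_map ::
  "('h0::chilbert_space \<Rightarrow>\<^sub>C\<^sub>L 'k0::chilbert_space) set \<Rightarrow>
   ('h0 \<Rightarrow>\<^sub>C\<^sub>L 'k0 \<Rightarrow> 'h::chilbert_space \<Rightarrow>\<^sub>C\<^sub>L 'k::chilbert_space) \<Rightarrow>
   (('k0 \<times> 'h0) \<Rightarrow>\<^sub>C\<^sub>L ('k0 \<times> 'h0)) \<Rightarrow> ('k \<times> 'h) \<Rightarrow>\<^sub>C\<^sub>L ('k \<times> 'h)"
  where "paulsen_map X \<phi> s =
    (THE r. \<exists>\<alpha> \<beta> x y. x \<in> X \<and> y \<in> X \<and>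
      s = op_block (\<alpha> *\<^sub>C cblinfun_id) x (adj y) (\<beta> *\<^sub>C cblinfun_id) \<and>
      r = op_block (\<alpha> *\<^sub>C cblinfun_id) (\<phi> x) (adj (\<phi> y)) (\<beta> *\<^sub>C cblinfun_id))"

end

theory Submission
  imports Defs
begin

text \<open>
  A triple morphism \<open>\<theta>\<close> of \<open>T\<close> is extended to the linking algebra without dilation theory: on the
  self-adjoint ternary ring \<open>W\<close> of off-diagonal operators over \<open>T\<close>, left multipliers \<open>a\<close> of \<open>W\<close>
  act by \<open>\<theta> z h \<mapsto> \<theta> (a z) h\<close>, and this is bounded because powers of \<open>a\<^sup>*a\<close> grow at most
  geometrically. The resulting representation of \<open>C\<^sup>*(\<S>(X))\<close> extends \<open>\<S>(\<phi>)\<close>, and it inherits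
  irreducibility from \<open>\<theta>\<close>.

  Conversely, the off-diagonal corner of a UCP extension \<open>\<Psi>\<close> of \<open>\<S>(\<phi>)\<close> is a rectangular operator
  state extending \<open>\<phi>\<close>, hence a triple morphism. Nondegeneracy and \<open>\<Psi> 1 = 1\<close> then force
  \<open>\<Psi>(s\<^sup>*s) = \<Psi>(s)\<^sup>*\<Psi>(s)\<close> for all \<open>s \<in> W\<close>. Therefore \<open>\<S>(X)\<close> lies in the multiplicative domain
  of \<open>\<Psi>\<close>, and \<open>\<Psi>\<close> is the *-representation determined by its values on \<open>\<S>(X)\<close>.
\<close>

section \<open>Hilbert spaces and adjoints\<close>

text \<open>The obstacle on both sides is the unit of the generated algebra: it need not lie in the
  closed span of products of elements of \<open>W\<close>, so a triple morphism does not see it.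
  Multipliers supply it for existence; for uniqueness it is approximated from inside by 1 - (1 -
  \<open>adj s\<close> s)^(2n+1) with s in \<open>W\<close>. Passing from T to \<open>W\<close>
  merges domain and codomain into one space and turns the triple product into x y z, so that a
  single algebra of left multipliers serves both corners. The symmetry 1 \<oplus> -1 lies in the
  Paulsen system and is sent to its counterpart by every extension; it restores the corners, both
  for extensions and for projections in the commutant. Square roots and functional calculus are
  avoided. Operator bounds come from \<open>log_convex_growth\<close>, which removes any constant in
  front of a geometric bound and keeps the rate. Hence the crude bound 2 for
  \<open>off_diagonal_map\<close> and an unspecified constant for the representation suffice. Gram
  matrices replace the Stinespring dilation.\<close>

lemma scaleC_one [simp]: "1 *\<^sub>C (x::'a::complex_vector) = x"
  using scaleR_scaleC[of 1 x] by simp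

lemma scaleC_zero_left [simp]: "0 *\<^sub>C (x::'a::complex_vector) = 0"
  using scaleR_scaleC[of 0 x] by simp

lemma scaleC_zero [simp]: "c *\<^sub>C (0::'a::complex_vector) = 0"
  by (metis mult_zero_right scaleC_scaleC scaleC_zero_left)

lemma scaleC_minus_left: "(- c) *\<^sub>C (x::'a::complex_vector) = - (c *\<^sub>C x)"
  by (metis add.right_inverse minus_unique scaleC_add_left scaleC_zero_left)

lemma scaleC_minus: "c *\<^sub>C (- x::'a::complex_vector) = - (c *\<^sub>C x)"
  by (metis add.right_inverse minus_unique scaleC_add_right scaleC_zero)

lemma scaleC_diff: "c *\<^sub>C (x - y::'a::complex_vector) = c *\<^sub>C x - c *\<^sub>C y"
  using scaleC_add_right[of c x "- y"] by (simp add: scaleC_minus)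

lemma scaleC_diff_left: "(c - d) *\<^sub>C (x::'a::complex_vector) = c *\<^sub>C x - d *\<^sub>C x"
  using scaleC_add_left[of c "- d" x] by (simp add: scaleC_minus_left)

lemma scaleC_sum: "c *\<^sub>C (\<Sum>i\<in>A. f i) = (\<Sum>i\<in>A. c *\<^sub>C (f i :: 'a::complex_vector))"
  by (induction A rule: infinite_finite_induct) (auto simp: scaleC_add_right)

lemma cinner_add_right: "cinner x (y + z) = cinner x y + cinner (x::'a::chilbert_space) z"
  by (metis cinner_add_left cinner_commute complex_cnj_add)

lemma cinner_scaleC_right: "cinner x (c *\<^sub>C y) = cnj c * cinner (x::'a::chilbert_space) y"
  by (metis cinner_commute cinner_scaleC_left complex_cnj_mult)

lemma cinner_zero_left [simp]: "cinner 0 (x::'a::chilbert_space) = 0"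
  by (metis cinner_scaleC_left mult_zero_left scaleC_zero_left)

lemma cinner_zero_right [simp]: "cinner (x::'a::chilbert_space) 0 = 0"
  by (metis cinner_commute cinner_zero_left complex_cnj_zero)

lemma cinner_minus_left: "cinner (- x) (y::'a::chilbert_space) = - cinner x y"
  by (metis add.right_inverse cinner_add_left cinner_zero_left minus_unique)

lemma cinner_minus_right: "cinner x (- y::'a::chilbert_space) = - cinner x y"
  by (metis add.right_inverse cinner_add_right cinner_zero_right minus_unique)

lemma cinner_diff_left: "cinner (x - y) (z::'a::chilbert_space) = cinner x z - cinner y z"
  using cinner_add_left[of x "- y" z] by (simp add: cinner_minus_left)

lemma cinner_diff_right: "cinner z (x - y::'a::chilbert_space) = cinner z x - cinner z y"
  using cinner_add_right[of z x "- y"] by (simp add: cinner_minus_right)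

lemma cinner_sum_left: "cinner (\<Sum>i\<in>A. f i) (y::'a::chilbert_space) = (\<Sum>i\<in>A. cinner (f i) y)"
  by (induction A rule: infinite_finite_induct) (auto simp: cinner_add_left)

lemma cinner_sum_right: "cinner (y::'a::chilbert_space) (\<Sum>i\<in>A. f i) = (\<Sum>i\<in>A. cinner y (f i))"
  by (induction A rule: infinite_finite_induct) (auto simp: cinner_add_right)

lemmas cinner_simps = cinner_add_left cinner_add_right cinner_scaleC_left cinner_scaleC_right
  cinner_minus_left cinner_minus_right cinner_diff_left cinner_diff_right

lemma cinner_eq_zero_iff [simp]: "cinner (x::'a::chilbert_space) x = 0 \<longleftrightarrow> x = 0"
  by (simp add: cinner_self)

lemma cinner_left_zeroI: "(\<And>y. cinner (x::'a::chilbert_space) y = 0) \<Longrightarrow> x = 0"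
  using cinner_eq_zero_iff by blast

lemma cinner_left_eqI: "(\<And>y. cinner (x::'a::chilbert_space) y = cinner z y) \<Longrightarrow> x = z"
  using cinner_left_zeroI[of "x - z"] by (simp add: cinner_diff_left)

lemma cinner_cauchy_schwarz: "cmod (cinner x y) \<le> norm (x::'a::chilbert_space) * norm y"
proof (cases "cinner x y = 0")
  case False
  define c where "c = cnj (cinner x y) / cmod (cinner x y)"
  have c: "cmod c = 1" "c * cinner x y = cmod (cinner x y)"
    using False complex_norm_square[of "cinner x y"]
    by (simp_all add: c_def norm_divide field_simps power2_eq_square)
  have "cmod (cinner x y) = Re (cinner (c *\<^sub>C x) y)"
    by (simp add: cinner_scaleC_left c)
  also have "\<dots> \<le> norm (c *\<^sub>C x) * norm y"
    unfolding Re_cinner by (rule norm_cauchy_schwarz)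
  finally show ?thesis by (simp add: norm_scaleC c)
qed simp

text \<open>Minimising \<open>\<parallel>v\<parallel>\<^sup>2 - 2 g v\<close> over \<open>V\<close> yields both the Riesz representation (\<open>V = UNIV\<close>) and
  orthogonal projection (\<open>g = inner x\<close>).\<close>

lemma subspace_functional_representation:
  fixes V :: "'a::{real_inner,complete_space} set"
  assumes V: "subspace V" and g: "bounded_linear g"
  shows "\<exists>z\<in>closure V. \<forall>v\<in>V. g v = inner v z"
proof -
  interpret g: bounded_linear g by fact
  obtain C where C: "\<And>x. norm (g x) \<le> norm x * C" using g.bounded by blast
  define J where "J v = (norm v)\<^sup>2 - 2 * g v" for v
  have J_ge: "J v \<ge> - C\<^sup>2" for v
  proof -
    have "2 * g v \<le> 2 * (norm v * C)" using C[of v] by simp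
    moreover have "0 \<le> (norm v - C)\<^sup>2" by simp
    ultimately show ?thesis unfolding J_def by (simp add: power2_eq_square algebra_simps)
  qed
  define I where "I = Inf (J ` V)"
  have bdd: "bdd_below (J ` V)" using J_ge by (auto intro!: bdd_belowI)
  have ne: "J ` V \<noteq> {}" using V by (auto simp: subspace_def)
  have I_le: "I \<le> J v" if "v \<in> V" for v
    unfolding I_def using bdd that by (simp add: cInf_lower)
  have "\<exists>v\<in>V. J v < I + inverse (real (Suc n))" for n
    using cInf_lessD[OF ne, of "I + inverse (real (Suc n))"] by (auto simp: I_def)
  then obtain v where v: "\<And>n. v n \<in> V" "\<And>n. J (v n) < I + inverse (real (Suc n))" by metis
  \<comment> \<open>Parallelogram law: the linear part of \<open>J\<close> cancels against the
    midpoint, so near-minimisers of \<open>J\<close> are close to each other.\<close>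
  have par: "(norm (x - y))\<^sup>2 = 2 * (J x + J y - 2 * J ((1/2) *\<^sub>R (x + y)))" for x y
    unfolding J_def by (simp add: power2_norm_eq_inner inner_simps g.add g.scaleR inner_commute algebra_simps)
  have dist: "(norm (v m - v n))\<^sup>2 \<le> 2 * (inverse (real (Suc m)) + inverse (real (Suc n)))" for m n
  proof -
    have "(1/2) *\<^sub>R (v m + v n) \<in> V"
      using V v by (simp add: subspace_add subspace_scale)
    then show ?thesis unfolding par using I_le[of "(1/2) *\<^sub>R (v m + v n)"] v(2)[of m] v(2)[of n] by simp
  qed
  have "Cauchy v"
  proof (rule metric_CauchyI)
    fix e :: real assume e: "e > 0"
    then obtain N where N: "inverse (real (Suc N)) < e\<^sup>2 / 4"
      using reals_Archimedean[of "e\<^sup>2 / 4"] by auto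
    show "\<exists>M. \<forall>m\<ge>M. \<forall>n\<ge>M. dist (v m) (v n) < e"
    proof (intro exI allI impI)
      fix m n assume "m \<ge> N" "n \<ge> N"
      then have "inverse (real (Suc m)) \<le> inverse (real (Suc N))"
        "inverse (real (Suc n)) \<le> inverse (real (Suc N))" by auto
      moreover have "x < E" if "x \<le> 2 * (a + b)" "c < E / 4" "a \<le> c" "b \<le> c" for x a b c E :: real
        using that by (simp add: field_simps)
      ultimately have "(norm (v m - v n))\<^sup>2 < e\<^sup>2"
        using dist[of m n] N by blast
      then show "dist (v m) (v n) < e"
        using e by (simp add: dist_norm power_less_imp_less_base)
    qed
  qed
  then obtain z where z: "v \<longlonglongrightarrow> z" using Cauchy_convergent_iff convergent_def by blast
  have Jc: "(\<lambda>n. J (v n + w)) \<longlonglongrightarrow> J (z + w)" for w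
    unfolding J_def by (intro tendsto_intros z g.tendsto)
  have JzI: "J z \<le> I"
  proof (rule LIMSEQ_le)
    show "(\<lambda>n. J (v n)) \<longlonglongrightarrow> J z" using Jc[of 0] by simp
    show "(\<lambda>n. I + inverse (real (Suc n))) \<longlonglongrightarrow> I"
      using LIMSEQ_inverse_real_of_nat_add[of I] .
  qed (use v(2) less_imp_le in blast)
  have J_le: "J z \<le> J (z + w)" if "w \<in> V" for w
  proof -
    have "I \<le> J (z + w)"
      by (rule LIMSEQ_le_const[OF Jc]) (use that v V in \<open>auto intro!: I_le subspace_add\<close>)
    with JzI show ?thesis by simp
  qed
  have "g w = inner w z" if w: "w \<in> V" for w
  proof -
    define b where "b = inner w z - g w"
    have quad: "0 \<le> 2 * t * b + t\<^sup>2 * (norm w)\<^sup>2" for t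
    proof -
      have "J z \<le> J (z + t *\<^sub>R w)" using J_le V w by (simp add: subspace_scale)
      moreover have "(norm (z + t *\<^sub>R w))\<^sup>2 = (norm z)\<^sup>2 + 2 * t * inner w z + t\<^sup>2 * (norm w)\<^sup>2"
        unfolding power2_norm_eq_inner
        by (simp add: inner_simps inner_commute algebra_simps power2_eq_square)
      ultimately show ?thesis unfolding J_def b_def
        by (simp add: g.add g.scaleR algebra_simps)
    qed
    show ?thesis
    proof (cases "w = 0")
      case False
      \<comment> \<open>The value substituted for \<open>t\<close> in the next line minimises the
        quadratic, whose value there is -(b/||w||)^2.\<close>
      have "0 \<le> - (b\<^sup>2 / (norm w)\<^sup>2)"
        using quad[of "- b / (norm w)\<^sup>2"] False
        by (simp add: power2_eq_square power4_eq_xxxx divide_simps split: if_splits)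
      then have "b = 0" using False
        by (metis divide_eq_0_iff neg_0_le_iff_le norm_eq_zero power2_less_eq_zero_iff
            zero_le_power2 zero_le_divide_iff order_antisym)
      then show ?thesis by (simp add: b_def)
    qed (simp add: g.zero)
  qed
  moreover have "z \<in> closure V" using z v(1) closure_sequential by blast
  ultimately show ?thesis by blast
qed

lemma closure_eq_UNIV_of_orthogonal_trivial:
  fixes V :: "'a::{real_inner,complete_space} set"
  assumes V: "subspace V" and triv: "\<And>x. (\<And>v. v \<in> V \<Longrightarrow> inner v x = 0) \<Longrightarrow> x = 0"
  shows "closure V = UNIV"
proof -
  have "x \<in> closure V" for x
  proof -
    obtain z where z: "z \<in> closure V" "\<And>v. v \<in> V \<Longrightarrow> inner v x = inner v z"
      using subspace_functional_representation[OF V bounded_linear_inner_left[of x]] by auto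
    then have "x - z = 0" by (intro triv) (simp add: inner_diff_right)
    with z show ?thesis by simp
  qed
  then show ?thesis by auto
qed

section \<open>Evaluation, norm and composition of bounded operators\<close>

lemma bounded_linear_cblinfun_apply: "bounded_linear (cblinfun_apply a)"
  using cblinfun_apply by auto

lemma cblinfun_apply_scaleC: "cblinfun_apply a (c *\<^sub>C x) = c *\<^sub>C a x"
  using cblinfun_apply[of a] by auto

lemma cblinfun_apply_add: "cblinfun_apply a (x + y) = a x + a y"
  by (simp add: bounded_linear_cblinfun_apply linear_simps)

lemma cblinfun_apply_diff: "cblinfun_apply a (x - y) = a x - a y"
  by (simp add: bounded_linear_cblinfun_apply linear_simps)

lemma cblinfun_apply_minus: "cblinfun_apply a (- y) = - a y"
  by (simp add: bounded_linear_cblinfun_apply linear_simps)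

lemma cblinfun_apply_zero [simp]: "cblinfun_apply a 0 = 0"
  by (simp add: bounded_linear_cblinfun_apply linear_simps)

lemma cblinfun_apply_sum: "cblinfun_apply a (\<Sum>i\<in>A. f i) = (\<Sum>i\<in>A. a (f i))"
  by (induction A rule: infinite_finite_induct) (auto simp: cblinfun_apply_add)

lemma cblinfun_eqI: "(\<And>x. cblinfun_apply a x = cblinfun_apply b x) \<Longrightarrow> a = b"
  by (simp add: cblinfun_apply_inject[symmetric] ext)

lemma plus_cblinfun_apply [simp]: "cblinfun_apply (a + b) x = a x + b x" by transfer simp
lemma minus_cblinfun_apply [simp]: "cblinfun_apply (a - b) x = a x - b x" by transfer simp
lemma uminus_cblinfun_apply [simp]: "cblinfun_apply (- a) x = - a x" by transfer simp
lemma zero_cblinfun_apply [simp]: "cblinfun_apply 0 x = 0" by transfer simp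
lemma scaleC_cblinfun_apply [simp]: "cblinfun_apply (c *\<^sub>C a) x = c *\<^sub>C a x" by transfer simp
lemma scaleR_cblinfun_apply [simp]: "cblinfun_apply (r *\<^sub>R a) x = r *\<^sub>R a x" by transfer simp
lemma cblinfun_id_apply [simp]: "cblinfun_apply cblinfun_id x = x" by transfer simp
lemma cblinfun_compose_apply [simp]: "cblinfun_apply (a o\<^sub>C\<^sub>L b) x = a (b x)" by transfer simp
lemma op_block_apply [simp]:
  "cblinfun_apply (op_block a b c d) x = (a (fst x) + b (snd x), c (fst x) + d (snd x))"
  by transfer simp
lemma sum_cblinfun_apply: "cblinfun_apply (\<Sum>i\<in>A. f i) x = (\<Sum>i\<in>A. f i x)"
  by (induction A rule: infinite_finite_induct) auto

lemmas cblinfun_apply_simps = cblinfun_apply_add cblinfun_apply_diff cblinfun_apply_minus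
  cblinfun_apply_scaleC

lemma norm_cblinfun_apply: "norm (cblinfun_apply a x) \<le> norm a * norm x"
  by transfer (auto intro: onorm)

lemma norm_cblinfun_bound: "0 \<le> B \<Longrightarrow> (\<And>x. norm (cblinfun_apply a x) \<le> B * norm x) \<Longrightarrow> norm a \<le> B"
  by transfer (auto intro: onorm_bound)

lemma norm_cblinfun_compose: "norm (a o\<^sub>C\<^sub>L b) \<le> norm a * norm b"
  by transfer (auto intro: onorm_compose[unfolded o_def])

lemma norm_scaleC_cblinfun: "norm (c *\<^sub>C (a :: 'a::chilbert_space \<Rightarrow>\<^sub>C\<^sub>L 'b::chilbert_space)) = cmod c * norm a"
proof -
  have le: "norm (c *\<^sub>C a) \<le> cmod c * norm a" for c and a :: "'a \<Rightarrow>\<^sub>C\<^sub>L 'b"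
  proof (rule norm_cblinfun_bound)
    show "norm ((c *\<^sub>C a) x) \<le> cmod c * norm a * norm x" for x
      using mult_left_mono[OF norm_cblinfun_apply[of a x], of "cmod c"]
      by (simp add: norm_scaleC mult.assoc)
  qed simp
  show ?thesis
  proof (cases "c = 0")
    case False
    have "a = (1 / c) *\<^sub>C c *\<^sub>C a" using False by (simp add: scaleC_scaleC)
    then have "norm a \<le> cmod (1 / c) * norm (c *\<^sub>C a)" using le by metis
    then have "cmod c * norm a \<le> norm (c *\<^sub>C a)" using False by (simp add: norm_divide field_simps)
    with le show ?thesis by (simp add: order_antisym)
  qed simp
qed

lemma compose_assoc: "a o\<^sub>C\<^sub>L b o\<^sub>C\<^sub>L c = a o\<^sub>C\<^sub>L (b o\<^sub>C\<^sub>L c)"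
  by (rule cblinfun_eqI) simp
lemma compose_id_left [simp]: "cblinfun_id o\<^sub>C\<^sub>L a = a" by (rule cblinfun_eqI) simp
lemma compose_id_right [simp]: "a o\<^sub>C\<^sub>L cblinfun_id = a" by (rule cblinfun_eqI) simp
lemma compose_zero_left [simp]: "0 o\<^sub>C\<^sub>L a = 0" by (rule cblinfun_eqI) simp
lemma compose_zero_right [simp]: "a o\<^sub>C\<^sub>L 0 = 0" by (rule cblinfun_eqI) simp
lemma compose_add_left: "(a + b) o\<^sub>C\<^sub>L c = a o\<^sub>C\<^sub>L c + b o\<^sub>C\<^sub>L c" by (rule cblinfun_eqI) simp
lemma compose_add_right: "a o\<^sub>C\<^sub>L (b + c) = a o\<^sub>C\<^sub>L b + a o\<^sub>C\<^sub>L c"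
  by (rule cblinfun_eqI) (simp add: cblinfun_apply_simps)
lemma compose_diff_left: "(a - b) o\<^sub>C\<^sub>L c = a o\<^sub>C\<^sub>L c - b o\<^sub>C\<^sub>L c" by (rule cblinfun_eqI) simp
lemma compose_diff_right: "a o\<^sub>C\<^sub>L (b - c) = a o\<^sub>C\<^sub>L b - a o\<^sub>C\<^sub>L c"
  by (rule cblinfun_eqI) (simp add: cblinfun_apply_simps)
lemma compose_minus_left: "(- a) o\<^sub>C\<^sub>L c = - (a o\<^sub>C\<^sub>L c)" by (rule cblinfun_eqI) simp
lemma compose_minus_right: "a o\<^sub>C\<^sub>L (- c) = - (a o\<^sub>C\<^sub>L c)"
  by (rule cblinfun_eqI) (simp add: cblinfun_apply_simps)
lemma compose_scaleC_left: "(k *\<^sub>C a) o\<^sub>C\<^sub>L c = k *\<^sub>C (a o\<^sub>C\<^sub>L c)" by (rule cblinfun_eqI) simp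
lemma compose_scaleC_right: "a o\<^sub>C\<^sub>L (k *\<^sub>C c) = k *\<^sub>C (a o\<^sub>C\<^sub>L c)"
  by (rule cblinfun_eqI) (simp add: cblinfun_apply_simps)

lemmas compose_simps = compose_add_left compose_add_right compose_diff_left compose_diff_right
  compose_minus_left compose_minus_right compose_scaleC_left compose_scaleC_right

lemma bounded_linear_compose_left: "bounded_linear (\<lambda>a. a o\<^sub>C\<^sub>L b)"
  by (rule bounded_linear_intro[where K="norm b"])
    (auto simp: compose_simps scaleR_scaleC norm_cblinfun_compose)

lemma bounded_linear_compose_right: "bounded_linear (\<lambda>b. a o\<^sub>C\<^sub>L b)"
  by (rule bounded_linear_intro[where K="norm a"])
    (auto simp: compose_simps scaleR_scaleC norm_cblinfun_compose mult.commute[of _ "norm a"])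

section \<open>Adjoints\<close>

lemma adjoint_exists:
  fixes a :: "'a::chilbert_space \<Rightarrow>\<^sub>C\<^sub>L 'b::chilbert_space"
  shows "\<exists>b :: 'b \<Rightarrow>\<^sub>C\<^sub>L 'a. \<forall>x y. cinner (a x) y = cinner x (b y)"
proof -
  have "\<exists>z. \<forall>x. cinner (a x) y = cinner x z" for y
  proof -
    have "bounded_linear (\<lambda>x. inner (a x) y)"
      by (intro bounded_linear_inner_left_comp bounded_linear_cblinfun_apply)
    then obtain z where z: "\<And>x. inner (a x) y = inner x z"
      using subspace_functional_representation[OF subspace_UNIV, of "\<lambda>x. inner (a x) y"] by auto
    \<comment> \<open>The Riesz representation over the reals gives only the real part; the
      imaginary part is the real part at \<open>\<i> *\<^sub>C x\<close>.\<close>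
    have "cinner (a x) y = cinner x z" for x
    proof (rule complex_eqI)
      show "Im (cinner (a x) y) = Im (cinner x z)"
        using z[of "\<i> *\<^sub>C x"]
        by (simp add: Re_cinner[symmetric] cblinfun_apply_scaleC cinner_scaleC_left)
    qed (simp add: Re_cinner z)
    then show ?thesis by blast
  qed
  then obtain f where f: "\<And>x y. cinner (a x) y = cinner x (f y)" by metis
  have f': "cinner (f y) x = cinner y (a x)" for x y
    using f[of x y] by (metis cinner_commute)
  have f_add: "f (x + y) = f x + f y" for x y
    by (rule cinner_left_eqI) (simp add: f' cinner_simps)
  have f_scale: "f (c *\<^sub>C x) = c *\<^sub>C f x" for c x
    by (rule cinner_left_eqI) (simp add: f' cinner_simps)
  have f_norm: "norm (f y) \<le> norm y * norm a" for y
  proof (cases "f y = 0")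
    case False
    have "norm (f y) * norm (f y) = cmod (cinner y (a (f y)))"
      by (simp add: f'[symmetric] cinner_self power2_eq_square norm_mult)
    also have "\<dots> \<le> norm y * norm (a (f y))" by (rule cinner_cauchy_schwarz)
    also have "\<dots> \<le> norm y * (norm a * norm (f y))"
      by (intro mult_left_mono norm_cblinfun_apply) simp
    finally show ?thesis using False by simp
  qed simp
  have "bounded_linear f"
    by (rule bounded_linear_intro[where K="norm a"]) (simp_all add: f_add f_norm f_scale scaleR_scaleC)
  then have "cblinfun_apply (Abs_cblinfun f) = f"
    by (simp add: Abs_cblinfun_inverse f_scale)
  with f show ?thesis by metis
qed

text \<open>Existence and uniqueness discharge the definite description in \<open>adj\<close>, which
  is used from here on only through this identity and its consequences.\<close>

lemma cinner_adj_right: "cinner (cblinfun_apply a x) y = cinner x (adj a y)"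
proof -
  have "\<exists>!b. \<forall>x y. cinner (cblinfun_apply a x) y = cinner x (cblinfun_apply b y)"
    using adjoint_exists[of a]
    by (metis (no_types, lifting) cblinfun_eqI cinner_commute cinner_left_eqI)
  from theI'[OF this] show ?thesis unfolding adj_def by blast
qed

lemma cinner_adj_left: "cinner (adj a x) y = cinner x (cblinfun_apply a y)"
  by (metis cinner_adj_right cinner_commute)

lemma adj_eqI: "(\<And>x y. cinner (cblinfun_apply a x) y = cinner x (cblinfun_apply b y)) \<Longrightarrow> adj a = b"
  by (metis cblinfun_eqI cinner_adj_left cinner_commute cinner_left_eqI)

lemma adj_adj [simp]: "adj (adj a) = a" by (rule adj_eqI) (rule cinner_adj_left)
lemma adj_zero [simp]: "adj 0 = 0" by (rule adj_eqI) simp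
lemma adj_id [simp]: "adj cblinfun_id = cblinfun_id" by (rule adj_eqI) simp
lemma adj_add: "adj (a + b) = adj a + adj b"
  by (rule adj_eqI) (simp add: cinner_simps cinner_adj_right)
lemma adj_diff: "adj (a - b) = adj a - adj b"
  by (rule adj_eqI) (simp add: cinner_simps cinner_adj_right)
lemma adj_minus: "adj (- b) = - adj b"
  by (rule adj_eqI) (simp add: cinner_simps cinner_adj_right)
lemma adj_scaleC: "adj (c *\<^sub>C b) = cnj c *\<^sub>C adj b"
  by (rule adj_eqI) (simp add: cinner_simps cinner_adj_right)
lemma adj_compose: "adj (a o\<^sub>C\<^sub>L b) = adj b o\<^sub>C\<^sub>L adj a"
  by (rule adj_eqI) (simp add: cinner_adj_right)
lemma adj_op_block: "adj (op_block a b c d) = op_block (adj a) (adj c) (adj b) (adj d)"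
  by (rule adj_eqI) (simp add: cinner_prod_def cinner_simps cinner_adj_right)

lemmas adj_simps = adj_add adj_diff adj_minus adj_scaleC adj_compose

lemma norm_adj_le: "norm (adj a) \<le> norm a"
proof (rule norm_cblinfun_bound)
  fix y
  show "norm (adj a y) \<le> norm a * norm y"
  proof (cases "adj a y = 0")
    case False
    have "norm (adj a y) * norm (adj a y) = cmod (cinner y (a (adj a y)))"
      by (simp add: cinner_adj_left[symmetric] cinner_self power2_eq_square norm_mult)
    also have "\<dots> \<le> norm y * norm (a (adj a y))" by (rule cinner_cauchy_schwarz)
    also have "\<dots> \<le> norm y * (norm a * norm (adj a y))"
      by (intro mult_left_mono norm_cblinfun_apply) simp
    finally show ?thesis using False by (simp add: mult.commute)
  qed simp
qed simp

lemma norm_adj [simp]: "norm (adj a) = norm a"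
  using norm_adj_le[of a] norm_adj_le[of "adj a"] by simp

lemma bounded_linear_adj: "bounded_linear adj"
  by (rule bounded_linear_intro[where K=1]) (auto simp: adj_simps scaleR_scaleC)

section \<open>Powers and rank-one operators\<close>

primrec cpow :: "('a::chilbert_space \<Rightarrow>\<^sub>C\<^sub>L 'a) \<Rightarrow> nat \<Rightarrow> ('a \<Rightarrow>\<^sub>C\<^sub>L 'a)" where
  "cpow a 0 = cblinfun_id"
| "cpow a (Suc n) = a o\<^sub>C\<^sub>L cpow a n"

lemma cpow_add: "cpow a (m + n) = cpow a m o\<^sub>C\<^sub>L cpow a n"
  by (induction m) (auto simp: compose_assoc)

lemma cpow_Suc_right: "cpow a (Suc n) = cpow a n o\<^sub>C\<^sub>L a"
  using cpow_add[of a n 1] by simp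

lemma adj_cpow: "adj a = a \<Longrightarrow> adj (cpow a n) = cpow a n"
proof (induction n)
  case (Suc n)
  then show ?case by (simp only: cpow.simps(2) adj_compose) (simp flip: cpow_Suc_right)
qed simp

lemma norm_cpow_compose_le: "norm (cpow a n o\<^sub>C\<^sub>L b) \<le> norm a ^ n * norm b"
proof (induction n)
  case (Suc n)
  have "norm (cpow a (Suc n) o\<^sub>C\<^sub>L b) \<le> norm a * norm (cpow a n o\<^sub>C\<^sub>L b)"
    by (simp add: compose_assoc norm_cblinfun_compose)
  also have "\<dots> \<le> norm a * (norm a ^ n * norm b)" by (intro mult_left_mono Suc) simp
  finally show ?case by (simp add: mult.assoc)
qed simp

lift_definition rank_one :: "'b::chilbert_space \<Rightarrow> 'a::chilbert_space \<Rightarrow> 'a \<Rightarrow>\<^sub>C\<^sub>L 'b"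
  is "\<lambda>k h x. cinner x h *\<^sub>C k"
proof (intro conjI allI)
  fix k :: 'b and h :: 'a
  show "bounded_linear (\<lambda>x. cinner x h *\<^sub>C k)"
  proof (rule bounded_linear_intro[where K="norm h * norm k"])
    show "norm (cinner x h *\<^sub>C k) \<le> norm x * (norm h * norm k)" for x
      using mult_right_mono[OF cinner_cauchy_schwarz[of x h], of "norm k"]
      by (simp add: norm_scaleC mult.assoc)
  qed (simp_all add: cinner_simps scaleC_add_left scaleR_scaleC scaleC_scaleC)
qed (simp add: cinner_simps scaleC_scaleC)

lemma is_projection_rank_one: "norm h = 1 \<Longrightarrow> is_projection (rank_one h h)"
  unfolding is_projection_def
proof
  assume h: "norm h = 1"
  have [simp]: "cblinfun_apply (rank_one h h) x = cinner x h *\<^sub>C h" for x by transfer simp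
  show "rank_one h h o\<^sub>C\<^sub>L rank_one h h = rank_one h h"
    by (rule cblinfun_eqI) (simp add: cinner_simps cinner_self h)
  show "adj (rank_one h h) = rank_one h h"
    by (rule adj_eqI) (simp add: cinner_simps cinner_commute[of h])
qed

lemma is_projection_zero: "is_projection 0" by (simp add: is_projection_def)

text \<open>\<open>nondegenerate\<close> quantifies over projections. The rank-one projection onto
  the line of \<open>h\<close>, paired with \<open>q = 0\<close>, turns it into a condition on
  vectors.\<close>

lemma nondegenerate_kernel:
  assumes "nondegenerate X \<phi>" "\<And>x. x \<in> X \<Longrightarrow> \<phi> x h = 0"
  shows "h = 0"
proof (rule ccontr)
  assume "h \<noteq> 0"
  define g where "g = (1 / norm h) *\<^sub>R h"
  have g: "norm g = 1" using \<open>h \<noteq> 0\<close> by (simp add: g_def)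
  have 1: "cblinfun_apply (rank_one g g) x = cinner x g *\<^sub>C g" for x by transfer simp
  have "\<phi> x g = 0" if "x \<in> X" for x
    by (simp add: g_def scaleR_scaleC cblinfun_apply_simps assms(2)[OF that])
  then have "\<phi> x o\<^sub>C\<^sub>L rank_one g g = 0" if "x \<in> X" for x
    by (intro cblinfun_eqI) (simp add: 1 cblinfun_apply_simps that)
  then have "rank_one g g = 0"
    using assms(1) is_projection_rank_one[OF g] is_projection_zero unfolding nondegenerate_def by fastforce
  then have "cinner g g *\<^sub>C g = 0" using 1[of g] by simp
  then show False using g by (auto simp: cinner_self)
qed

text \<open>Dual to \<open>nondegenerate_kernel\<close>: now the rank-one projection is
  \<open>q\<close> and \<open>p = 0\<close>. It says that the ranges of the operators
  \<open>\<phi> x\<close> span a dense subspace.\<close>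

lemma nondegenerate_cokernel:
  assumes "nondegenerate X \<phi>" "\<And>x. x \<in> X \<Longrightarrow> adj (\<phi> x) h = 0"
  shows "h = 0"
proof (rule ccontr)
  assume "h \<noteq> 0"
  define g where "g = (1 / norm h) *\<^sub>R h"
  have g: "norm g = 1" using \<open>h \<noteq> 0\<close> by (simp add: g_def)
  have 1: "cblinfun_apply (rank_one g g) x = cinner x g *\<^sub>C g" for x by transfer simp
  have "adj (\<phi> x) g = 0" if "x \<in> X" for x
    by (simp add: g_def scaleR_scaleC cblinfun_apply_simps assms(2)[OF that])
  then have "rank_one g g o\<^sub>C\<^sub>L \<phi> x = 0" if "x \<in> X" for x
    by (intro cblinfun_eqI) (simp add: 1 cinner_adj_right that)
  then have "rank_one g g = 0"
    using assms(1) is_projection_rank_one[OF g] is_projection_zero unfolding nondegenerate_def by fastforce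
  then have "cinner g g *\<^sub>C g = 0" using 1[of g] by simp
  then show False using g by (auto simp: cinner_self)
qed

section \<open>Representations of multiplier algebras\<close>

text \<open>Log-convexity makes the ratios b(m+1)/b(m) nondecreasing; a first ratio q > r would give
  growth like q^m and beat C r^m. The constant C disappears from the conclusion, as in the spectral
  radius formula.\<close>

lemma log_convex_growth:
  fixes b :: "nat \<Rightarrow> real"
  assumes nonneg: "\<And>m. 0 \<le> b m" and convex: "\<And>m. (b (Suc m))\<^sup>2 \<le> b m * b (Suc (Suc m))"
    and growth: "\<And>m. b m \<le> C * r ^ m" and r: "0 \<le> r"
  shows "b 1 \<le> r * b 0"
proof (rule ccontr)
  assume "\<not> b 1 \<le> r * b 0"
  then have gt: "r * b 0 < b 1" by simp
  have "b 0 \<noteq> 0"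
  proof
    assume "b 0 = 0"
    then have "(b 1)\<^sup>2 \<le> 0" using convex[of 0] by simp
    then show False using gt \<open>b 0 = 0\<close> by simp
  qed
  then have b0: "b 0 > 0" using nonneg[of 0] by simp
  define q where "q = b 1 / b 0"
  have q: "r < q" using gt b0 by (simp add: q_def field_simps)
  then have q0: "q > 0" using r by simp
  have step: "b m > 0 \<and> q * b m \<le> b (Suc m)" for m
  proof (induction m)
    case 0 then show ?case using b0 by (simp add: q_def)
  next
    case (Suc m)
    then have pos: "b (Suc m) > 0" using q0 by (smt (verit) mult_pos_pos)
    have "q * b m * b (Suc m) \<le> (b (Suc m))\<^sup>2"
      using Suc pos by (simp add: power2_eq_square)
    also have "\<dots> \<le> b m * b (Suc (Suc m))" by (rule convex)
    finally have "b m * (q * b (Suc m)) \<le> b m * b (Suc (Suc m))" by (simp add: ac_simps)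
    then show ?case using Suc pos by simp
  qed
  have low: "q ^ m * b 0 \<le> b m" for m
  proof (induction m)
    case (Suc m)
    have "q * (q ^ m * b 0) \<le> q * b m" using Suc q0 by simp
    also have "\<dots> \<le> b (Suc m)" using step by blast
    finally show ?case by (simp add: mult.assoc)
  qed simp
  show False
  \<comment> \<open>The main case divides by \<open>r\<close>; for \<open>r = 0\<close> the growth
    bound already gives \<open>b 1 \<le> 0\<close>.\<close>
  proof (cases "r = 0")
    case True then show False using growth[of 1] step[of 1] by simp
  next
    case False
    then have r: "r > 0" using r by simp
    obtain n where n: "C / b 0 < (q / r) ^ n"
      using real_arch_pow[of "q / r"] q r by auto
    have "(q / r) ^ n * b 0 \<le> C"
      using order_trans[OF low growth, of n] r by (simp add: power_divide field_simps)
    then show False using n b0 by (simp add: field_simps)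
  qed
qed

section \<open>Complex subspaces and linear maps on them\<close>

lemma csubspace_add: "csubspace S \<Longrightarrow> x \<in> S \<Longrightarrow> y \<in> S \<Longrightarrow> x + y \<in> S"
  by (simp add: csubspace_def)
lemma csubspace_scaleC: "csubspace S \<Longrightarrow> x \<in> S \<Longrightarrow> c *\<^sub>C x \<in> S"
  by (simp add: csubspace_def)
lemma csubspace_zero: "csubspace S \<Longrightarrow> 0 \<in> S"
  by (simp add: csubspace_def)
lemma csubspace_minus: "csubspace S \<Longrightarrow> x \<in> S \<Longrightarrow> - x \<in> S"
  using csubspace_scaleC[of S x "-1"] by (simp add: scaleC_minus_left)
lemma csubspace_diff: "csubspace S \<Longrightarrow> x \<in> S \<Longrightarrow> y \<in> S \<Longrightarrow> x - y \<in> S"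
  using csubspace_add[of S x "- y"] by (simp add: csubspace_minus)
lemma csubspace_sum: "csubspace S \<Longrightarrow> (\<And>i. i \<in> A \<Longrightarrow> f i \<in> S) \<Longrightarrow> (\<Sum>i\<in>A. f i) \<in> S"
  by (induction A rule: infinite_finite_induct) (auto simp: csubspace_zero csubspace_add)

lemmas csubspace_intros = csubspace_add csubspace_scaleC csubspace_zero csubspace_minus
  csubspace_diff csubspace_sum

lemma clinear_on_add: "clinear_on S f \<Longrightarrow> x \<in> S \<Longrightarrow> y \<in> S \<Longrightarrow> f (x + y) = f x + f y"
  by (simp add: clinear_on_def)
lemma clinear_on_scaleC: "clinear_on S f \<Longrightarrow> x \<in> S \<Longrightarrow> f (c *\<^sub>C x) = c *\<^sub>C f x"
  by (simp add: clinear_on_def)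
lemma clinear_on_zero: "clinear_on S f \<Longrightarrow> csubspace S \<Longrightarrow> f 0 = 0"
  by (metis clinear_on_scaleC csubspace_zero scaleC_zero_left)
lemma clinear_on_minus: "clinear_on S f \<Longrightarrow> x \<in> S \<Longrightarrow> f (- x) = - f x"
  using clinear_on_scaleC[of S f x "-1"] by (simp add: scaleC_minus_left)
lemma clinear_on_diff: "clinear_on S f \<Longrightarrow> csubspace S \<Longrightarrow> x \<in> S \<Longrightarrow> y \<in> S \<Longrightarrow> f (x - y) = f x - f y"
  using clinear_on_add[of S f x "- y"] by (simp add: clinear_on_minus csubspace_minus)
lemma clinear_on_sum:
  "clinear_on S f \<Longrightarrow> csubspace S \<Longrightarrow> (\<And>i. i \<in> A \<Longrightarrow> x i \<in> S) \<Longrightarrow> f (\<Sum>i\<in>A. x i) = (\<Sum>i\<in>A. f (x i))"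
  by (induction A rule: infinite_finite_induct)
    (auto simp: clinear_on_zero clinear_on_add csubspace_sum)

lemma subspace_fst_image:
  fixes R :: "('a::chilbert_space \<times> 'b::chilbert_space) set"
  assumes R: "csubspace R" shows "subspace (fst ` R)"
  unfolding subspace_def
proof (intro conjI ballI allI)
  show "0 \<in> fst ` R" using imageI[OF csubspace_zero[OF R], of fst] by simp
  show "x + y \<in> fst ` R" if xy: "x \<in> fst ` R" "y \<in> fst ` R" for x y
  proof -
    obtain r s where "r \<in> R" "x = fst r" "s \<in> R" "y = fst s" using xy by blast
    then show ?thesis
      by (intro image_eqI[of _ _ "r + s"] csubspace_add[OF R]) simp_all
  qed
  show "c *\<^sub>R x \<in> fst ` R" if x: "x \<in> fst ` R" for c x
  proof -
    obtain r where "r \<in> R" "x = fst r" using x by blast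
    then show ?thesis
      by (intro image_eqI[of _ _ "complex_of_real c *\<^sub>C r"] csubspace_scaleC[OF R])
        (simp_all add: scaleR_scaleC scaleC_prod_def)
  qed
qed

text \<open>\<open>R\<close> is the graph of a densely defined operator. A relation is used because
  the values are prescribed on sums with many representations; the norm bound makes the closure of
  \<open>R\<close> single-valued, and completeness makes it total.\<close>

lemma bounded_relation_extension:
  fixes R :: "('a::chilbert_space \<times> 'b::chilbert_space) set"
  assumes R: "csubspace R" and bound: "\<And>x y. (x, y) \<in> R \<Longrightarrow> norm y \<le> C * norm x"
    and dense: "closure (fst ` R) = UNIV" and C: "0 \<le> C"
  shows "\<exists>a :: 'a \<Rightarrow>\<^sub>C\<^sub>L 'b. norm a \<le> C \<and> (\<forall>(x, y)\<in>R. cblinfun_apply a x = y)"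
proof -
  define P where "P x y \<longleftrightarrow> (x, y) \<in> closure R" for x y
  have P_seq: "P x y \<longleftrightarrow> (\<exists>u v. (\<forall>n. (u n, v n) \<in> R) \<and> u \<longlonglongrightarrow> x \<and> v \<longlonglongrightarrow> y)" for x y
  proof
    assume "P x y"
    then obtain w where "\<And>n. w n \<in> R" "w \<longlonglongrightarrow> (x, y)" unfolding P_def closure_sequential by blast
    then show "\<exists>u v. (\<forall>n. (u n, v n) \<in> R) \<and> u \<longlonglongrightarrow> x \<and> v \<longlonglongrightarrow> y"
      by (intro exI[of _ "\<lambda>n. fst (w n)"] exI[of _ "\<lambda>n. snd (w n)"])
        (auto dest: tendsto_fst tendsto_snd)
  next
    assume "\<exists>u v. (\<forall>n. (u n, v n) \<in> R) \<and> u \<longlonglongrightarrow> x \<and> v \<longlonglongrightarrow> y"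
    then obtain u v where "\<And>n. (u n, v n) \<in> R" "u \<longlonglongrightarrow> x" "v \<longlonglongrightarrow> y" by blast
    then show "P x y" unfolding P_def closure_sequential
      by (intro exI[of _ "\<lambda>n. (u n, v n)"]) (auto intro: tendsto_Pair)
  qed
  have P_bound: "norm y \<le> C * norm x" if "P x y" for x y
  proof -
    obtain u v where uv: "\<And>n. (u n, v n) \<in> R" "u \<longlonglongrightarrow> x" "v \<longlonglongrightarrow> y" using \<open>P x y\<close> P_seq by blast
    show ?thesis
      by (rule LIMSEQ_le[OF tendsto_norm[OF uv(3)] tendsto_mult_left[OF tendsto_norm[OF uv(2)]]])
        (use uv(1) bound in blast)
  qed
  have P_add: "P (x + x') (y + y')" if "P x y" "P x' y'" for x x' y y'
  proof -
    obtain u v where uv: "\<And>n. (u n, v n) \<in> R" "u \<longlonglongrightarrow> x" "v \<longlonglongrightarrow> y" using \<open>P x y\<close> P_seq by blast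
    obtain u' v' where uv': "\<And>n. (u' n, v' n) \<in> R" "u' \<longlonglongrightarrow> x'" "v' \<longlonglongrightarrow> y'"
      using \<open>P x' y'\<close> P_seq by blast
    show ?thesis unfolding P_seq
    proof (intro exI[of _ "\<lambda>n. u n + u' n"] exI[of _ "\<lambda>n. v n + v' n"] conjI allI)
      show "(u n + u' n, v n + v' n) \<in> R" for n
        using csubspace_add[OF R uv(1)[of n] uv'(1)[of n]] by simp
    qed (auto intro!: tendsto_add uv uv')
  qed
  have P_scale: "P (c *\<^sub>C x) (c *\<^sub>C y)" if "P x y" for c x y
  proof -
    obtain u v where uv: "\<And>n. (u n, v n) \<in> R" "u \<longlonglongrightarrow> x" "v \<longlonglongrightarrow> y" using \<open>P x y\<close> P_seq by blast
    show ?thesis unfolding P_seq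
    proof (intro exI[of _ "\<lambda>n. c *\<^sub>C u n"] exI[of _ "\<lambda>n. c *\<^sub>C v n"] conjI allI)
      show "(c *\<^sub>C u n, c *\<^sub>C v n) \<in> R" for n
        using csubspace_scaleC[OF R uv(1)[of n], of c] by (simp add: scaleC_prod_def)
    qed (auto intro!: bounded_linear.tendsto[OF bounded_linear_scaleC] uv)
  qed
  have P_unique: "y = y'" if "P x y" "P x y'" for x y y'
    using P_bound[OF P_add[OF that(1) P_scale[OF that(2), of "-1"]]]
    by (simp add: scaleC_minus_left)
  have P_exists: "\<exists>y. P x y" for x
  proof -
    have "x \<in> closure (fst ` R)" using dense by simp
    then obtain u where u: "\<And>n. u n \<in> fst ` R" "u \<longlonglongrightarrow> x" unfolding closure_sequential by blast
    then have "\<forall>n. \<exists>v. (u n, v) \<in> R" by force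
    then obtain v where v: "\<And>n. (u n, v n) \<in> R" by metis
    \<comment> \<open>The bound applied to the difference of two graph points turns convergence of
      \<open>u\<close> into the Cauchy property of \<open>v\<close>.\<close>
    have lip: "norm (v m - v n) \<le> C * norm (u m - u n)" for m n
      by (rule bound) (use csubspace_diff[OF R v[of m] v[of n]] in simp)
    have "Cauchy v"
    proof (rule metric_CauchyI)
      fix e :: real assume "e > 0"
      \<comment> \<open>\<open>C + 1\<close> instead of \<open>C\<close> avoids division by
        zero.\<close>
      then have "e / (C + 1) > 0" using C by simp
      then obtain M where M: "\<And>m n. m \<ge> M \<Longrightarrow> n \<ge> M \<Longrightarrow> dist (u m) (u n) < e / (C + 1)"
        using metric_CauchyD[OF LIMSEQ_imp_Cauchy[OF u(2)]] by metis
      have "dist (v m) (v n) < e" if "m \<ge> M" "n \<ge> M" for m n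
      proof -
        have "dist (v m) (v n) \<le> (C + 1) * dist (u m) (u n)"
          using lip[of m n] by (simp add: dist_norm distrib_right) (smt (verit) norm_ge_zero)
        also have "\<dots> < e" using M[OF that] C by (simp add: field_simps)
        finally show ?thesis .
      qed
      then show "\<exists>M. \<forall>m\<ge>M. \<forall>n\<ge>M. dist (v m) (v n) < e" by blast
    qed
    then show ?thesis unfolding P_seq using u v Cauchy_convergent_iff convergent_def by blast
  qed
  obtain f where f: "\<And>x. P x (f x)" using P_exists by metis
  have f_eq: "f x = y" if "P x y" for x y using P_unique f that by blast
  have f_scale: "f (c *\<^sub>C x) = c *\<^sub>C f x" for c x by (intro f_eq P_scale f)
  have f_bound: "norm (f x) \<le> C * norm x" for x by (intro P_bound f)
  have "bounded_linear f"
  proof (rule bounded_linear_intro[where K=C])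
    show "f (x + y) = f x + f y" for x y by (intro f_eq P_add f)
  qed (simp_all add: f_bound mult.commute[of _ C] f_scale scaleR_scaleC)
  then have app: "cblinfun_apply (Abs_cblinfun f) = f" by (simp add: Abs_cblinfun_inverse f_scale)
  moreover have "f x = y" if "(x, y) \<in> R" for x y
    using that closure_subset[of R] by (intro f_eq) (auto simp: P_def)
  ultimately show ?thesis
    by (intro exI[of _ "Abs_cblinfun f"]) (auto intro!: norm_cblinfun_bound C f_bound)
qed

text \<open>Being self-adjoint, \<open>W\<close> needs no adjoint inside the triple product.
  \<open>kernel_trivial\<close> is nondegeneracy; through \<open>adj_W\<close> it also makes the
  vectors \<open>\<theta> z h\<close> total. \<open>B\<close> may exceed 1, because the growth
  arguments remove it.\<close>

locale ternary_rep =
  fixes W :: "('a::chilbert_space \<Rightarrow>\<^sub>C\<^sub>L 'a) set"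
    and \<theta> :: "('a \<Rightarrow>\<^sub>C\<^sub>L 'a) \<Rightarrow> ('b::chilbert_space \<Rightarrow>\<^sub>C\<^sub>L 'b)"
    and B :: real
  assumes csubspace_W: "csubspace W"
    and closed_W: "closed W"
    and adj_W: "x \<in> W \<Longrightarrow> adj x \<in> W"
    and triple_W: "x \<in> W \<Longrightarrow> y \<in> W \<Longrightarrow> z \<in> W \<Longrightarrow> x o\<^sub>C\<^sub>L y o\<^sub>C\<^sub>L z \<in> W"
    and linear: "clinear_on W \<theta>"
    and theta_adj: "x \<in> W \<Longrightarrow> \<theta> (adj x) = adj (\<theta> x)"
    and theta_triple: "x \<in> W \<Longrightarrow> y \<in> W \<Longrightarrow> z \<in> W \<Longrightarrow>
      \<theta> (x o\<^sub>C\<^sub>L y o\<^sub>C\<^sub>L z) = \<theta> x o\<^sub>C\<^sub>L \<theta> y o\<^sub>C\<^sub>L \<theta> z"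
    and theta_bound: "x \<in> W \<Longrightarrow> norm (\<theta> x) \<le> B * norm x"
    and B_nonneg: "0 \<le> B"
    and kernel_trivial: "(\<And>x. x \<in> W \<Longrightarrow> \<theta> x h = 0) \<Longrightarrow> h = 0"
begin

lemmas W_intros = csubspace_intros[OF csubspace_W]
lemmas theta_linear = clinear_on_add[OF linear] clinear_on_scaleC[OF linear]
  clinear_on_minus[OF linear] clinear_on_diff[OF linear csubspace_W]

lemma eqI_right:
  assumes "\<And>z. z \<in> W \<Longrightarrow> \<theta> z o\<^sub>C\<^sub>L a = \<theta> z o\<^sub>C\<^sub>L b"
  shows "a = b"
proof (rule cblinfun_eqI)
  fix x
  have "a x - b x = 0"
  proof (rule kernel_trivial)
    fix z assume "z \<in> W"
    then show "\<theta> z (a x - b x) = 0"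
      using arg_cong[OF assms, of z "\<lambda>c. cblinfun_apply c x"] by (simp add: cblinfun_apply_simps)
  qed
  then show "a x = b x" by simp
qed

text \<open>Adjoint form of \<open>eqI_right\<close>: the ranges of the operators
  \<open>\<theta> z\<close> span a dense subspace.\<close>

lemma eqI_left:
  assumes "\<And>z. z \<in> W \<Longrightarrow> a o\<^sub>C\<^sub>L \<theta> z = b o\<^sub>C\<^sub>L \<theta> z"
  shows "a = b"
proof -
  have "adj a = adj b"
  proof (rule eqI_right)
    fix z assume "z \<in> W"
    then show "\<theta> z o\<^sub>C\<^sub>L adj a = \<theta> z o\<^sub>C\<^sub>L adj b"
      using arg_cong[OF assms[OF adj_W], of z adj] by (simp add: adj_compose theta_adj)
  qed
  then show ?thesis by (metis adj_adj)
qed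

text \<open>The adjointable left multipliers of \<open>W\<close>. Since \<open>W\<close> is
  self-adjoint, the condition on \<open>adj a\<close> amounts to right multiplication by
  \<open>a\<close>.\<close>

definition multipliers :: "('a \<Rightarrow>\<^sub>C\<^sub>L 'a) set"
  where "multipliers = {a. \<forall>z\<in>W. a o\<^sub>C\<^sub>L z \<in> W \<and> adj a o\<^sub>C\<^sub>L z \<in> W}"

lemma multiplier_W: "a \<in> multipliers \<Longrightarrow> z \<in> W \<Longrightarrow> a o\<^sub>C\<^sub>L z \<in> W"
  by (simp add: multipliers_def)

lemma multiplier_W_right:
  assumes "a \<in> multipliers" "z \<in> W" shows "z o\<^sub>C\<^sub>L a \<in> W"
proof -
  have "adj a o\<^sub>C\<^sub>L adj z \<in> W" using assms by (simp add: multipliers_def adj_W)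
  from adj_W[OF this] show ?thesis by (simp add: adj_compose)
qed

lemma multiplier_adj: "a \<in> multipliers \<Longrightarrow> adj a \<in> multipliers"
  by (simp add: multipliers_def)

lemma multiplier_id: "cblinfun_id \<in> multipliers"
  by (simp add: multipliers_def)

lemma multiplier_compose: "a \<in> multipliers \<Longrightarrow> b \<in> multipliers \<Longrightarrow> a o\<^sub>C\<^sub>L b \<in> multipliers"
  by (auto simp: multipliers_def compose_assoc adj_compose)

lemma csubspace_multipliers: "csubspace multipliers"
  by (auto simp: csubspace_def multipliers_def compose_simps adj_simps intro!: W_intros)

lemmas multiplier_intros = csubspace_intros[OF csubspace_multipliers] multiplier_id
  multiplier_compose multiplier_adj

lemma multiplier_cpow: "a \<in> multipliers \<Longrightarrow> cpow a n \<in> multipliers"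
  by (induction n) (auto intro: multiplier_intros)

lemma multiplier_products: "x \<in> W \<Longrightarrow> y \<in> W \<Longrightarrow> x o\<^sub>C\<^sub>L y \<in> multipliers"
  by (simp add: multipliers_def adj_compose triple_W adj_W)

lemma closed_multipliers: "closed multipliers"
proof -
  have "closed {a. a o\<^sub>C\<^sub>L z \<in> W}" "closed {a. adj a o\<^sub>C\<^sub>L z \<in> W}" for z
    using closed_vimage[OF closed_W, of "\<lambda>a. a o\<^sub>C\<^sub>L z"]
      closed_vimage[OF closed_W, of "\<lambda>a. adj a o\<^sub>C\<^sub>L z"]
    by (auto simp: vimage_def intro!: linear_continuous_on bounded_linear_compose_left
        bounded_linear_compose[OF bounded_linear_compose_left bounded_linear_adj])
  moreover have "multipliers = (\<Inter>z\<in>W. {a. a o\<^sub>C\<^sub>L z \<in> W} \<inter> {a. adj a o\<^sub>C\<^sub>L z \<in> W})"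
    by (auto simp: multipliers_def)
  ultimately show ?thesis by (auto intro!: closed_INT closed_Int)
qed

text \<open>After multiplication by \<open>\<theta> w\<close> on the left, both sides become
  \<theta> of the same product of w, \<open>adj z'\<close>, a and z, and \<open>eqI_right\<close>
  cancels the factor. So \<open>a\<close> and \<open>adj a\<close> behave as mutual adjoints before
  any operator has been assigned to \<open>a\<close>.\<close>

lemma multiplier_symmetric:
  assumes a: "a \<in> multipliers" and z: "z \<in> W" "z' \<in> W"
  shows "adj (\<theta> z') o\<^sub>C\<^sub>L \<theta> (a o\<^sub>C\<^sub>L z) = adj (\<theta> (adj a o\<^sub>C\<^sub>L z')) o\<^sub>C\<^sub>L \<theta> z"
proof (rule eqI_right)
  fix w assume w: "w \<in> W"
  have "\<theta> w o\<^sub>C\<^sub>L (adj (\<theta> z') o\<^sub>C\<^sub>L \<theta> (a o\<^sub>C\<^sub>L z)) = \<theta> (w o\<^sub>C\<^sub>L adj z' o\<^sub>C\<^sub>L (a o\<^sub>C\<^sub>L z))"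
    using w z multiplier_W[OF a z(1)] by (subst theta_triple) (auto simp: theta_adj adj_W compose_assoc)
  also have "w o\<^sub>C\<^sub>L adj z' o\<^sub>C\<^sub>L (a o\<^sub>C\<^sub>L z) = w o\<^sub>C\<^sub>L adj (adj a o\<^sub>C\<^sub>L z') o\<^sub>C\<^sub>L z"
    by (simp add: adj_compose compose_assoc)
  also have "\<theta> \<dots> = \<theta> w o\<^sub>C\<^sub>L (adj (\<theta> (adj a o\<^sub>C\<^sub>L z')) o\<^sub>C\<^sub>L \<theta> z)"
    using w z multiplier_W[OF multiplier_adj[OF a]]
    by (subst theta_triple) (auto simp: theta_adj adj_W compose_assoc)
  finally show "\<theta> w o\<^sub>C\<^sub>L (adj (\<theta> z') o\<^sub>C\<^sub>L \<theta> (a o\<^sub>C\<^sub>L z))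
    = \<theta> w o\<^sub>C\<^sub>L (adj (\<theta> (adj a o\<^sub>C\<^sub>L z')) o\<^sub>C\<^sub>L \<theta> z)" .
qed

text \<open>A list is a formal sum of vectors \<open>\<theta> z h\<close>, acted on by
  \<open>a\<close>. Staying formal allows norm estimates before the action is known to depend only
  on the sum.\<close>

definition combination :: "('a \<Rightarrow>\<^sub>C\<^sub>L 'a) \<Rightarrow> (('a \<Rightarrow>\<^sub>C\<^sub>L 'a) \<times> 'b) list \<Rightarrow> 'b"
  where "combination a l = (\<Sum>(z, h)\<leftarrow>l. \<theta> (a o\<^sub>C\<^sub>L z) h)"

lemma combination_simps [simp]:
  "combination a [] = 0"
  "combination a ((z, h) # l) = \<theta> (a o\<^sub>C\<^sub>L z) h + combination a l"
  "combination a (l @ l') = combination a l + combination a l'"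
  by (simp_all add: combination_def)

text \<open>Sesquilinear extension of \<open>multiplier_symmetric\<close>. The factors
  \<open>c\<close> and \<open>d\<close> let one factor at a time move across when powers are
  compared.\<close>

lemma combination_symmetric:
  assumes a: "a \<in> multipliers" and c: "c \<in> multipliers" and d: "d \<in> multipliers"
    and l: "set l \<subseteq> W \<times> UNIV" and l': "set l' \<subseteq> W \<times> UNIV"
  shows "cinner (combination (a o\<^sub>C\<^sub>L c) l) (combination d l')
    = cinner (combination c l) (combination (adj a o\<^sub>C\<^sub>L d) l')"
proof -
  have 1: "cinner (\<theta> (a o\<^sub>C\<^sub>L c o\<^sub>C\<^sub>L z) h) (\<theta> (d o\<^sub>C\<^sub>L z') h')
    = cinner (\<theta> (c o\<^sub>C\<^sub>L z) h) (\<theta> (adj a o\<^sub>C\<^sub>L d o\<^sub>C\<^sub>L z') h')" if "z \<in> W" "z' \<in> W" for z z' h h'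
  proof -
    have "cinner ((adj (\<theta> (d o\<^sub>C\<^sub>L z')) o\<^sub>C\<^sub>L \<theta> (a o\<^sub>C\<^sub>L (c o\<^sub>C\<^sub>L z))) h) h'
      = cinner ((adj (\<theta> (adj a o\<^sub>C\<^sub>L (d o\<^sub>C\<^sub>L z'))) o\<^sub>C\<^sub>L \<theta> (c o\<^sub>C\<^sub>L z)) h) h'"
      using that a c d by (simp only: multiplier_symmetric[OF a] multiplier_W)
    then show ?thesis by (simp add: cinner_adj_left compose_assoc)
  qed
  have 2: "cinner (\<theta> (a o\<^sub>C\<^sub>L c o\<^sub>C\<^sub>L z) h) (combination d l')
    = cinner (\<theta> (c o\<^sub>C\<^sub>L z) h) (combination (adj a o\<^sub>C\<^sub>L d) l')" if "z \<in> W" for z h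
    using l' by (induction l') (auto simp: cinner_add_right 1[OF that])
  show ?thesis using l by (induction l) (auto simp: cinner_add_left 2)
qed

text \<open>For \<open>s = adj a o\<^sub>C\<^sub>L a\<close>, symmetry and Cauchy-Schwarz make the
  norms of \<open>combination (cpow s m) l\<close> log-convex in m, so
  \<open>log_convex_growth\<close> bounds s with constant \<open>norm s\<close>. The bound for
  \<open>a\<close> follows by pairing \<open>combination s l\<close> with
  \<open>combination cblinfun_id l\<close>.\<close>

lemma combination_bound:
  assumes a: "a \<in> multipliers" and l: "set l \<subseteq> W \<times> UNIV"
  shows "norm (combination a l) \<le> norm a * norm (combination cblinfun_id l)"
proof -
  define s where "s = adj a o\<^sub>C\<^sub>L a"
  have s: "s \<in> multipliers" "adj s = s"
    using a by (auto simp: s_def adj_compose intro: multiplier_intros)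
  note pow = multiplier_cpow[OF s(1)]
  define b where "b m = norm (combination (cpow s m) l)" for m
  have "b 1 \<le> norm s * b 0"
  proof (rule log_convex_growth)
    show "(b (Suc m))\<^sup>2 \<le> b m * b (Suc (Suc m))" for m
    proof -
      have "complex_of_real ((b (Suc m))\<^sup>2) = cinner (combination (cpow s m) l) (combination (cpow s (Suc (Suc m))) l)"
        using combination_symmetric[OF s(1) pow pow l l, of m "Suc m"]
        unfolding b_def by (simp add: cinner_self s)
      then have "(b (Suc m))\<^sup>2 = cmod (cinner (combination (cpow s m) l) (combination (cpow s (Suc (Suc m))) l))"
        by (metis abs_of_nonneg norm_of_real zero_le_power2)
      also have "\<dots> \<le> b m * b (Suc (Suc m))" unfolding b_def by (rule cinner_cauchy_schwarz)
      finally show ?thesis .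
    qed
    \<comment> \<open>This constant depends on the list and gives no operator bound by itself; what
      matters is that it does not depend on \<open>m\<close>.\<close>
    show "b m \<le> (\<Sum>(z, h)\<leftarrow>l. B * norm z * norm h) * norm s ^ m" for m
      unfolding b_def using l
    proof (induction l)
      case (Cons p l)
      obtain z h where p: "p = (z, h)" by (cases p)
      then have z: "z \<in> W" using Cons.prems by simp
      have "norm (\<theta> (cpow s m o\<^sub>C\<^sub>L z) h) \<le> norm (\<theta> (cpow s m o\<^sub>C\<^sub>L z)) * norm h"
        by (rule norm_cblinfun_apply)
      also have "\<dots> \<le> B * norm (cpow s m o\<^sub>C\<^sub>L z) * norm h"
        by (intro mult_right_mono theta_bound multiplier_W pow z) simp
      also have "\<dots> \<le> B * (norm s ^ m * norm z) * norm h"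
        by (intro mult_right_mono mult_left_mono norm_cpow_compose_le B_nonneg) simp
      finally have "norm (\<theta> (cpow s m o\<^sub>C\<^sub>L z) h) \<le> B * norm z * norm h * norm s ^ m"
        by (simp add: ac_simps)
      then show ?case using Cons norm_triangle_ineq[of "\<theta> (cpow s m o\<^sub>C\<^sub>L z) h" "combination (cpow s m) l"]
        by (auto simp: p distrib_right)
    qed simp
  qed (auto simp: b_def)
  then have le: "norm (combination s l) \<le> norm s * norm (combination cblinfun_id l)"
    by (simp add: b_def)
  let ?x = "norm (combination cblinfun_id l)"
  have "(norm (combination a l))\<^sup>2 = Re (cinner (combination (a o\<^sub>C\<^sub>L cblinfun_id) l) (combination a l))"
    by (simp add: cinner_self)
  also have "\<dots> = Re (cinner (combination cblinfun_id l) (combination s l))"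
    by (subst combination_symmetric) (auto simp: a l multiplier_id s_def)
  also have "\<dots> \<le> ?x * norm (combination s l)"
    by (meson cinner_cauchy_schwarz complex_Re_le_cmod order_trans)
  also have "\<dots> \<le> ?x * (norm s * ?x)" using le by (intro mult_left_mono) auto
  also have "\<dots> \<le> ?x * ((norm a * norm a) * ?x)"
    using norm_cblinfun_compose[of "adj a" a] by (intro mult_left_mono mult_right_mono) (auto simp: s_def)
  also have "\<dots> = (norm a * ?x)\<^sup>2" by (simp add: power2_eq_square)
  finally show ?thesis by (rule power2_le_imp_le) simp
qed

text \<open>The pairs of \<open>combination cblinfun_id l\<close> and \<open>combination a l\<close>
  form the graph to which \<open>bounded_relation_extension\<close> applies, with
  \<open>combination_bound\<close> as its bound.\<close>

lemma multiplier_image_exists: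
  assumes a: "a \<in> multipliers"
  shows "\<exists>p. norm p \<le> norm a \<and> (\<forall>z\<in>W. p o\<^sub>C\<^sub>L \<theta> z = \<theta> (a o\<^sub>C\<^sub>L z))"
proof -
  let ?L = "{l. set l \<subseteq> W \<times> (UNIV :: 'b set)}"
  let ?R = "(\<lambda>l. (combination cblinfun_id l, combination a l)) ` ?L"
  have scale: "combination d (map (\<lambda>(z, h). (z, c *\<^sub>C h)) l) = c *\<^sub>C combination d l" for d c l
    by (induction l) (auto simp: scaleC_add_right cblinfun_apply_scaleC)
  have R: "csubspace ?R"
    unfolding csubspace_def
  proof (intro conjI ballI allI)
    show "0 \<in> ?R" by (intro image_eqI[of _ _ "[]"]) (auto simp: zero_prod_def)
    show "x + y \<in> ?R" if x: "x \<in> ?R" and y: "y \<in> ?R" for x y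
    proof -
      obtain l l' where "l \<in> ?L" "x = (combination cblinfun_id l, combination a l)"
        "l' \<in> ?L" "y = (combination cblinfun_id l', combination a l')" using x y by blast
      then show ?thesis by (intro image_eqI[of _ _ "l @ l'"]) auto
    qed
    show "c *\<^sub>C x \<in> ?R" if x: "x \<in> ?R" for c x
    proof -
      obtain l where "l \<in> ?L" "x = (combination cblinfun_id l, combination a l)" using x by blast
      then show ?thesis
        by (intro image_eqI[of _ _ "map (\<lambda>(z, h). (z, c *\<^sub>C h)) l"]) (auto simp: scale scaleC_prod_def)
    qed
  qed
  have "closure (fst ` ?R) = UNIV"
  proof (rule closure_eq_UNIV_of_orthogonal_trivial)
    show "subspace (fst ` ?R)" by (rule subspace_fst_image[OF R])
    fix x assume x: "\<And>v. v \<in> fst ` ?R \<Longrightarrow> inner v x = 0"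
    show "x = 0"
    proof (rule kernel_trivial)
      \<comment> \<open>Testing orthogonality on the vector
        \<open>\<theta> (adj z) (\<theta> z x)\<close> gives the squared norm of
        \<open>\<theta> z x\<close>.\<close>
      fix z assume z: "z \<in> W"
      let ?h = "\<theta> z x"
      have "\<theta> (adj z) ?h \<in> fst ` ?R"
        using z by (auto simp: image_image intro!: image_eqI[of _ _ "[(adj z, ?h)]"] adj_W)
      then have "Re (cinner (\<theta> (adj z) ?h) x) = 0" using x by (simp add: Re_cinner)
      then show "\<theta> z x = 0" using z by (simp add: theta_adj cinner_adj_left cinner_self)
    qed
  qed
  then obtain p where p: "norm p \<le> norm a" "\<And>x y. (x, y) \<in> ?R \<Longrightarrow> cblinfun_apply p x = y"
    using bounded_relation_extension[OF R, of "norm a"] combination_bound[OF a] by fastforce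
  have "p o\<^sub>C\<^sub>L \<theta> z = \<theta> (a o\<^sub>C\<^sub>L z)" if "z \<in> W" for z
  proof (rule cblinfun_eqI)
    fix h
    show "(p o\<^sub>C\<^sub>L \<theta> z) h = \<theta> (a o\<^sub>C\<^sub>L z) h"
      using that by (auto intro!: p(2) image_eqI[of _ _ "[(z, h)]"])
  qed
  with p(1) show ?thesis by blast
qed

definition multiplier_rep :: "('a \<Rightarrow>\<^sub>C\<^sub>L 'a) \<Rightarrow> ('b \<Rightarrow>\<^sub>C\<^sub>L 'b)" (\<open>\<pi>\<close>)
  where "\<pi> a = (SOME p. norm p \<le> norm a \<and> (\<forall>z\<in>W. p o\<^sub>C\<^sub>L \<theta> z = \<theta> (a o\<^sub>C\<^sub>L z)))"

lemma
  assumes "a \<in> multipliers"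
  shows norm_rep_le: "norm (\<pi> a) \<le> norm a"
    and rep_theta: "z \<in> W \<Longrightarrow> \<pi> a o\<^sub>C\<^sub>L \<theta> z = \<theta> (a o\<^sub>C\<^sub>L z)"
  using someI_ex[OF multiplier_image_exists[OF assms]] unfolding multiplier_rep_def by auto

text \<open>The vectors \<open>\<theta> z h\<close> are total, so the intertwining relation
  determines the operator. The algebraic laws of \<open>\<pi>\<close> are read off from this
  uniqueness.\<close>

lemma rep_eqI:
  assumes "a \<in> multipliers" "\<And>z. z \<in> W \<Longrightarrow> p o\<^sub>C\<^sub>L \<theta> z = \<theta> (a o\<^sub>C\<^sub>L z)"
  shows "\<pi> a = p"
  by (rule eqI_left) (simp add: assms rep_theta)

lemma rep_id: "\<pi> cblinfun_id = cblinfun_id"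
  by (rule rep_eqI) (auto intro: multiplier_intros)

lemma rep_add: "a \<in> multipliers \<Longrightarrow> b \<in> multipliers \<Longrightarrow> \<pi> (a + b) = \<pi> a + \<pi> b"
  by (rule rep_eqI) (auto intro: multiplier_intros simp: compose_simps rep_theta theta_linear multiplier_W)

lemma rep_scaleC: "a \<in> multipliers \<Longrightarrow> \<pi> (c *\<^sub>C a) = c *\<^sub>C \<pi> a"
  by (rule rep_eqI) (auto intro: multiplier_intros simp: compose_simps rep_theta theta_linear multiplier_W)

lemma rep_compose: "a \<in> multipliers \<Longrightarrow> b \<in> multipliers \<Longrightarrow> \<pi> (a o\<^sub>C\<^sub>L b) = \<pi> a o\<^sub>C\<^sub>L \<pi> b"
  by (rule rep_eqI) (auto intro: multiplier_intros simp: compose_assoc rep_theta multiplier_W)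

lemma rep_products: "x \<in> W \<Longrightarrow> y \<in> W \<Longrightarrow> \<pi> (x o\<^sub>C\<^sub>L y) = \<theta> x o\<^sub>C\<^sub>L \<theta> y"
  by (rule rep_eqI) (auto simp: multiplier_products theta_triple)

lemma rep_adj:
  assumes a: "a \<in> multipliers" shows "\<pi> (adj a) = adj (\<pi> a)"
proof (rule rep_eqI)
  fix z assume z: "z \<in> W"
  show "adj (\<pi> a) o\<^sub>C\<^sub>L \<theta> z = \<theta> (adj a o\<^sub>C\<^sub>L z)"
  proof (rule eqI_right)
    fix w assume w: "w \<in> W"
    have "\<theta> w o\<^sub>C\<^sub>L (adj (\<pi> a) o\<^sub>C\<^sub>L \<theta> z) = adj (\<pi> a o\<^sub>C\<^sub>L \<theta> (adj w)) o\<^sub>C\<^sub>L \<theta> z"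
      using w by (simp add: adj_compose theta_adj compose_assoc)
    also have "\<dots> = adj (\<theta> (a o\<^sub>C\<^sub>L adj w)) o\<^sub>C\<^sub>L \<theta> z" using a w by (simp add: rep_theta adj_W)
    also have "\<dots> = \<theta> w o\<^sub>C\<^sub>L \<theta> (adj a o\<^sub>C\<^sub>L z)"
      using multiplier_symmetric[OF multiplier_adj[OF a] z adj_W[OF w]] w by (simp add: theta_adj)
    finally show "\<theta> w o\<^sub>C\<^sub>L (adj (\<pi> a) o\<^sub>C\<^sub>L \<theta> z) = \<theta> w o\<^sub>C\<^sub>L \<theta> (adj a o\<^sub>C\<^sub>L z)" .
  qed
qed (intro multiplier_adj a)

text \<open>Right-handed form of \<open>rep_theta\<close>, obtained by taking adjoints; the mixed
  products in \<open>graded_product\<close> need it.\<close>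

lemma theta_rep:
  assumes a: "a \<in> multipliers" and z: "z \<in> W" shows "\<theta> (z o\<^sub>C\<^sub>L a) = \<theta> z o\<^sub>C\<^sub>L \<pi> a"
proof -
  have "adj (\<theta> (z o\<^sub>C\<^sub>L a)) = adj (\<theta> z o\<^sub>C\<^sub>L \<pi> a)"
    using rep_theta[OF multiplier_adj[OF a] adj_W[OF z]] multiplier_W_right[OF a z] z a
    by (simp add: theta_adj[symmetric] adj_compose rep_adj)
  then show ?thesis by (metis adj_adj)
qed

end

text \<open>The symmetry \<open>g\<close> splits an operator into an even and an odd part. In the application
  \<open>g = 1 \<oplus> -1\<close> and \<open>W\<close> consists of odd operators, so that \<open>graded_algebra\<close> is a C*-algebra of
  \<open>2 \<times> 2\<close> operator matrices.\<close>

locale graded_ternary_rep = ternary_rep +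
  fixes g :: "'a \<Rightarrow>\<^sub>C\<^sub>L 'a"
  assumes g_square: "g o\<^sub>C\<^sub>L g = cblinfun_id"
    and g_adj: "adj g = g"
    and g_odd: "x \<in> W \<Longrightarrow> g o\<^sub>C\<^sub>L x o\<^sub>C\<^sub>L g = - x"
    and g_W: "x \<in> W \<Longrightarrow> g o\<^sub>C\<^sub>L x \<in> W"
begin

definition "even_part m = (1 / 2) *\<^sub>C (m + g o\<^sub>C\<^sub>L m o\<^sub>C\<^sub>L g)"
definition "odd_part m = (1 / 2) *\<^sub>C (m - g o\<^sub>C\<^sub>L m o\<^sub>C\<^sub>L g)"

text \<open>Membership is a condition on the two parts, so that closedness follows from their
  continuity.\<close>

definition "graded_algebra = {m. even_part m \<in> multipliers \<and> odd_part m \<in> W}"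

definition "graded_rep m = \<pi> (even_part m) + \<theta> (odd_part m)"

definition "even_multiplier d \<longleftrightarrow> d \<in> multipliers \<and> g o\<^sub>C\<^sub>L d o\<^sub>C\<^sub>L g = d"

lemma even_plus_odd: "even_part m + odd_part m = m"
  by (simp add: even_part_def odd_part_def flip: scaleC_add_right)
    (simp add: scaleC_add_right flip: scaleC_add_left)

lemma g_g: "g o\<^sub>C\<^sub>L (g o\<^sub>C\<^sub>L m) = m"
  by (simp add: g_square flip: compose_assoc)

lemma graded_split:
  assumes "even_multiplier d" "x \<in> W"
  shows "even_part (d + x) = d" "odd_part (d + x) = x"
proof -
  have "g o\<^sub>C\<^sub>L (d + x) o\<^sub>C\<^sub>L g = d - x"
    using assms by (simp add: even_multiplier_def compose_simps g_odd)
  then show "even_part (d + x) = d" "odd_part (d + x) = x"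
    by (simp_all add: even_part_def odd_part_def flip: scaleC_add_left)
      (simp_all add: scaleC_add_right flip: scaleC_add_left)
qed

lemma graded_intro:
  assumes "even_multiplier d" "x \<in> W"
  shows "d + x \<in> graded_algebra" "graded_rep (d + x) = \<pi> d + \<theta> x"
  using assms graded_split[OF assms] by (auto simp: graded_algebra_def graded_rep_def even_multiplier_def)

lemma graded_cases:
  assumes "m \<in> graded_algebra"
  obtains d x where "m = d + x" "even_multiplier d" "x \<in> W"
proof
  show "m = even_part m + odd_part m" by (simp add: even_plus_odd)
  show "even_multiplier (even_part m)"
    using assms by (simp add: even_multiplier_def graded_algebra_def even_part_def compose_simps
        compose_assoc g_g g_square add.commute)
qed (use assms in \<open>simp add: graded_algebra_def\<close>)

lemma even_multiplier_intros:
  "even_multiplier d \<Longrightarrow> even_multiplier e \<Longrightarrow> even_multiplier (d + e)"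
  "even_multiplier d \<Longrightarrow> even_multiplier (c *\<^sub>C d)"
  "even_multiplier d \<Longrightarrow> even_multiplier (adj d)"
  "even_multiplier cblinfun_id" "even_multiplier 0"
proof -
  show "even_multiplier (adj d)" if "even_multiplier d"
  proof -
    have "g o\<^sub>C\<^sub>L (adj d o\<^sub>C\<^sub>L g) = adj (g o\<^sub>C\<^sub>L d o\<^sub>C\<^sub>L g)" by (simp add: adj_compose g_adj)
    with that show ?thesis by (auto simp: even_multiplier_def compose_assoc intro: multiplier_intros)
  qed
qed (auto simp: even_multiplier_def compose_simps g_square intro: multiplier_intros)

lemma even_multiplier_compose:
  assumes "even_multiplier d" "even_multiplier e" shows "even_multiplier (d o\<^sub>C\<^sub>L e)"
proof -
  have "g o\<^sub>C\<^sub>L (d o\<^sub>C\<^sub>L e) o\<^sub>C\<^sub>L g = (g o\<^sub>C\<^sub>L d o\<^sub>C\<^sub>L g) o\<^sub>C\<^sub>L (g o\<^sub>C\<^sub>L e o\<^sub>C\<^sub>L g)"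
    by (simp add: compose_assoc g_g)
  with assms show ?thesis by (auto simp: even_multiplier_def intro: multiplier_intros)
qed

lemma even_multiplier_products:
  assumes "x \<in> W" "y \<in> W" shows "even_multiplier (x o\<^sub>C\<^sub>L y)"
proof -
  have "g o\<^sub>C\<^sub>L (x o\<^sub>C\<^sub>L y) o\<^sub>C\<^sub>L g = (g o\<^sub>C\<^sub>L x o\<^sub>C\<^sub>L g) o\<^sub>C\<^sub>L (g o\<^sub>C\<^sub>L y o\<^sub>C\<^sub>L g)"
    by (simp add: compose_assoc g_g)
  also have "\<dots> = x o\<^sub>C\<^sub>L y" using assms by (simp add: g_odd compose_simps)
  finally show ?thesis using assms by (simp add: even_multiplier_def multiplier_products)
qed

text \<open>In the application this, together with the identity, puts all diagonal scalars of the
  Paulsen system into \<open>graded_algebra\<close>.\<close>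

lemma even_multiplier_g: "even_multiplier g"
  by (auto simp: even_multiplier_def multipliers_def g_adj g_W g_square)

lemma graded_algebra_W: "x \<in> W \<Longrightarrow> x \<in> graded_algebra \<and> graded_rep x = \<theta> x"
  using graded_intro[OF even_multiplier_intros(5), of x] rep_scaleC[OF multiplier_id, of 0] by simp

lemma graded_algebra_even: "even_multiplier d \<Longrightarrow> d \<in> graded_algebra \<and> graded_rep d = \<pi> d"
  using graded_intro[of d 0] clinear_on_zero[OF linear csubspace_W] by (simp add: W_intros)

lemma graded_rep_id: "graded_rep cblinfun_id = cblinfun_id"
  using graded_algebra_even[OF even_multiplier_intros(4)] by (simp add: rep_id)

text \<open>Products of equal parity are even multipliers and mixed products lie in
  \<open>W\<close>; the four terms are matched by \<open>rep_compose\<close>,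
  \<open>rep_products\<close>, \<open>rep_theta\<close> and \<open>theta_rep\<close>.\<close>

lemma graded_product:
  assumes "even_multiplier d" "x \<in> W" "even_multiplier e" "y \<in> W"
  shows "(d + x) o\<^sub>C\<^sub>L (e + y) \<in> graded_algebra"
    and "graded_rep ((d + x) o\<^sub>C\<^sub>L (e + y)) = graded_rep (d + x) o\<^sub>C\<^sub>L graded_rep (e + y)"
proof -
  have eq: "(d + x) o\<^sub>C\<^sub>L (e + y) = (d o\<^sub>C\<^sub>L e + x o\<^sub>C\<^sub>L y) + (d o\<^sub>C\<^sub>L y + x o\<^sub>C\<^sub>L e)"
    by (simp add: compose_simps)
  have ev: "even_multiplier (d o\<^sub>C\<^sub>L e + x o\<^sub>C\<^sub>L y)"
    using assms by (intro even_multiplier_intros even_multiplier_compose even_multiplier_products)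
  have m: "d \<in> multipliers" "e \<in> multipliers" using assms by (auto simp: even_multiplier_def)
  have odd: "d o\<^sub>C\<^sub>L y + x o\<^sub>C\<^sub>L e \<in> W"
    using assms m by (intro W_intros multiplier_W multiplier_W_right)
  show "(d + x) o\<^sub>C\<^sub>L (e + y) \<in> graded_algebra" unfolding eq by (rule graded_intro[OF ev odd])
  show "graded_rep ((d + x) o\<^sub>C\<^sub>L (e + y)) = graded_rep (d + x) o\<^sub>C\<^sub>L graded_rep (e + y)"
    unfolding eq graded_intro(2)[OF ev odd] graded_intro(2)[OF assms(1,2)] graded_intro(2)[OF assms(3,4)]
    using assms m
    by (simp add: rep_add rep_compose rep_products multiplier_products multiplier_compose theta_linear
        multiplier_W multiplier_W_right theta_rep rep_theta compose_simps)
qed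

lemma graded_adj:
  assumes "even_multiplier d" "x \<in> W"
  shows "adj (d + x) \<in> graded_algebra" "graded_rep (adj (d + x)) = adj (graded_rep (d + x))"
  using assms graded_intro[OF even_multiplier_intros(3)[OF assms(1)] adj_W[OF assms(2)]]
  by (simp_all add: adj_add graded_intro(2)[OF assms] theta_adj rep_adj even_multiplier_def)

lemma graded_linear:
  assumes "even_multiplier d" "x \<in> W" "even_multiplier e" "y \<in> W"
  shows "(d + x) + (e + y) \<in> graded_algebra" "c *\<^sub>C (d + x) \<in> graded_algebra"
    and "graded_rep ((d + x) + (e + y)) = graded_rep (d + x) + graded_rep (e + y)"
    and "graded_rep (c *\<^sub>C (d + x)) = c *\<^sub>C graded_rep (d + x)"
proof -
  have eq: "(d + x) + (e + y) = (d + e) + (x + y)" "c *\<^sub>C (d + x) = c *\<^sub>C d + c *\<^sub>C x"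
    by (simp_all add: scaleC_add_right)
  have 1: "even_multiplier (d + e)" "x + y \<in> W" using assms even_multiplier_intros W_intros by auto
  have 2: "even_multiplier (c *\<^sub>C d)" "c *\<^sub>C x \<in> W" using assms even_multiplier_intros W_intros by auto
  show "(d + x) + (e + y) \<in> graded_algebra" unfolding eq by (rule graded_intro[OF 1])
  show "c *\<^sub>C (d + x) \<in> graded_algebra" unfolding eq by (rule graded_intro[OF 2])
  show "graded_rep ((d + x) + (e + y)) = graded_rep (d + x) + graded_rep (e + y)"
    unfolding eq graded_intro(2)[OF 1] graded_intro(2)[OF assms(1,2)] graded_intro(2)[OF assms(3,4)]
    using assms by (simp add: rep_add theta_linear even_multiplier_def)
  show "graded_rep (c *\<^sub>C (d + x)) = c *\<^sub>C graded_rep (d + x)"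
    unfolding eq graded_intro(2)[OF 2] graded_intro(2)[OF assms(1,2)]
    using assms by (simp add: rep_scaleC theta_linear even_multiplier_def scaleC_add_right)
qed

lemma bounded_linear_parts: "bounded_linear even_part" "bounded_linear odd_part"
proof -
  have conj: "bounded_linear (\<lambda>m. g o\<^sub>C\<^sub>L m o\<^sub>C\<^sub>L g)"
    by (rule bounded_linear_compose[OF bounded_linear_compose_left bounded_linear_compose_right])
  have "even_part = (\<lambda>m. (1 / 2) *\<^sub>R (m + g o\<^sub>C\<^sub>L m o\<^sub>C\<^sub>L g))"
    "odd_part = (\<lambda>m. (1 / 2) *\<^sub>R (m - g o\<^sub>C\<^sub>L m o\<^sub>C\<^sub>L g))"
    by (auto simp: even_part_def odd_part_def scaleR_scaleC)
  then show "bounded_linear even_part" "bounded_linear odd_part"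
    by (auto intro!: bounded_linear_compose[OF bounded_linear_scaleR_right] bounded_linear_add
        bounded_linear_sub bounded_linear_ident conj)
qed

lemma cstar_graded_algebra: "is_cstar_algebra graded_algebra"
proof -
  have "closed graded_algebra"
  proof -
    have "graded_algebra = even_part -` multipliers \<inter> odd_part -` W"
      by (auto simp: graded_algebra_def)
    then show ?thesis
      by (auto intro!: closed_Int closed_vimage closed_multipliers closed_W linear_continuous_on bounded_linear_parts)
  qed
  moreover have "csubspace graded_algebra"
    unfolding csubspace_def using graded_algebra_W[of 0]
    by (auto simp: W_intros elim!: graded_cases intro: graded_linear)
  ultimately show ?thesis
    unfolding is_cstar_algebra_def by (auto elim!: graded_cases intro: graded_adj graded_product)
qed

lemma star_representation_graded_rep: "star_representation graded_algebra graded_rep"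
  unfolding star_representation_def clinear_on_def
  by (auto elim!: graded_cases simp: graded_linear graded_product graded_adj)

text \<open>A crude constant from the continuity of the two parts; the growth argument in
  \<open>star_representation_completely_positive\<close> removes it.\<close>

lemma graded_rep_bounded: "\<exists>K. \<forall>m\<in>graded_algebra. norm (graded_rep m) \<le> K * norm m"
proof -
  obtain K where K: "\<And>m. norm (even_part m) \<le> norm m * K"
    using bounded_linear.bounded[OF bounded_linear_parts(1)] by blast
  obtain K' where K': "\<And>m. norm (odd_part m) \<le> norm m * K'"
    using bounded_linear.bounded[OF bounded_linear_parts(2)] by blast
  have "norm (graded_rep m) \<le> (K + B * K') * norm m" if "m \<in> graded_algebra" for m
  proof -
    have "norm (graded_rep m) \<le> norm (even_part m) + B * norm (odd_part m)"
      unfolding graded_rep_def using that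
      by (intro norm_triangle_le add_mono norm_rep_le theta_bound) (auto simp: graded_algebra_def)
    also have "\<dots> \<le> norm m * K + B * (norm m * K')"
      by (intro add_mono mult_left_mono K K' B_nonneg)
    finally show ?thesis by (simp add: algebra_simps)
  qed
  then show ?thesis by blast
qed

end

section \<open>Complete positivity of bounded representations\<close>

definition vec_inner :: "nat \<Rightarrow> (nat \<Rightarrow> 'a::chilbert_space) \<Rightarrow> (nat \<Rightarrow> 'a) \<Rightarrow> complex"
  where "vec_inner n x y = (\<Sum>i<n. cinner (x i) (y i))"

definition vec_norm :: "nat \<Rightarrow> (nat \<Rightarrow> 'a::chilbert_space) \<Rightarrow> real"
  where "vec_norm n x = L2_set (\<lambda>i. norm (x i)) {..<n}"

definition mat_apply :: "nat \<Rightarrow> ('a::chilbert_space, 'b::chilbert_space) op_mat \<Rightarrow> (nat \<Rightarrow> 'a) \<Rightarrow> nat \<Rightarrow> 'b"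
  where "mat_apply n a x i = (\<Sum>j<n. a i j (x j))"

lemma op_mat_positive_iff:
  "op_mat_positive n a \<longleftrightarrow> (\<forall>h. vec_inner n (mat_apply n a h) h \<in> \<real>\<^sub>\<ge>\<^sub>0)"
  by (simp add: op_mat_positive_def vec_inner_def mat_apply_def)

lemma vec_norm_nonneg [simp]: "0 \<le> vec_norm n x"
  by (simp add: vec_norm_def)

lemma vec_inner_self: "vec_inner n x x = complex_of_real ((vec_norm n x)\<^sup>2)"
  unfolding vec_inner_def vec_norm_def L2_set_def
  by (simp add: sum_nonneg cinner_self del: of_real_power)

lemma vec_inner_cauchy_schwarz: "cmod (vec_inner n x y) \<le> vec_norm n x * vec_norm n y"
proof -
  have "cmod (vec_inner n x y) \<le> (\<Sum>i<n. \<bar>norm (x i)\<bar> * \<bar>norm (y i)\<bar>)"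
    unfolding vec_inner_def by (rule sum_norm_le) (simp add: cinner_cauchy_schwarz)
  also have "\<dots> \<le> vec_norm n x * vec_norm n y"
    unfolding vec_norm_def by (rule L2_set_mult_ineq)
  finally show ?thesis .
qed

lemma vec_inner_linear:
  "vec_inner n (\<lambda>i. x i + y i) z = vec_inner n x z + vec_inner n y z"
  "vec_inner n z (\<lambda>i. x i + y i) = vec_inner n z x + vec_inner n z y"
  "vec_inner n (\<lambda>i. x i - y i) z = vec_inner n x z - vec_inner n y z"
  "vec_inner n z (\<lambda>i. x i - y i) = vec_inner n z x - vec_inner n z y"
  "vec_inner n (\<lambda>i. c *\<^sub>C x i) z = c * vec_inner n x z"
  "vec_inner n z (\<lambda>i. c *\<^sub>C x i) = cnj c * vec_inner n z x"
  by (simp_all add: vec_inner_def cinner_simps sum.distrib sum_subtractf sum_distrib_left)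

lemma mat_apply_linear:
  "mat_apply n a (\<lambda>i. x i + y i) = (\<lambda>i. mat_apply n a x i + mat_apply n a y i)"
  "mat_apply n a (\<lambda>i. x i - y i) = (\<lambda>i. mat_apply n a x i - mat_apply n a y i)"
  "mat_apply n a (\<lambda>i. c *\<^sub>C x i) = (\<lambda>i. c *\<^sub>C mat_apply n a x i)"
  by (auto simp: mat_apply_def cblinfun_apply_simps sum.distrib sum_subtractf scaleC_sum)

lemma vec_inner_cong: "(\<And>i. i < n \<Longrightarrow> x i = x' i) \<Longrightarrow> (\<And>i. i < n \<Longrightarrow> y i = y' i) \<Longrightarrow>
  vec_inner n x y = vec_inner n x' y'"
  by (simp add: vec_inner_def)

lemma vec_norm_cong: "(\<And>i. i < n \<Longrightarrow> x i = x' i) \<Longrightarrow> vec_norm n x = vec_norm n x'"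
  unfolding vec_norm_def by (rule L2_set_cong) auto

lemma vec_norm_le_sum: "vec_norm n x \<le> (\<Sum>i<n. norm (x i))"
  unfolding vec_norm_def by (rule L2_set_le_sum) simp

lemma norm_le_vec_norm: "i < n \<Longrightarrow> norm (x i) \<le> vec_norm n x"
  unfolding vec_norm_def by (rule member_le_L2_set) auto

lemma vec_norm_mat_apply_bound:
  "vec_norm n (mat_apply n a x) \<le> (\<Sum>i<n. \<Sum>j<n. norm (a i j)) * vec_norm n x"
proof -
  have "vec_norm n (mat_apply n a x) \<le> (\<Sum>i<n. norm (mat_apply n a x i))" by (rule vec_norm_le_sum)
  also have "\<dots> \<le> (\<Sum>i<n. \<Sum>j<n. norm (a i j) * vec_norm n x)"
    unfolding mat_apply_def
  proof (intro sum_mono order_trans[OF norm_sum] sum_mono)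
    fix i j assume "j \<in> {..<n}"
    then show "norm (a i j (x j)) \<le> norm (a i j) * vec_norm n x"
      using norm_cblinfun_apply[of "a i j" "x j"] mult_left_mono[OF norm_le_vec_norm[of j n x], of "norm (a i j)"]
      by simp
  qed
  finally show ?thesis by (simp add: sum_distrib_right)
qed

lemma vec_inner_delta: "i < n \<Longrightarrow> vec_inner n x (\<lambda>k. if k = i then y else 0) = cinner (x i) y"
  "i < n \<Longrightarrow> vec_inner n (\<lambda>k. if k = i then y else 0) x = cinner y (x i)"
  by (simp_all add: vec_inner_def if_distrib[of "cinner _"] if_distrib[of "\<lambda>u. cinner u _"] cong: if_cong)

lemma mat_apply_delta: "j < n \<Longrightarrow> mat_apply n a (\<lambda>k. if k = j then y else 0) i = a i j y"
  by (simp add: mat_apply_def if_distrib[of "cblinfun_apply _"] cong: if_cong)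

lemma vec_norm_delta: "j < n \<Longrightarrow> vec_norm n (\<lambda>k. if k = j then y else 0) = norm y"
proof -
  assume "j < n"
  then have "complex_of_real ((vec_norm n (\<lambda>k. if k = j then y else 0))\<^sup>2) = complex_of_real ((norm y)\<^sup>2)"
    by (simp add: vec_inner_self[symmetric] vec_inner_delta cinner_self del: of_real_power)
  then show ?thesis by (simp only: of_real_eq_iff power2_eq_iff_nonneg norm_ge_zero vec_norm_nonneg)
qed

text \<open>\<open>p\<close> and \<open>q\<close> stand for the two cross terms of a form that is
  real on the diagonal. The hypotheses are its reality at x + y and at \<i> x + y, less the diagonal
  terms.\<close>

lemma cnj_eq_of_real_polarization:
  assumes "Im (p + q) = 0" "Im (\<i> * p - \<i> * q) = 0" shows "p = cnj q"
  using assms by (intro complex_eqI) auto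

lemma op_mat_positive_symmetric:
  assumes pos: "op_mat_positive n a"
  shows "vec_inner n (mat_apply n a x) y = vec_inner n x (mat_apply n a y)"
proof -
  let ?s = "\<lambda>x y. vec_inner n (mat_apply n a x) y"
  have real: "Im (?s x x) = 0" for x
    using pos by (auto simp: op_mat_positive_iff complex_nonneg_Reals_iff)
  have "?s x y = cnj (?s y x)"
  proof (rule cnj_eq_of_real_polarization)
    show "Im (?s x y + ?s y x) = 0"
      using real[of "\<lambda>i. x i + y i"] real[of x] real[of y]
      by (simp add: mat_apply_linear vec_inner_linear)
    show "Im (\<i> * ?s x y - \<i> * ?s y x) = 0"
      using real[of "\<lambda>i. \<i> *\<^sub>C x i + y i"] real[of x] real[of y]
      by (simp add: mat_apply_linear vec_inner_linear)
  qed
  also have "\<dots> = vec_inner n x (mat_apply n a y)"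
    by (simp add: vec_inner_def cinner_commute[symmetric])
  finally show ?thesis .
qed

lemma op_mat_positive_adj:
  assumes pos: "op_mat_positive n a" and ij: "i < n" "j < n"
  shows "adj (a i j) = a j i"
proof (rule adj_eqI)
  fix x y
  show "cinner (a i j x) y = cinner x (a j i y)"
    using op_mat_positive_symmetric[OF pos, of "\<lambda>k. if k = j then x else 0" "\<lambda>k. if k = i then y else 0"] ij
    by (simp add: vec_inner_delta mat_apply_delta)
qed

lemma mat_apply_symmetric:
  assumes "\<And>i j. i < n \<Longrightarrow> j < n \<Longrightarrow> adj (d i j) = d j i"
  shows "vec_inner n (mat_apply n d x) y = vec_inner n x (mat_apply n d y)"
proof -
  have "vec_inner n (mat_apply n d x) y = (\<Sum>i<n. \<Sum>j<n. cinner (x j) (d j i (y i)))"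
    unfolding vec_inner_def mat_apply_def cinner_sum_left
    by (intro sum.cong refl) (auto simp: cinner_adj_right assms)
  also have "\<dots> = vec_inner n x (mat_apply n d y)"
    unfolding vec_inner_def mat_apply_def cinner_sum_right by (rule sum.swap)
  finally show ?thesis .
qed

primrec mat_power :: "nat \<Rightarrow> ('a::chilbert_space, 'a) op_mat \<Rightarrow> nat \<Rightarrow> ('a, 'a) op_mat" where
  "mat_power n c 0 = (\<lambda>i j. if i = j then cblinfun_id else 0)"
| "mat_power n c (Suc m) = (\<lambda>i j. \<Sum>k<n. c i k o\<^sub>C\<^sub>L mat_power n c m k j)"

lemma mat_apply_mat_power_0: "i < n \<Longrightarrow> mat_apply n (mat_power n c 0) x i = x i"
  by (simp add: mat_apply_def if_distrib[of cblinfun_apply] if_distribR cong: if_cong)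

lemma mat_apply_product:
  "mat_apply n (\<lambda>i j. \<Sum>k<n. c i k o\<^sub>C\<^sub>L d k j) x = mat_apply n c (mat_apply n d x)"
proof
  fix i
  show "mat_apply n (\<lambda>i j. \<Sum>k<n. c i k o\<^sub>C\<^sub>L d k j) x i = mat_apply n c (mat_apply n d x) i"
    by (simp add: mat_apply_def sum_cblinfun_apply cblinfun_apply_sum) (rule sum.swap)
qed

text \<open>No square root of \<open>a\<close> is used: the point is the inequality ||a x||^2 \<le>
  L <a x, x>, after which expanding ||L x - a x||^2 suffices.\<close>

lemma positive_mat_complement_contraction:
  assumes pos: "op_mat_positive n a" and L: "L > 0"
    and bound: "\<And>x. vec_norm n (mat_apply n a x) \<le> L * vec_norm n x"
    and c: "c = (\<lambda>i j. (if i = j then complex_of_real L *\<^sub>C cblinfun_id else 0) - a i j)"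
  shows "vec_norm n (mat_apply n c x) \<le> L * vec_norm n x"
proof -
  let ?a = "mat_apply n a"
  let ?y = "?a x"
  have cx: "mat_apply n c x i = complex_of_real L *\<^sub>C x i - ?y i" if "i < n" for i
    using that unfolding c mat_apply_def
    by (simp add: sum_subtractf if_distrib[of cblinfun_apply] if_distribR cong: if_cong)
  have yy: "vec_inner n (?a ?y) x = vec_inner n ?y ?y" "vec_inner n x ?y = vec_inner n ?y x"
    using op_mat_positive_symmetric[OF pos] by metis+
  have "Re (vec_inner n (?a ?y) ?y) \<le> vec_norm n (?a ?y) * vec_norm n ?y"
    by (meson vec_inner_cauchy_schwarz complex_Re_le_cmod order_trans)
  also have "\<dots> \<le> L * vec_norm n ?y * vec_norm n ?y" by (intro mult_right_mono bound) simp
  finally have 1: "Re (vec_inner n (?a ?y) ?y) \<le> L * (vec_norm n ?y)\<^sup>2"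
    by (simp add: power2_eq_square)
  \<comment> \<open>Positivity of \<open>a\<close> at x - (a x)/L, combined with fact 1, yields the
    inequality labelled 2.\<close>
  let ?z = "\<lambda>i. x i - complex_of_real (1 / L) *\<^sub>C ?y i"
  have "0 \<le> Re (vec_inner n (?a ?z) ?z)"
    using pos by (auto simp: op_mat_positive_iff complex_nonneg_Reals_iff)
  also have "Re (vec_inner n (?a ?z) ?z)
    = Re (vec_inner n ?y x) - 2 / L * (vec_norm n ?y)\<^sup>2 + (1 / L)\<^sup>2 * Re (vec_inner n (?a ?y) ?y)"
    unfolding mat_apply_linear vec_inner_linear yy
    by (simp add: vec_inner_self power2_eq_square)
  also have "\<dots> \<le> Re (vec_inner n ?y x) - 2 / L * (vec_norm n ?y)\<^sup>2 + (1 / L)\<^sup>2 * (L * (vec_norm n ?y)\<^sup>2)"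
    using 1 by (intro add_left_mono mult_left_mono) auto
  finally have 2: "(vec_norm n ?y)\<^sup>2 \<le> L * Re (vec_inner n ?y x)"
    using L by (simp add: field_simps power2_eq_square)
  have "complex_of_real ((vec_norm n (mat_apply n c x))\<^sup>2)
    = vec_inner n (\<lambda>i. complex_of_real L *\<^sub>C x i - ?y i) (\<lambda>i. complex_of_real L *\<^sub>C x i - ?y i)"
    unfolding vec_inner_self[symmetric] by (rule vec_inner_cong) (auto simp: cx)
  also have "\<dots> = L\<^sup>2 * (vec_norm n x)\<^sup>2 - 2 * L * vec_inner n ?y x + (vec_norm n ?y)\<^sup>2"
    unfolding vec_inner_linear yy
    by (simp add: vec_inner_self power2_eq_square algebra_simps)
  finally have "(vec_norm n (mat_apply n c x))\<^sup>2
    = Re (L\<^sup>2 * (vec_norm n x)\<^sup>2 - 2 * L * vec_inner n ?y x + (vec_norm n ?y)\<^sup>2)"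
    by (metis Re_complex_of_real)
  also have "\<dots> = L\<^sup>2 * (vec_norm n x)\<^sup>2 - 2 * L * Re (vec_inner n ?y x) + (vec_norm n ?y)\<^sup>2"
    by (simp add: Re_power_real flip: of_real_power)
  also have "\<dots> \<le> L\<^sup>2 * (vec_norm n x)\<^sup>2"
  proof -
    have key: "X - 2 * L * R + y \<le> X" if "y \<le> L * R" "0 \<le> y" for X R y :: real
      using that by (simp add: algebra_simps)
    show ?thesis by (rule key[OF 2]) simp
  qed
  finally have "(vec_norm n (mat_apply n c x))\<^sup>2 \<le> (L * vec_norm n x)\<^sup>2" by (simp add: power_mult_distrib)
  then show ?thesis by (rule power2_le_imp_le) (use L in simp)
qed

lemma cstar_algebra_csubspace: "is_cstar_algebra A \<Longrightarrow> csubspace A"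
  by (simp add: is_cstar_algebra_def)

text \<open>Instead of factoring a positive matrix as b^* b, write it as L - c with c self-adjoint
  and bounded by L. The iterates of \<Phi>(c) on h have log-convex norms and grow at most like L^m,
  so ||\<Phi>(c) h|| \<le> L ||h|| and L - \<Phi>(c) is positive.\<close>

lemma star_representation_completely_positive:
  assumes A: "is_cstar_algebra A" and id: "cblinfun_id \<in> A"
    and rep: "star_representation A \<Phi>" and unital: "\<Phi> cblinfun_id = cblinfun_id"
    and bound: "\<And>m. m \<in> A \<Longrightarrow> norm (\<Phi> m) \<le> K * norm m"
  shows "completely_positive A \<Phi>"
  unfolding completely_positive_def
proof (intro allI ballI impI)
  fix n a assume a: "a \<in> mats_over n A" and pos: "op_mat_positive n a"
  have aA: "a i j \<in> A" if "i < n" "j < n" for i j using a that by (auto simp: mats_over_def)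
  have sub: "csubspace A" and lin: "clinear_on A \<Phi>"
    using A rep by (auto simp: is_cstar_algebra_def star_representation_def)
  \<comment> \<open>The double sum bounds the operator norm of the matrix; the summand 1 keeps
    \<open>L\<close> positive.\<close>
  define L where "L = 1 + (\<Sum>i<n. \<Sum>j<n. norm (a i j))"
  have L: "L > 0" unfolding L_def by (simp add: sum_nonneg add_pos_nonneg)
  define c where "c = (\<lambda>i j. (if i = j then complex_of_real L *\<^sub>C cblinfun_id else 0) - a i j)"
  have contr: "vec_norm n (mat_apply n c x) \<le> L * vec_norm n x" for x
  proof (rule positive_mat_complement_contraction[OF pos L _ c_def])
    fix x
    show "vec_norm n (mat_apply n a x) \<le> L * vec_norm n x"
      unfolding L_def distrib_right
      by (rule add_increasing[OF _ vec_norm_mat_apply_bound]) simp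
  qed
  have cA: "c i j \<in> A" if "i < n" "j < n" for i j
    unfolding c_def using that by (auto intro!: csubspace_intros[OF sub] aA id)
  have PA: "mat_power n c m i j \<in> A" if "i < n" "j < n" for m i j
    using that
  proof (induction m arbitrary: i j)
    case (Suc m)
    have "c i k o\<^sub>C\<^sub>L mat_power n c m k j \<in> A" if "k < n" for k
      using A cA[OF Suc.prems(1) that] Suc.IH[OF that Suc.prems(2)] unfolding is_cstar_algebra_def by blast
    then show ?case by (auto intro!: csubspace_sum[OF sub])
  qed (auto intro: id csubspace_zero[OF sub])
  have P_contr: "vec_norm n (mat_apply n (mat_power n c m) x) \<le> L ^ m * vec_norm n x" for m x
  proof (induction m)
    case 0
    have "vec_norm n (mat_apply n (mat_power n c 0) x) = vec_norm n x"
      by (rule vec_norm_cong) (rule mat_apply_mat_power_0)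
    then show ?case by simp
  next
    case (Suc m)
    have "vec_norm n (mat_apply n (mat_power n c (Suc m)) x)
      \<le> L * vec_norm n (mat_apply n (mat_power n c m) x)"
      by (simp add: mat_apply_product contr)
    also have "\<dots> \<le> L * (L ^ m * vec_norm n x)" using Suc L by simp
    finally show ?case by (simp add: mult.assoc)
  qed
  have P_norm: "norm (mat_power n c m i j) \<le> L ^ m" if "i < n" "j < n" for m i j
  proof (rule norm_cblinfun_bound)
    fix y
    have "norm (mat_power n c m i j y)
      \<le> vec_norm n (mat_apply n (mat_power n c m) (\<lambda>k. if k = j then y else 0))"
      using norm_le_vec_norm[OF that(1), of "mat_apply n (mat_power n c m) (\<lambda>k. if k = j then y else 0)"]
      by (simp add: mat_apply_delta[OF that(2)])
    also have "\<dots> \<le> L ^ m * norm y" using P_contr[of m "\<lambda>k. if k = j then y else 0"] vec_norm_delta[OF that(2), of y] by simp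
    finally show "norm (mat_power n c m i j y) \<le> L ^ m * norm y" .
  qed (use L in simp)
  let ?\<Phi>c = "\<lambda>i j. \<Phi> (c i j)"
  have \<Phi>c_adj: "adj (\<Phi> (c i j)) = \<Phi> (c j i)" if "i < n" "j < n" for i j
  proof -
    have "adj (c i j) = c j i"
      using op_mat_positive_adj[OF pos that] by (auto simp: c_def adj_simps)
    then show ?thesis using rep cA[OF that] by (metis star_representation_def)
  qed
  have sym: "vec_inner n (mat_apply n ?\<Phi>c x) y = vec_inner n x (mat_apply n ?\<Phi>c y)" for x y
    by (rule mat_apply_symmetric) (rule \<Phi>c_adj)
  have "vec_inner n (mat_apply n (\<lambda>i j. \<Phi> (a i j)) h) h \<in> \<real>\<^sub>\<ge>\<^sub>0" for h
  proof -
    define v where "v m = mat_apply n (\<lambda>i j. \<Phi> (mat_power n c m i j)) h" for m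
    have v0: "v 0 i = h i" if "i < n" for i
      using that clinear_on_zero[OF lin sub]
      by (simp add: v_def mat_apply_def if_distrib[of \<Phi>] unital if_distrib[of cblinfun_apply] if_distribR cong: if_cong)
    have v_Suc: "v (Suc m) i = mat_apply n ?\<Phi>c (v m) i" if i: "i < n" for m i
    proof -
      have "\<Phi> (mat_power n c (Suc m) i j) = (\<Sum>k<n. \<Phi> (c i k) o\<^sub>C\<^sub>L \<Phi> (mat_power n c m k j))" if j: "j < n" for j
      proof -
        have "\<Phi> (mat_power n c (Suc m) i j) = (\<Sum>k<n. \<Phi> (c i k o\<^sub>C\<^sub>L mat_power n c m k j))"
          unfolding mat_power.simps
          by (rule clinear_on_sum[OF lin sub]) (use A cA PA i j in \<open>auto simp: is_cstar_algebra_def\<close>)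
        also have "\<dots> = (\<Sum>k<n. \<Phi> (c i k) o\<^sub>C\<^sub>L \<Phi> (mat_power n c m k j))"
          using rep cA PA i j by (intro sum.cong refl) (auto simp: star_representation_def)
        finally show ?thesis .
      qed
      then have "v (Suc m) i = mat_apply n (\<lambda>i j. \<Sum>k<n. \<Phi> (c i k) o\<^sub>C\<^sub>L \<Phi> (mat_power n c m k j)) h i"
        unfolding v_def mat_apply_def by (intro sum.cong refl) (simp del: mat_power.simps)
      then show ?thesis unfolding mat_apply_product v_def .
    qed
    have le: "vec_norm n (v 1) \<le> L * vec_norm n (v 0)"
    proof (rule log_convex_growth[of "\<lambda>m. vec_norm n (v m)"])
      show "(vec_norm n (v (Suc m)))\<^sup>2 \<le> vec_norm n (v m) * vec_norm n (v (Suc (Suc m)))" for m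
      proof -
        have "complex_of_real ((vec_norm n (v (Suc m)))\<^sup>2) = vec_inner n (mat_apply n ?\<Phi>c (v m)) (v (Suc m))"
          unfolding vec_inner_self[symmetric] by (rule vec_inner_cong) (auto simp: v_Suc)
        also have "\<dots> = vec_inner n (v m) (v (Suc (Suc m)))"
          unfolding sym by (rule vec_inner_cong) (auto simp: v_Suc)
        finally have "(vec_norm n (v (Suc m)))\<^sup>2 = cmod (vec_inner n (v m) (v (Suc (Suc m))))"
          by (metis abs_of_nonneg norm_of_real zero_le_power2)
        then show ?thesis by (simp add: vec_inner_cauchy_schwarz)
      qed
      \<comment> \<open>The powers of c are estimated in the source algebra, so \<open>K\<close> and
        \<open>h\<close> enter only the constant and not the rate \<open>L\<close>.\<close>
      show "vec_norm n (v m) \<le> (\<Sum>i<n. \<Sum>j<n. \<bar>K\<bar> * norm (h j)) * L ^ m" for m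
      proof -
        have "vec_norm n (v m) \<le> (\<Sum>i<n. norm (v m i))" by (rule vec_norm_le_sum)
        also have "\<dots> \<le> (\<Sum>i<n. \<Sum>j<n. \<bar>K\<bar> * norm (h j) * L ^ m)"
          unfolding v_def mat_apply_def
        proof (intro sum_mono order_trans[OF norm_sum] sum_mono)
          fix i j assume "i \<in> {..<n}" "j \<in> {..<n}"
          then have ij: "i < n" "j < n" by auto
          have "norm (\<Phi> (mat_power n c m i j)) \<le> \<bar>K\<bar> * norm (mat_power n c m i j)"
            by (rule order_trans[OF bound[OF PA[OF ij]]]) (simp add: mult_right_mono)
          also have "\<dots> \<le> \<bar>K\<bar> * L ^ m" using P_norm[OF ij] by (simp add: mult_left_mono)
          finally have 1: "norm (\<Phi> (mat_power n c m i j)) \<le> \<bar>K\<bar> * L ^ m" .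
          have "norm (\<Phi> (mat_power n c m i j) (h j)) \<le> norm (\<Phi> (mat_power n c m i j)) * norm (h j)"
            by (rule norm_cblinfun_apply)
          also have "\<dots> \<le> \<bar>K\<bar> * L ^ m * norm (h j)" using 1 by (simp add: mult_right_mono)
          finally show "norm (\<Phi> (mat_power n c m i j) (h j)) \<le> \<bar>K\<bar> * norm (h j) * L ^ m"
            by (simp add: ac_simps)
        qed
        finally show ?thesis by (simp only: sum_distrib_right)
      qed
    qed (use L in auto)
    have v1: "vec_norm n (mat_apply n ?\<Phi>c h) \<le> L * vec_norm n h"
    proof -
      have "vec_norm n (v 1) = vec_norm n (mat_apply n ?\<Phi>c h)"
        by (rule vec_norm_cong) (simp add: v_Suc mat_apply_def v0)
      moreover have "vec_norm n (v 0) = vec_norm n h" by (rule vec_norm_cong) (simp add: v0)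
      ultimately show ?thesis using le by simp
    qed
    let ?q = "vec_inner n (mat_apply n ?\<Phi>c h) h"
    have eq: "vec_inner n (mat_apply n (\<lambda>i j. \<Phi> (a i j)) h) h = L * vec_inner n h h - ?q"
    proof -
      have "\<Phi> (c i j) = (if i = j then complex_of_real L *\<^sub>C cblinfun_id else 0) - \<Phi> (a i j)" if "i < n" "j < n" for i j
        unfolding c_def using that
        by (auto simp: clinear_on_diff[OF lin sub] clinear_on_scaleC[OF lin] clinear_on_minus[OF lin]
            clinear_on_zero[OF lin sub] unital id aA csubspace_intros[OF sub])
      then have "mat_apply n ?\<Phi>c h i = complex_of_real L *\<^sub>C h i - mat_apply n (\<lambda>i j. \<Phi> (a i j)) h i" if "i < n" for i
        using that unfolding mat_apply_def
        by (simp add: sum_subtractf if_distrib[of cblinfun_apply] if_distribR cong: if_cong)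
      then have "?q = vec_inner n (\<lambda>i. complex_of_real L *\<^sub>C h i - mat_apply n (\<lambda>i j. \<Phi> (a i j)) h i) h"
        by (intro vec_inner_cong) auto
      then show ?thesis by (simp add: vec_inner_linear)
    qed
    have "cnj ?q = ?q"
      using sym[of h h] by (simp add: vec_inner_def cinner_commute[symmetric])
    then have "Im ?q = 0" by (simp add: complex_eq_iff)
    moreover have "Re ?q \<le> L * (vec_norm n h)\<^sup>2"
    proof -
      have "Re ?q \<le> vec_norm n (mat_apply n ?\<Phi>c h) * vec_norm n h"
        by (meson vec_inner_cauchy_schwarz complex_Re_le_cmod order_trans)
      also have "\<dots> \<le> L * vec_norm n h * vec_norm n h" using v1 by (simp add: mult_right_mono)
      finally show ?thesis by (simp add: power2_eq_square)
    qed
    ultimately show ?thesis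
      unfolding eq complex_nonneg_Reals_iff by (simp add: vec_inner_self flip: of_real_power of_real_mult)
  qed
  then show "op_mat_positive n (\<lambda>i j. \<Phi> (a i j))" by (simp add: op_mat_positive_iff)
qed

section \<open>Multiplicative domains of unital completely positive maps\<close>

lemma id_minus_positive:
  assumes "norm s \<le> 1"
  shows "cinner ((cblinfun_id - adj s o\<^sub>C\<^sub>L s) z) z \<in> \<real>\<^sub>\<ge>\<^sub>0"
proof -
  have "(norm (s z))\<^sup>2 \<le> (norm z)\<^sup>2"
    using norm_cblinfun_apply[of s z] mult_right_mono[OF assms, of "norm z"] by (intro power_mono) auto
  then show ?thesis
    by (simp add: cinner_simps cinner_adj_left cinner_self complex_nonneg_Reals_iff del: of_real_power)
qed

text \<open>The loss of squared norm under 1 - \<open>adj s\<close> s dominates ||s z||^2. This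
  refines contractivity and is the term that telescopes in \<open>norm_defect_pow\<close>.\<close>

lemma id_minus_contraction:
  assumes "norm s \<le> 1"
  shows "(norm ((cblinfun_id - adj s o\<^sub>C\<^sub>L s) z))\<^sup>2 \<le> (norm z)\<^sup>2 - (norm (s z))\<^sup>2"
proof -
  have "norm (adj s (s z)) \<le> norm (s z)"
    using norm_cblinfun_apply[of "adj s" "s z"] mult_right_mono[OF assms, of "norm (s z)"] by simp
  then have le: "(norm (adj s (s z)))\<^sup>2 \<le> (norm (s z))\<^sup>2" by (rule power_mono) simp
  define w where "w = adj s (s z)"
  have "cinner w z = complex_of_real ((norm (s z))\<^sup>2)" "cinner z w = complex_of_real ((norm (s z))\<^sup>2)"
    by (simp_all add: w_def cinner_adj_left cinner_adj_right[symmetric] cinner_self)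
  then have "cinner (z - w) (z - w)
    = complex_of_real ((norm z)\<^sup>2 - 2 * (norm (s z))\<^sup>2 + (norm w)\<^sup>2)"
    by (simp only: cinner_diff_left cinner_diff_right) (simp add: cinner_self)
  then have "(norm ((cblinfun_id - adj s o\<^sub>C\<^sub>L s) z))\<^sup>2
      = (norm z)\<^sup>2 - 2 * (norm (s z))\<^sup>2 + (norm (adj s (s z)))\<^sup>2"
    unfolding cinner_self of_real_eq_iff by (simp add: w_def)
  then show ?thesis using le by simp
qed

text \<open>Turns right factors into left factors: s times a power of 1 - \<open>adj s\<close> s
  lies in \<open>W\<close>, because powers of 1 - s \<open>adj s\<close> are left multipliers of
  \<open>W\<close>.\<close>

lemma intertwine_defect_pow:
  "s o\<^sub>C\<^sub>L cpow (cblinfun_id - adj s o\<^sub>C\<^sub>L s) m = cpow (cblinfun_id - s o\<^sub>C\<^sub>L adj s) m o\<^sub>C\<^sub>L s"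
proof (induction m)
  case (Suc m)
  let ?u = "cblinfun_id - adj s o\<^sub>C\<^sub>L s" and ?v = "cblinfun_id - s o\<^sub>C\<^sub>L adj s"
  have "s o\<^sub>C\<^sub>L cpow ?u (Suc m) = ?v o\<^sub>C\<^sub>L (s o\<^sub>C\<^sub>L cpow ?u m)"
    by (simp add: compose_simps compose_assoc)
  then show ?case by (simp add: Suc compose_assoc)
qed simp

text \<open>The sequence \<open>\<parallel>s u\<^sup>j x\<parallel>\<^sup>2\<close> is decreasing, and it is dominated by the decrements of
  \<open>\<parallel>u\<^sup>j x\<parallel>\<^sup>2\<close>, hence summable.\<close>

lemma norm_defect_pow:
  assumes s: "norm s \<le> 1"
  shows "norm (s o\<^sub>C\<^sub>L cpow (cblinfun_id - adj s o\<^sub>C\<^sub>L s) m) \<le> sqrt (inverse (real (Suc m)))"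
proof (rule norm_cblinfun_bound)
  fix x
  define u where "u = cblinfun_id - adj s o\<^sub>C\<^sub>L s"
  define a where "a j = (norm (s (cpow u j x)))\<^sup>2" for j
  have "a (Suc j) \<le> a j" for j
  proof -
    \<comment> \<open>Moving one factor across s turns it into 1 - s \<open>adj s\<close>, again a
      contraction, so the sequence \<open>a\<close> decreases.\<close>
    have "s (cpow u (Suc j) x) = (cblinfun_id - adj (adj s) o\<^sub>C\<^sub>L adj s) (s (cpow u j x))"
      by (simp add: u_def cblinfun_apply_simps)
    moreover have "(norm ((cblinfun_id - adj (adj s) o\<^sub>C\<^sub>L adj s) y))\<^sup>2 \<le> (norm y)\<^sup>2" for y
      by (rule order_trans[OF id_minus_contraction]) (use s in auto)
    ultimately show ?thesis unfolding a_def by metis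
  qed
  then have "decseq a" by (simp add: decseq_Suc_iff)
  then have "(\<Sum>j\<le>m. a m) \<le> (\<Sum>j\<le>m. a j)" by (intro sum_mono) (simp add: decseq_def)
  also have "\<dots> \<le> (\<Sum>j\<le>m. (norm (cpow u j x))\<^sup>2 - (norm (cpow u (Suc j) x))\<^sup>2)"
  proof (rule sum_mono)
    fix j
    have "X \<le> Y - Z" if "Z \<le> Y - X" for X Y Z :: real using that by simp
    from this[OF id_minus_contraction[OF s, of "cpow u j x"]]
    show "a j \<le> (norm (cpow u j x))\<^sup>2 - (norm (cpow u (Suc j) x))\<^sup>2"
      by (simp add: a_def u_def)
  qed
  also have "\<dots> = (norm (cpow u 0 x))\<^sup>2 - (norm (cpow u (Suc m) x))\<^sup>2"
    by (induction m) auto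
  also have "\<dots> \<le> (norm x)\<^sup>2" by simp
  finally have "a m \<le> inverse (real (Suc m)) * (norm x)\<^sup>2" by (simp add: field_simps)
  then have "sqrt (a m) \<le> sqrt (inverse (real (Suc m)) * (norm x)\<^sup>2)" by (rule real_sqrt_le_mono)
  then show "norm ((s o\<^sub>C\<^sub>L cpow (cblinfun_id - adj s o\<^sub>C\<^sub>L s) m) x) \<le> sqrt (inverse (real (Suc m))) * norm x"
    by (simp add: a_def u_def real_sqrt_mult)
qed simp

text \<open>An odd power is \<open>u\<close> between two copies of \<open>cpow u n\<close>. Odd
  exponents are the ones that the partial sums in \<open>half_le_odd_sum\<close> produce.\<close>

lemma cpow_odd_positive:
  assumes "adj u = u" "\<And>z. cinner (u z) z \<in> \<real>\<^sub>\<ge>\<^sub>0"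
  shows "cinner (cpow u (Suc (2 * n)) x) x \<in> \<real>\<^sub>\<ge>\<^sub>0"
proof -
  have "cpow u (Suc (2 * n)) = cpow u n o\<^sub>C\<^sub>L (u o\<^sub>C\<^sub>L cpow u n)"
    using cpow_add[of u n "Suc n"] by (simp add: mult_2)
  then have "cinner (cpow u (Suc (2 * n)) x) x = cinner (u (cpow u n x)) (cpow u n x)"
    using cinner_adj_left[of "cpow u n"] by (simp add: adj_cpow assms(1))
  then show ?thesis using assms(2) by simp
qed

locale ucp_map =
  fixes A :: "('a::chilbert_space \<Rightarrow>\<^sub>C\<^sub>L 'a) set"
    and \<Phi> :: "('a \<Rightarrow>\<^sub>C\<^sub>L 'a) \<Rightarrow> ('b::chilbert_space \<Rightarrow>\<^sub>C\<^sub>L 'b)"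
  assumes cstar: "is_cstar_algebra A" and id_A: "cblinfun_id \<in> A" and ucp: "ucp A \<Phi>"
begin

lemma csubspace_A: "csubspace A" and compose_A: "x \<in> A \<Longrightarrow> y \<in> A \<Longrightarrow> x o\<^sub>C\<^sub>L y \<in> A"
  and adj_A: "x \<in> A \<Longrightarrow> adj x \<in> A" and closed_A: "closed A"
  using cstar by (auto simp: is_cstar_algebra_def)

lemma linear: "clinear_on A \<Phi>" and unital: "\<Phi> cblinfun_id = cblinfun_id"
  and cp: "completely_positive A \<Phi>"
  using ucp by (auto simp: ucp_def)

lemmas A_intros = csubspace_intros[OF csubspace_A] compose_A adj_A id_A

lemma positive:
  assumes "m \<in> A" "\<And>z. cinner (m z) z \<in> \<real>\<^sub>\<ge>\<^sub>0" shows "cinner (\<Phi> m h) h \<in> \<real>\<^sub>\<ge>\<^sub>0"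
proof -
  have "op_mat_positive 1 (\<lambda>i j. \<Phi> m)"
    using cp assms unfolding completely_positive_def
    by (auto simp: mats_over_def op_mat_positive_def dest!: spec[of _ "1::nat"] bspec[of _ _ "\<lambda>i j. m"])
  then show ?thesis by (auto simp: op_mat_positive_def dest!: spec[of _ "\<lambda>_. h"])
qed

text \<open>The products \<open>adj (x i) o\<^sub>C\<^sub>L x j\<close> form the Gram matrix of a
  row of operators; the image under \<Phi> is the kernel of Stinespring's construction.\<close>

lemma gram_positive:
  fixes n :: nat
  assumes x: "\<And>i. i < n \<Longrightarrow> x i \<in> A"
  shows "(\<Sum>i<n. cinner (\<Sum>j<n. \<Phi> (adj (x i) o\<^sub>C\<^sub>L x j) (h j)) (h i)) \<in> \<real>\<^sub>\<ge>\<^sub>0"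
proof -
  have "op_mat_positive n (\<lambda>i j. adj (x i) o\<^sub>C\<^sub>L x j)"
    unfolding op_mat_positive_def
  proof
    fix h :: "nat \<Rightarrow> 'a"
    have "(\<Sum>i<n. cinner (\<Sum>j<n. (adj (x i) o\<^sub>C\<^sub>L x j) (h j)) (h i))
      = cinner (\<Sum>j<n. x j (h j)) (\<Sum>i<n. x i (h i))"
      by (simp add: cinner_sum_right cinner_adj_left flip: cblinfun_apply_sum)
    then show "(\<Sum>i<n. cinner (\<Sum>j<n. (adj (x i) o\<^sub>C\<^sub>L x j) (h j)) (h i)) \<in> \<real>\<^sub>\<ge>\<^sub>0"
      by (simp add: cinner_self complex_nonneg_Reals_iff del: of_real_power)
  qed
  moreover have "(\<lambda>i j. adj (x i) o\<^sub>C\<^sub>L x j) \<in> mats_over n A"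
    using x by (auto simp: mats_over_def intro: A_intros)
  ultimately have "op_mat_positive n (\<lambda>i j. \<Phi> (adj (x i) o\<^sub>C\<^sub>L x j))"
    using cp unfolding completely_positive_def by blast
  then show ?thesis unfolding op_mat_positive_def by blast
qed

text \<open>The Gram inequality for the triple 1, x, y. The vector in the slot of the unit stays
  free so that \<open>defect_gram\<close> can complete the square in it.\<close>

lemma gram_three:
  assumes "x \<in> A" "y \<in> A"
  shows "cinner a a + cinner (\<Phi> x b) a + cinner (\<Phi> y c) a
    + cinner (\<Phi> (adj x) a) b + cinner (\<Phi> (adj x o\<^sub>C\<^sub>L x) b) b + cinner (\<Phi> (adj x o\<^sub>C\<^sub>L y) c) b
    + cinner (\<Phi> (adj y) a) c + cinner (\<Phi> (adj y o\<^sub>C\<^sub>L x) b) c + cinner (\<Phi> (adj y o\<^sub>C\<^sub>L y) c) c \<in> \<real>\<^sub>\<ge>\<^sub>0"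
proof -
  define f where "f = (\<lambda>i::nat. if i = 0 then cblinfun_id else if i = 1 then x else y)"
  define h where "h = (\<lambda>i::nat. if i = 0 then a else if i = 1 then b else c)"
  have "f i \<in> A" for i using assms id_A by (auto simp: f_def)
  from gram_positive[of 3 f h, OF this] show ?thesis
    by (simp add: eval_nat_numeral f_def h_def unital cinner_add_left algebra_simps)
qed

text \<open>Reality of the Gram form at b and at \<open>\<i> *\<^sub>C b\<close>, with the diagonal
  part subtracted, identifies the two cross terms.\<close>

lemma adj_map:
  assumes "x \<in> A" shows "\<Phi> (adj x) = adj (\<Phi> x)"
proof -
  have im: "Im (cinner (\<Phi> x b) a + cinner (\<Phi> (adj x) a) b) = 0" for a b
    using gram_three[OF assms assms, of a b 0] gram_three[OF assms assms, of 0 b 0]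
    by (simp add: complex_nonneg_Reals_iff cinner_self del: of_real_power)
  have "cinner (\<Phi> x b) a = cinner b (\<Phi> (adj x) a)" for a b
  proof -
    have "cinner (\<Phi> x b) a = cnj (cinner (\<Phi> (adj x) a) b)"
    proof (rule cnj_eq_of_real_polarization[OF im])
      show "Im (\<i> * cinner (\<Phi> x b) a - \<i> * cinner (\<Phi> (adj x) a) b) = 0"
        using im[of "\<i> *\<^sub>C b" a] by (simp add: cblinfun_apply_simps cinner_simps)
    qed
    then show ?thesis by (simp add: cinner_commute[symmetric])
  qed
  then show ?thesis by (metis adj_eqI)
qed

text \<open>The Kadison-Schwarz defect: the Schur complement of the unit entry in the Gram matrix of
  \<Phi>.\<close>

definition defect :: "('a \<Rightarrow>\<^sub>C\<^sub>L 'a) \<Rightarrow> ('a \<Rightarrow>\<^sub>C\<^sub>L 'a) \<Rightarrow> ('b \<Rightarrow>\<^sub>C\<^sub>L 'b)"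
  where "defect x y = \<Phi> (adj x o\<^sub>C\<^sub>L y) - adj (\<Phi> x) o\<^sub>C\<^sub>L \<Phi> y"

lemma adj_defect: "x \<in> A \<Longrightarrow> y \<in> A \<Longrightarrow> adj (defect x y) = defect y x"
  by (simp add: defect_def adj_simps adj_map[symmetric] A_intros)

text \<open>Setting the free vector of \<open>gram_three\<close> to -(\<Phi> x b + \<Phi> y c)
  completes the square in the unit slot and leaves the form of \<open>defect\<close>.\<close>

lemma defect_gram:
  assumes "x \<in> A" "y \<in> A"
  shows "cinner (defect x x b) b + cinner (defect x y c) b + cinner (defect y x b) c
    + cinner (defect y y c) c \<in> \<real>\<^sub>\<ge>\<^sub>0"
proof -
  define p where "p = \<Phi> x b"
  define q where "q = \<Phi> y c"
  have "cinner (adj (\<Phi> x) z) b = cinner z p" "cinner (adj (\<Phi> y) z) c = cinner z q" for z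
    by (simp_all add: p_def q_def cinner_adj_left)
  then show ?thesis
    using gram_three[OF assms, of "- (p + q)" b c]
    by (simp add: defect_def adj_map assms cinner_simps cblinfun_apply_simps
        p_def[symmetric] q_def[symmetric] algebra_simps)
qed

lemma defect_nonneg: "x \<in> A \<Longrightarrow> 0 \<le> Re (cinner (defect x x b) b)"
  using defect_gram[of x x b 0] by (simp add: complex_nonneg_Reals_iff)

text \<open>Cauchy-Schwarz for the positive semidefinite kernel \<open>defect\<close>: a vector
  isotropic in one slot is annihilated by all cross terms.\<close>

lemma defect_vanishes:
  assumes x: "x \<in> A" and y: "y \<in> A" and zero: "Re (cinner (defect y y h) h) \<le> 0"
  shows "defect x y h = 0"
proof (rule ccontr)
  define b where "b = defect x y h"
  assume "defect x y h \<noteq> 0"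
  then have b: "(norm b)\<^sup>2 > 0" by (simp add: b_def)
  define P where "P = Re (cinner (defect x x b) b)"
  \<comment> \<open>Chosen so that the cross terms, -2 t ||b||^2 in total, exceed the diagonal value
    \<open>P\<close> by exactly 1.\<close>
  define t where "t = (P + 1) / (2 * (norm b)\<^sup>2)"
  define c where "c = complex_of_real (- t) *\<^sub>C h"
  have "cinner (defect y x b) h = cinner b (defect x y h)"
    by (simp add: adj_defect[OF x y, symmetric] cinner_adj_left)
  then have yx: "cinner (defect y x b) h = complex_of_real ((norm b)\<^sup>2)"
    by (simp add: b_def cinner_self)
  have "0 \<le> Re (cinner (defect x x b) b + cinner (defect x y c) b + cinner (defect y x b) c
    + cinner (defect y y c) c)"
    using defect_gram[OF x y, of b c] by (simp only: complex_nonneg_Reals_iff)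
  also have "\<dots> = P - 2 * t * (norm b)\<^sup>2 + t\<^sup>2 * Re (cinner (defect y y h) h)"
    by (simp add: c_def cblinfun_apply_simps cinner_simps yx b_def[symmetric] cinner_self P_def
        power2_eq_square del: of_real_power)
  also have "\<dots> \<le> P - 2 * t * (norm b)\<^sup>2" using zero by (simp add: mult_nonneg_nonpos)
  also have "2 * t * (norm b)\<^sup>2 = P + 1" using b by (simp add: t_def)
  finally show False by simp
qed

text \<open>\<Phi> preserves positivity of ||x||^2 - \<open>adj x\<close> x, and the Schwarz
  inequality \<open>defect_nonneg\<close> passes from there to \<open>\<Phi> x\<close>.\<close>

lemma norm_map_le:
  assumes x: "x \<in> A" shows "norm (\<Phi> x) \<le> norm x"
proof (rule norm_cblinfun_bound)
  fix h
  let ?m = "complex_of_real ((norm x)\<^sup>2) *\<^sub>C cblinfun_id - adj x o\<^sub>C\<^sub>L x"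
  have m: "?m \<in> A" using x by (intro A_intros)
  have "cinner (?m z) z \<in> \<real>\<^sub>\<ge>\<^sub>0" for z
  proof -
    have "(norm (x z))\<^sup>2 \<le> (norm x)\<^sup>2 * (norm z)\<^sup>2"
      using power_mono[OF norm_cblinfun_apply[of x z], of 2] by (simp add: power_mult_distrib)
    then show ?thesis
      by (simp add: cinner_simps cinner_adj_left cinner_self complex_nonneg_Reals_iff
          del: of_real_power flip: of_real_mult)
  qed
  from positive[OF m this, of h]
  have "Re (cinner (\<Phi> (adj x o\<^sub>C\<^sub>L x) h) h) \<le> (norm x)\<^sup>2 * (norm h)\<^sup>2"
    using x by (simp add: clinear_on_diff[OF linear csubspace_A] clinear_on_scaleC[OF linear] A_intros
        unital cinner_simps cinner_self complex_nonneg_Reals_iff del: of_real_power flip: of_real_mult)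
  moreover have "(norm (\<Phi> x h))\<^sup>2 \<le> Re (cinner (\<Phi> (adj x o\<^sub>C\<^sub>L x) h) h)"
    using defect_nonneg[OF x, of h] by (simp add: defect_def cinner_simps cinner_adj_left cinner_self)
  ultimately have "(norm (\<Phi> x h))\<^sup>2 \<le> (norm x * norm h)\<^sup>2" by (simp add: power_mult_distrib)
  then show "norm (\<Phi> x h) \<le> norm x * norm h" by (rule power2_le_imp_le) simp
qed simp

text \<open>Choi's multiplicative domain, stated by its bimodule property so that closure under
  products is direct; the Schwarz equalities enter through
  \<open>multiplicative_domainI\<close>.\<close>

definition multiplicative_domain :: "('a \<Rightarrow>\<^sub>C\<^sub>L 'a) set"
  where "multiplicative_domain = {x \<in> A. \<forall>y\<in>A. \<Phi> (y o\<^sub>C\<^sub>L x) = \<Phi> y o\<^sub>C\<^sub>L \<Phi> x \<and> \<Phi> (x o\<^sub>C\<^sub>L y) = \<Phi> x o\<^sub>C\<^sub>L \<Phi> y}"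

text \<open>\<open>defect x x = 0\<close> kills every cross term \<open>defect (adj y) x\<close>,
  which gives multiplicativity with x on the right; the same for \<open>adj x\<close> becomes
  multiplicativity with x on the left after taking adjoints.\<close>

lemma multiplicative_domainI:
  assumes x: "x \<in> A" and zero: "defect x x = 0" "defect (adj x) (adj x) = 0"
  shows "x \<in> multiplicative_domain"
proof -
  have 1: "\<Phi> (y o\<^sub>C\<^sub>L z) = \<Phi> y o\<^sub>C\<^sub>L \<Phi> z" if "y \<in> A" "z \<in> A" "defect z z = 0" for y z
  proof -
    have "defect (adj y) z = 0"
      by (rule cblinfun_eqI) (use that in \<open>simp add: defect_vanishes adj_A\<close>)
    then show ?thesis using that by (simp add: defect_def adj_map)
  qed
  have "\<Phi> (x o\<^sub>C\<^sub>L y) = \<Phi> x o\<^sub>C\<^sub>L \<Phi> y" if y: "y \<in> A" for y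
  proof -
    have "adj (\<Phi> (x o\<^sub>C\<^sub>L y)) = adj (\<Phi> x o\<^sub>C\<^sub>L \<Phi> y)"
      using 1[OF adj_A[OF y] adj_A[OF x] zero(2)] x y
      by (simp add: adj_map[symmetric] adj_compose compose_A)
    then show ?thesis by (metis adj_adj)
  qed
  with 1[OF _ x zero(1)] x show ?thesis by (auto simp: multiplicative_domain_def)
qed

lemma map_tendsto:
  assumes "\<And>n. x n \<in> A" "x \<longlonglongrightarrow> l" "l \<in> A"
  shows "(\<lambda>n. \<Phi> (x n)) \<longlonglongrightarrow> \<Phi> l"
proof -
  have lim: "(\<lambda>n. norm (x n - l)) \<longlonglongrightarrow> 0"
    using assms(2) by (simp add: LIM_zero_iff tendsto_norm_zero_iff)
  have "norm (\<Phi> (x n) - \<Phi> l) \<le> norm (x n - l)" for n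
    using norm_map_le[of "x n - l"] assms
    by (simp add: clinear_on_diff[OF linear csubspace_A] A_intros)
  then have "\<forall>\<^sub>F n in sequentially. norm (\<Phi> (x n) - \<Phi> l) \<le> norm (x n - l)"
    by (intro always_eventually allI)
  from Lim_null_comparison[OF this lim] have "(\<lambda>n. \<Phi> (x n) - \<Phi> l) \<longlonglongrightarrow> 0" .
  then show ?thesis by (simp add: LIM_zero_iff)
qed

lemma cstar_multiplicative_domain: "is_cstar_algebra multiplicative_domain"
  unfolding is_cstar_algebra_def
proof (intro conjI ballI)
  let ?M = multiplicative_domain
  note lin = clinear_on_add[OF linear] clinear_on_scaleC[OF linear] clinear_on_zero[OF linear csubspace_A]
  show "csubspace ?M"
    unfolding csubspace_def
  proof (intro conjI ballI allI)
    show "0 \<in> ?M" by (simp add: multiplicative_domain_def lin A_intros)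
    show "x + y \<in> ?M" if "x \<in> ?M" "y \<in> ?M" for x y
      using that by (simp add: multiplicative_domain_def compose_add_left compose_add_right lin compose_A A_intros(1))
    show "c *\<^sub>C x \<in> ?M" if "x \<in> ?M" for c x
      using that by (simp add: multiplicative_domain_def compose_scaleC_left compose_scaleC_right lin compose_A A_intros(2))
  qed
  show "x o\<^sub>C\<^sub>L y \<in> ?M" if "x \<in> ?M" "y \<in> ?M" for x y
  proof -
    have "\<Phi> (z o\<^sub>C\<^sub>L (x o\<^sub>C\<^sub>L y)) = \<Phi> z o\<^sub>C\<^sub>L \<Phi> (x o\<^sub>C\<^sub>L y)" "\<Phi> (x o\<^sub>C\<^sub>L y o\<^sub>C\<^sub>L z) = \<Phi> (x o\<^sub>C\<^sub>L y) o\<^sub>C\<^sub>L \<Phi> z"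
      if z: "z \<in> A" for z
    proof -
      have m: "\<Phi> (w o\<^sub>C\<^sub>L x) = \<Phi> w o\<^sub>C\<^sub>L \<Phi> x" "\<Phi> (x o\<^sub>C\<^sub>L w) = \<Phi> x o\<^sub>C\<^sub>L \<Phi> w"
        "\<Phi> (w o\<^sub>C\<^sub>L y) = \<Phi> w o\<^sub>C\<^sub>L \<Phi> y" "\<Phi> (y o\<^sub>C\<^sub>L w) = \<Phi> y o\<^sub>C\<^sub>L \<Phi> w" if "w \<in> A" for w
        using \<open>x \<in> ?M\<close> \<open>y \<in> ?M\<close> that by (auto simp: multiplicative_domain_def)
      have A: "x \<in> A" "y \<in> A" using \<open>x \<in> ?M\<close> \<open>y \<in> ?M\<close> by (auto simp: multiplicative_domain_def)
      show "\<Phi> (z o\<^sub>C\<^sub>L (x o\<^sub>C\<^sub>L y)) = \<Phi> z o\<^sub>C\<^sub>L \<Phi> (x o\<^sub>C\<^sub>L y)"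
        using m(3)[OF compose_A[OF z A(1)]] m(1)[OF z] m(3)[OF A(1)] by (simp add: compose_assoc)
      show "\<Phi> (x o\<^sub>C\<^sub>L y o\<^sub>C\<^sub>L z) = \<Phi> (x o\<^sub>C\<^sub>L y) o\<^sub>C\<^sub>L \<Phi> z"
        using m(2)[OF compose_A[OF A(2) z]] m(4)[OF z] m(2)[OF A(2)] by (simp add: compose_assoc)
    qed
    then show ?thesis using that by (auto simp: multiplicative_domain_def compose_A)
  qed
  show "adj x \<in> ?M" if x: "x \<in> ?M" for x
  proof -
    have xA: "x \<in> A" using x by (simp add: multiplicative_domain_def)
    have "\<Phi> (y o\<^sub>C\<^sub>L adj x) = \<Phi> y o\<^sub>C\<^sub>L \<Phi> (adj x)" "\<Phi> (adj x o\<^sub>C\<^sub>L y) = \<Phi> (adj x) o\<^sub>C\<^sub>L \<Phi> y"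
      if y: "y \<in> A" for y
    proof -
      have m: "\<Phi> (x o\<^sub>C\<^sub>L adj y) = \<Phi> x o\<^sub>C\<^sub>L adj (\<Phi> y)" "\<Phi> (adj y o\<^sub>C\<^sub>L x) = adj (\<Phi> y) o\<^sub>C\<^sub>L \<Phi> x"
        using x adj_A[OF y] by (simp_all add: multiplicative_domain_def adj_map y)
      show "\<Phi> (y o\<^sub>C\<^sub>L adj x) = \<Phi> y o\<^sub>C\<^sub>L \<Phi> (adj x)"
        using arg_cong[OF m(1), of adj] xA y by (simp add: adj_map[symmetric] adj_compose A_intros)
      show "\<Phi> (adj x o\<^sub>C\<^sub>L y) = \<Phi> (adj x) o\<^sub>C\<^sub>L \<Phi> y"
        using arg_cong[OF m(2), of adj] xA y by (simp add: adj_map[symmetric] adj_compose A_intros)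
    qed
    then show ?thesis using xA by (simp add: multiplicative_domain_def adj_A)
  qed
  show "closed ?M"
    unfolding closed_sequential_limits
  proof (intro allI impI, elim conjE)
    fix x l assume x: "\<forall>n. x n \<in> ?M" and l: "x \<longlonglongrightarrow> l"
    have xA: "x n \<in> A" for n using x by (simp add: multiplicative_domain_def)
    have lA: "l \<in> A" using closed_sequentially[OF closed_A] xA l by blast
    have "\<Phi> (y o\<^sub>C\<^sub>L l) = \<Phi> y o\<^sub>C\<^sub>L \<Phi> l" "\<Phi> (l o\<^sub>C\<^sub>L y) = \<Phi> l o\<^sub>C\<^sub>L \<Phi> y" if y: "y \<in> A" for y
    proof -
      have "(\<lambda>n. \<Phi> (y o\<^sub>C\<^sub>L x n)) \<longlonglongrightarrow> \<Phi> (y o\<^sub>C\<^sub>L l)" "(\<lambda>n. \<Phi> (x n o\<^sub>C\<^sub>L y)) \<longlonglongrightarrow> \<Phi> (l o\<^sub>C\<^sub>L y)"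
        by (intro map_tendsto A_intros xA y lA bounded_linear.tendsto[OF bounded_linear_compose_right]
            bounded_linear.tendsto[OF bounded_linear_compose_left] l)+
      moreover have "(\<lambda>n. \<Phi> (y o\<^sub>C\<^sub>L x n)) \<longlonglongrightarrow> \<Phi> y o\<^sub>C\<^sub>L \<Phi> l" "(\<lambda>n. \<Phi> (x n o\<^sub>C\<^sub>L y)) \<longlonglongrightarrow> \<Phi> l o\<^sub>C\<^sub>L \<Phi> y"
        using x y bounded_linear.tendsto[OF bounded_linear_compose_right map_tendsto[OF xA l lA], of "\<Phi> y"]
          bounded_linear.tendsto[OF bounded_linear_compose_left map_tendsto[OF xA l lA], of "\<Phi> y"]
        by (simp_all add: multiplicative_domain_def)
      ultimately show "\<Phi> (y o\<^sub>C\<^sub>L l) = \<Phi> y o\<^sub>C\<^sub>L \<Phi> l" "\<Phi> (l o\<^sub>C\<^sub>L y) = \<Phi> l o\<^sub>C\<^sub>L \<Phi> y"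
        using LIMSEQ_unique by blast+
    qed
    then show "l \<in> ?M" using lA by (simp add: multiplicative_domain_def)
  qed
qed

end

section \<open>Rigidity of nondegenerate ternary representations\<close>

lemma scaleC_eq_zero_iff: "c *\<^sub>C (x::'a::complex_vector) = 0 \<longleftrightarrow> c = 0 \<or> x = 0"
proof
  assume "c *\<^sub>C x = 0"
  then have "(1 / c) *\<^sub>C c *\<^sub>C x = 0" by simp
  then show "c = 0 \<or> x = 0" by (cases "c = 0") (simp_all add: scaleC_scaleC)
qed auto

text \<open>The partial sums of odd length of \<open>a\<close> are half the sum of \<open>a 0\<close>, \<open>a (2 * n)\<close> and the
  combinations below, because \<open>2 (1 + t + \<dots> + t\<^sup>2\<^sup>n) = 1 + t\<^sup>2\<^sup>n + \<Sum>\<^sub>k (t\<^sup>k + t\<^sup>k\<^sup>+\<^sup>1)\<^sup>2\<close>.\<close>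

lemma half_le_odd_sum:
  fixes a :: "nat \<Rightarrow> real"
  assumes even: "\<And>k. 0 \<le> a (2 * k)"
    and pairs: "\<And>k. 0 \<le> a (2 * k) + 2 * a (Suc (2 * k)) + a (2 * Suc k)"
  shows "a 0 / 2 \<le> (\<Sum>m<Suc (2 * n). a m)"
proof -
  have "a 0 / 2 + a (2 * n) / 2 \<le> (\<Sum>m<Suc (2 * n). a m)"
  proof (induction n)
    case (Suc n)
    have "(\<Sum>m<Suc (2 * Suc n). a m) = (\<Sum>m<Suc (2 * n). a m) + a (Suc (2 * n)) + a (2 * Suc n)"
      by simp
    then show ?case using Suc pairs[of n] by (simp add: field_simps)
  qed simp
  then show ?thesis using even[of n] by simp
qed

locale ternary_restriction = ternary_rep W \<theta> B + ucp: ucp_map A \<Phi>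
  for W :: "('a::chilbert_space \<Rightarrow>\<^sub>C\<^sub>L 'a) set"
    and \<theta> :: "('a \<Rightarrow>\<^sub>C\<^sub>L 'a) \<Rightarrow> ('b::chilbert_space \<Rightarrow>\<^sub>C\<^sub>L 'b)" and B :: real
    and A :: "('a \<Rightarrow>\<^sub>C\<^sub>L 'a) set" and \<Phi> :: "('a \<Rightarrow>\<^sub>C\<^sub>L 'a) \<Rightarrow> ('b \<Rightarrow>\<^sub>C\<^sub>L 'b)" +
  assumes W_subset: "W \<subseteq> A" and agree: "w \<in> W \<Longrightarrow> \<Phi> w = \<theta> w"
begin

lemma defect_W: "x \<in> W \<Longrightarrow> y \<in> W \<Longrightarrow> ucp.defect x y = \<Phi> (adj x o\<^sub>C\<^sub>L y) - adj (\<theta> x) o\<^sub>C\<^sub>L \<theta> y"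
  by (simp add: ucp.defect_def agree)

text \<open>Both first terms are \<Phi> of the same product, and \<open>multiplier_symmetric\<close>
  handles the \<theta>-terms. Multipliers thus move from one slot of \<open>defect\<close> to the
  other.\<close>

lemma multiplier_defect_symmetric:
  assumes "a \<in> multipliers" "x \<in> W" "y \<in> W"
  shows "ucp.defect x (a o\<^sub>C\<^sub>L y) = ucp.defect (adj a o\<^sub>C\<^sub>L x) y"
  using assms multiplier_symmetric[OF assms(1,3,2)]
  by (simp add: defect_W multiplier_W multiplier_adj adj_compose compose_assoc)

text \<open>Against vectors \<open>h\<close> in the range of \<open>\<theta> s\<^sup>*\<close>, the elements \<open>e = 1 - u\<^sup>2\<^sup>n\<^sup>+\<^sup>1\<close> with
  \<open>u = 1 - s\<^sup>*s\<close> act as an approximate unit, so that \<open>\<Phi> e \<le> 1\<close> leaves no room for a defect.\<close>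

lemma defect_diagonal_on_range:
  assumes s: "s \<in> W" "norm s \<le> 1" and h: "h = adj (\<theta> s) k"
  shows "Re (cinner (ucp.defect s s h) h) \<le> 0"
proof -
  define u where "u = cblinfun_id - adj s o\<^sub>C\<^sub>L s"
  define v where "v = cblinfun_id - s o\<^sub>C\<^sub>L adj s"
  have v: "v \<in> multipliers" "adj v = v"
    unfolding v_def using s(1) by (auto intro!: multiplier_intros multiplier_products adj_W simp: adj_simps)
  have u: "adj u = u" by (simp add: u_def adj_simps)
  \<comment> \<open>By \<open>intertwine_defect_pow\<close>, \<open>y m\<close> is s u^m. With
    \<open>v\<close> on the left it visibly lies in \<open>W\<close>, and \<open>adj s\<close>
    applied to it gives u^m - u^(m+1), so its sums telescope.\<close>
  define y where "y m = cpow v m o\<^sub>C\<^sub>L s" for m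
  have y: "y m \<in> W" for m unfolding y_def by (intro multiplier_W multiplier_cpow v s)
  have yA: "y m \<in> A" "s \<in> A" for m using y s W_subset by auto
  define a where "a m = Re (cinner (ucp.defect s (y m) h) h)" for m
  \<comment> \<open>The defect of \<open>y i\<close> and \<open>y j\<close> depends only on i + j,
    so the Gram form is a Hankel form; its positivity feeds \<open>half_le_odd_sum\<close>.\<close>
  have shift: "ucp.defect (y i) (y j) = ucp.defect s (y (i + j))" for i j
    using multiplier_defect_symmetric[OF multiplier_cpow[OF v(1)] s(1) y, of i j]
    by (simp add: adj_cpow[OF v(2)] y_def cpow_add compose_assoc)
  have low: "a 0 / 2 \<le> (\<Sum>m<Suc (2 * n). a m)" for n
  proof (rule half_le_odd_sum)
    show "0 \<le> a (2 * k)" for k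
      using ucp.defect_nonneg[OF yA(1), of k h] by (simp add: a_def shift mult_2)
    show "0 \<le> a (2 * k) + 2 * a (Suc (2 * k)) + a (2 * Suc k)" for k
    proof -
      have idx: "k + k = 2 * k" "k + Suc k = Suc (2 * k)" "Suc k + k = Suc (2 * k)" "Suc k + Suc k = 2 * Suc k"
        by simp_all
      have "0 \<le> a (k + k) + a (k + Suc k) + a (Suc k + k) + a (Suc k + Suc k)"
        using ucp.defect_gram[OF yA(1) yA(1), of k h "Suc k" h]
        by (simp only: complex_nonneg_Reals_iff shift plus_complex.sel a_def)
      then show ?thesis unfolding idx by simp
    qed
  qed
  \<comment> \<open>The sum of the \<open>a m\<close> is <\<Phi>(1 - u^M) h, h> minus <\<theta>(E)
    h, \<theta>(s) h>. The first term is at most ||h||^2 because u^M is positive; the second is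
    ||h||^2 up to an error in \<theta>(s u^M).\<close>
  have up: "(\<Sum>m<M. a m) \<le> B * norm h * norm k * norm (s o\<^sub>C\<^sub>L cpow u M)" if M: "M = Suc (2 * n)" for M n
  proof -
    define E where "E = (\<Sum>m<M. y m)"
    have E: "E \<in> W" unfolding E_def by (intro W_intros y)
    have sy: "adj s o\<^sub>C\<^sub>L y m = cpow u m o\<^sub>C\<^sub>L (adj s o\<^sub>C\<^sub>L s)" for m
      using intertwine_defect_pow[of "adj s" m] by (simp add: y_def u_def v_def flip: compose_assoc)
    have sE: "adj s o\<^sub>C\<^sub>L E = cblinfun_id - cpow u M"
    proof -
      have "adj s o\<^sub>C\<^sub>L (\<Sum>m<N. y m) = cblinfun_id - cpow u N" for N
      proof (induction N)
        case (Suc N)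
        have "cpow u (Suc N) = cpow u N - cpow u N o\<^sub>C\<^sub>L (adj s o\<^sub>C\<^sub>L s)"
          unfolding cpow_Suc_right by (simp add: u_def compose_simps)
        then show ?case using Suc by (simp add: compose_add_right sy)
      qed simp
      then show ?thesis by (simp add: E_def)
    qed
    have powA: "cpow u m \<in> A" for m
    proof (induction m)
      case (Suc m)
      have "u \<in> A" unfolding u_def by (intro ucp.A_intros yA)
      with Suc show ?case by (simp add: ucp.compose_A)
    qed (simp add: ucp.id_A)
    have suW: "s o\<^sub>C\<^sub>L cpow u M \<in> W"
      unfolding u_def intertwine_defect_pow using y[of M] by (simp add: y_def v_def)
    have "(\<Sum>m<M. a m) = Re (cinner ((\<Phi> (adj s o\<^sub>C\<^sub>L E) - adj (\<theta> s) o\<^sub>C\<^sub>L \<theta> E) h) h)"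
    proof -
      have "\<Phi> (adj s o\<^sub>C\<^sub>L E) = (\<Sum>m<M. \<Phi> (adj s o\<^sub>C\<^sub>L y m))"
      proof -
        have "adj s o\<^sub>C\<^sub>L E = (\<Sum>m<M. adj s o\<^sub>C\<^sub>L y m)"
          unfolding E_def by (rule linear_sum[OF bounded_linear.linear[OF bounded_linear_compose_right]])
        then show ?thesis
          by (simp add: clinear_on_sum[OF ucp.linear ucp.csubspace_A] ucp.A_intros yA)
      qed
      moreover have "\<theta> E = (\<Sum>m<M. \<theta> (y m))"
        unfolding E_def by (rule clinear_on_sum[OF linear csubspace_W y])
      ultimately show ?thesis
        by (simp add: a_def defect_W[OF s(1) y] sum_cblinfun_apply cblinfun_apply_sum cinner_sum_left
            cinner_diff_left sum_subtractf)
    qed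
    also have "\<dots> = Re (cinner (\<Phi> (adj s o\<^sub>C\<^sub>L E) h) h) - Re (cinner (adj (\<theta> s) (\<theta> E h)) h)"
      by (simp add: cinner_diff_left)
    also have "Re (cinner (\<Phi> (adj s o\<^sub>C\<^sub>L E) h) h) \<le> (norm h)\<^sup>2"
    proof -
      have "cinner (\<Phi> (cpow u M) h) h \<in> \<real>\<^sub>\<ge>\<^sub>0"
        unfolding M
        by (intro ucp.positive powA cpow_odd_positive u) (unfold u_def, rule id_minus_positive[OF s(2)])
      moreover have "\<Phi> (adj s o\<^sub>C\<^sub>L E) = cblinfun_id - \<Phi> (cpow u M)"
        unfolding sE by (simp add: clinear_on_diff[OF ucp.linear ucp.csubspace_A] ucp.id_A powA ucp.unital)
      ultimately show ?thesis
        by (simp add: cinner_diff_left cinner_self complex_nonneg_Reals_iff)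
    qed
    \<comment> \<open>The form of \<open>h\<close> enters here: it provides the extra factor
      \<open>\<theta> s\<close> that makes s \<open>adj s\<close> E a triple product, equal to s - s
      u^M.\<close>
    also have "Re (cinner (adj (\<theta> s) (\<theta> E h)) h) = (norm h)\<^sup>2 - Re (cinner (\<theta> (s o\<^sub>C\<^sub>L cpow u M) h) k)"
    proof -
      have "cinner (adj (\<theta> s) (\<theta> E h)) h = cinner ((\<theta> s o\<^sub>C\<^sub>L \<theta> (adj s) o\<^sub>C\<^sub>L \<theta> E) h) k"
        unfolding h by (simp add: cinner_adj_right theta_adj s)
      also have "\<theta> s o\<^sub>C\<^sub>L \<theta> (adj s) o\<^sub>C\<^sub>L \<theta> E = \<theta> (s o\<^sub>C\<^sub>L adj s o\<^sub>C\<^sub>L E)"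
        using s E by (simp add: theta_triple adj_W)
      also have "s o\<^sub>C\<^sub>L adj s o\<^sub>C\<^sub>L E = s - s o\<^sub>C\<^sub>L cpow u M"
        by (simp add: compose_assoc sE compose_diff_right)
      also have "\<theta> \<dots> = \<theta> s - \<theta> (s o\<^sub>C\<^sub>L cpow u M)" by (rule theta_linear) (use s suW in auto)
      also have "cinner ((\<theta> s - \<theta> (s o\<^sub>C\<^sub>L cpow u M)) h) k = cinner h h - cinner (\<theta> (s o\<^sub>C\<^sub>L cpow u M) h) k"
        by (simp add: cinner_diff_left h cinner_adj_right)
      finally show ?thesis by (simp add: cinner_self)
    qed
    also have "(norm h)\<^sup>2 - ((norm h)\<^sup>2 - Re (cinner (\<theta> (s o\<^sub>C\<^sub>L cpow u M) h) k))
      = Re (cinner (\<theta> (s o\<^sub>C\<^sub>L cpow u M) h) k)" by simp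
    also have "\<dots> \<le> norm (\<theta> (s o\<^sub>C\<^sub>L cpow u M) h) * norm k"
      by (meson cinner_cauchy_schwarz complex_Re_le_cmod order_trans)
    also have "\<dots> \<le> norm (\<theta> (s o\<^sub>C\<^sub>L cpow u M)) * norm h * norm k"
      by (intro mult_right_mono norm_cblinfun_apply) simp
    also have "\<dots> \<le> B * norm (s o\<^sub>C\<^sub>L cpow u M) * norm h * norm k"
      by (intro mult_right_mono theta_bound suW) auto
    finally show ?thesis by (simp add: ac_simps)
  qed
  have bound: "a 0 / 2 \<le> B * norm h * norm k * norm (s o\<^sub>C\<^sub>L cpow u (Suc (2 * n)))" for n
    by (rule order_trans[OF low up[OF refl]])
  \<comment> \<open>By \<open>norm_defect_pow\<close> the error is of order 1/sqrt n, so the limit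
    leaves \<open>a 0 \<le> 0\<close>; since \<open>y 0 = s\<close>, this is the diagonal
    defect.\<close>
  have "a 0 / 2 \<le> B * norm h * norm k * sqrt (inverse (real (Suc n)))" for n
  proof -
    have "norm (s o\<^sub>C\<^sub>L cpow u (Suc (2 * n))) \<le> sqrt (inverse (real (Suc (Suc (2 * n)))))"
      unfolding u_def by (rule norm_defect_pow[OF s(2)])
    also have "\<dots> \<le> sqrt (inverse (real (Suc n)))"
      by (intro real_sqrt_le_mono le_imp_inverse_le) auto
    finally have "B * norm h * norm k * norm (s o\<^sub>C\<^sub>L cpow u (Suc (2 * n)))
      \<le> B * norm h * norm k * sqrt (inverse (real (Suc n)))"
      using B_nonneg by (intro mult_left_mono) auto
    with bound[of n] show ?thesis by simp
  qed
  moreover have "(\<lambda>n. B * norm h * norm k * sqrt (inverse (real (Suc n)))) \<longlonglongrightarrow> B * norm h * norm k * sqrt 0"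
    by (intro tendsto_intros tendsto_real_sqrt LIMSEQ_inverse_real_of_nat)
  ultimately have "a 0 / 2 \<le> B * norm h * norm k * sqrt 0"
    by (intro LIMSEQ_le_const) auto
  then show ?thesis by (simp add: a_def y_def)
qed

text \<open>After scaling s into the unit ball, the diagonal defect vanishes on the range of
  \<open>adj (\<theta> s)\<close>, and \<open>defect_vanishes\<close> carries this over to
  \<open>defect t s\<close> for every t.\<close>

lemma defect_compose_adj:
  assumes t: "t \<in> W" and s: "s \<in> W"
  shows "ucp.defect t s o\<^sub>C\<^sub>L adj (\<theta> s) = 0"
proof -
  \<comment> \<open>\<open>norm s + 1\<close> keeps the scaling factor positive for s = 0 as
    well.\<close>
  define q where "q = 1 / (norm s + 1)"
  define r where "r = complex_of_real q"
  have pos: "norm s + 1 > 0" by (simp add: add_nonneg_pos)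
  then have q: "q > 0" by (simp add: q_def)
  then have r: "r \<noteq> 0" "cnj r = r" by (auto simp: r_def)
  have "norm (r *\<^sub>C s) = q * norm s" using q by (simp add: norm_scaleC_cblinfun r_def)
  also have "\<dots> \<le> 1" using pos by (simp add: q_def)
  finally have rs: "r *\<^sub>C s \<in> W" "norm (r *\<^sub>C s) \<le> 1"
    using s by (auto intro: W_intros)
  have "ucp.defect t (r *\<^sub>C s) (adj (\<theta> (r *\<^sub>C s)) k) = 0" for k
    using t rs W_subset defect_diagonal_on_range[OF rs refl] by (intro ucp.defect_vanishes) auto
  moreover have "ucp.defect t (r *\<^sub>C s) = r *\<^sub>C ucp.defect t s"
    using t s rs W_subset
    by (simp add: defect_W theta_linear compose_simps clinear_on_scaleC[OF ucp.linear] ucp.A_intros subsetD scaleC_diff)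
  ultimately have "r *\<^sub>C r *\<^sub>C (ucp.defect t s (adj (\<theta> s) k)) = 0" for k
    by (simp add: theta_linear s adj_scaleC r cblinfun_apply_simps)
  then have "ucp.defect t s (adj (\<theta> s) k) = 0" for k
    using r by (simp add: scaleC_eq_zero_iff)
  then show ?thesis by (intro cblinfun_eqI) simp
qed

text \<open>\<open>defect t x o\<^sub>C\<^sub>L adj (\<theta> y)\<close> is sesquilinear in x and y
  and vanishes for x = y, hence everywhere by polarization. The ranges of the right factors span a
  dense subspace, so the defect itself is 0.\<close>

lemma defect_zero:
  assumes t: "t \<in> W" and s: "s \<in> W"
  shows "ucp.defect t s = 0"
proof (rule eqI_left)
  fix z assume z: "z \<in> W"
  define f where "f x y = ucp.defect t x o\<^sub>C\<^sub>L adj (\<theta> y)" for x y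
  have diag: "f x x = 0" if "x \<in> W" for x unfolding f_def by (rule defect_compose_adj[OF t that])
  have f_add: "f (x + y) w = f x w + f y w" "f w (x + y) = f w x + f w y" if "x \<in> W" "y \<in> W" "w \<in> W" for x y w
    using that t W_subset
    by (simp_all add: f_def defect_W W_intros theta_linear compose_simps adj_simps
        clinear_on_add[OF ucp.linear] ucp.A_intros subsetD)
  have f_scale: "f (c *\<^sub>C x) w = c *\<^sub>C f x w" "f w (c *\<^sub>C x) = cnj c *\<^sub>C f w x" if "x \<in> W" "w \<in> W" for x w c
    using that t W_subset
    by (simp_all add: f_def defect_W W_intros theta_linear compose_simps adj_simps scaleC_diff
        clinear_on_scaleC[OF ucp.linear] ucp.A_intros subsetD)
  let ?w = "adj z"
  have w: "?w \<in> W" "\<i> *\<^sub>C ?w \<in> W" using z by (auto intro: adj_W W_intros)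
  have sum: "f s ?w + f ?w s = 0"
    using diag[of "s + ?w"] diag[of s] diag[of ?w] s w by (simp add: f_add W_intros add.commute)
  have "(- \<i>) *\<^sub>C f s ?w + \<i> *\<^sub>C f ?w s = 0"
    using diag[of "s + \<i> *\<^sub>C ?w"] diag[of s] diag[of ?w] s w by (simp add: f_add f_scale W_intros add.commute)
  then have "(- \<i>) *\<^sub>C f s ?w + \<i> *\<^sub>C (- f s ?w) = 0"
    using minus_unique[OF sum] by simp
  then have "(- \<i> + - \<i>) *\<^sub>C f s ?w = 0"
    by (simp only: scaleC_add_left scaleC_minus scaleC_minus_left)
  then have "f s ?w = 0" by (simp add: scaleC_eq_zero_iff)
  then show "ucp.defect t s o\<^sub>C\<^sub>L \<theta> z = 0 o\<^sub>C\<^sub>L \<theta> z" using z by (simp add: f_def theta_adj)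
qed

lemma W_multiplicative: "W \<subseteq> ucp.multiplicative_domain"
  using W_subset by (auto intro!: ucp.multiplicative_domainI defect_zero adj_W)

end

section \<open>Operator matrices and matrix norms\<close>

lift_definition inl_op :: "'k::chilbert_space \<Rightarrow>\<^sub>C\<^sub>L ('k \<times> 'h::chilbert_space)" is "\<lambda>k. (k, 0)"
  by (auto simp: scaleC_prod_def intro!: bounded_linear_Pair bounded_linear_ident)
lift_definition inr_op :: "'h::chilbert_space \<Rightarrow>\<^sub>C\<^sub>L ('k::chilbert_space \<times> 'h)" is "\<lambda>h. (0, h)"
  by (auto simp: scaleC_prod_def intro!: bounded_linear_Pair bounded_linear_ident)
lift_definition fst_op :: "('k::chilbert_space \<times> 'h::chilbert_space) \<Rightarrow>\<^sub>C\<^sub>L 'k" is fst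
  by (auto simp: scaleC_prod_def intro!: bounded_linear_fst)
lift_definition snd_op :: "('k::chilbert_space \<times> 'h::chilbert_space) \<Rightarrow>\<^sub>C\<^sub>L 'h" is snd
  by (auto simp: scaleC_prod_def intro!: bounded_linear_snd)

lemma inl_op_apply [simp]: "inl_op k = (k, 0)" by transfer simp
lemma inr_op_apply [simp]: "inr_op h = (0, h)" by transfer simp
lemma fst_op_apply [simp]: "fst_op x = fst x" by transfer simp
lemma snd_op_apply [simp]: "snd_op x = snd x" by transfer simp

lemma norm_inl_op: "norm inl_op \<le> 1" and norm_inr_op: "norm inr_op \<le> 1"
  by (rule norm_cblinfun_bound; simp)+

lemma norm_fst_op: "norm fst_op \<le> 1"
  by (rule norm_cblinfun_bound) (simp_all, metis norm_fst_le prod.collapse)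

lemma norm_snd_op: "norm snd_op \<le> 1"
  by (rule norm_cblinfun_bound) (simp_all, metis norm_snd_le prod.collapse)

lemma norm_compose3_le:
  assumes "norm a \<le> 1" "norm c \<le> 1" shows "norm (a o\<^sub>C\<^sub>L b o\<^sub>C\<^sub>L c) \<le> norm b"
proof -
  have "norm (a o\<^sub>C\<^sub>L b o\<^sub>C\<^sub>L c) \<le> norm (a o\<^sub>C\<^sub>L b) * norm c" by (rule norm_cblinfun_compose)
  also have "\<dots> \<le> norm (a o\<^sub>C\<^sub>L b) * 1" using assms by (intro mult_left_mono) auto
  also have "\<dots> \<le> norm a * norm b" by (simp add: norm_cblinfun_compose)
  also have "\<dots> \<le> 1 * norm b" using assms by (intro mult_right_mono) auto
  finally show ?thesis by simp
qed

definition upper_corner :: "(('k::chilbert_space \<times> 'h::chilbert_space) \<Rightarrow>\<^sub>C\<^sub>L ('k \<times> 'h)) \<Rightarrow> ('h \<Rightarrow>\<^sub>C\<^sub>L 'k)"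
  where "upper_corner m = fst_op o\<^sub>C\<^sub>L m o\<^sub>C\<^sub>L inr_op"
definition lower_corner :: "(('k::chilbert_space \<times> 'h::chilbert_space) \<Rightarrow>\<^sub>C\<^sub>L ('k \<times> 'h)) \<Rightarrow> ('k \<Rightarrow>\<^sub>C\<^sub>L 'h)"
  where "lower_corner m = snd_op o\<^sub>C\<^sub>L m o\<^sub>C\<^sub>L inl_op"
definition upper :: "('h::chilbert_space \<Rightarrow>\<^sub>C\<^sub>L 'k::chilbert_space) \<Rightarrow> (('k \<times> 'h) \<Rightarrow>\<^sub>C\<^sub>L ('k \<times> 'h))"
  where "upper t = op_block 0 t 0 0"
definition symmetry :: "(('k::chilbert_space \<times> 'h::chilbert_space) \<Rightarrow>\<^sub>C\<^sub>L ('k \<times> 'h))"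
  where "symmetry = op_block cblinfun_id 0 0 (- cblinfun_id)"

lemma op_block_corners:
  "m = op_block (fst_op o\<^sub>C\<^sub>L m o\<^sub>C\<^sub>L inl_op) (upper_corner m) (lower_corner m) (snd_op o\<^sub>C\<^sub>L m o\<^sub>C\<^sub>L inr_op)"
proof (rule cblinfun_eqI)
  fix x
  have "m x = m (fst x, 0) + m (0, snd x)" by (simp flip: cblinfun_apply_add)
  then show "m x = op_block (fst_op o\<^sub>C\<^sub>L m o\<^sub>C\<^sub>L inl_op) (upper_corner m) (lower_corner m) (snd_op o\<^sub>C\<^sub>L m o\<^sub>C\<^sub>L inr_op) x"
    by (simp add: upper_corner_def lower_corner_def prod_eq_iff)
qed

lemma op_block_cases:
  fixes m :: "('k::chilbert_space \<times> 'h::chilbert_space) \<Rightarrow>\<^sub>C\<^sub>L ('k \<times> 'h)"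
  obtains a b c d where "m = op_block a b c d"
  using that[OF op_block_corners] .

lemma corner_op_block [simp]: "upper_corner (op_block a b c d) = b" "lower_corner (op_block a b c d) = c"
  by (auto intro!: cblinfun_eqI simp: upper_corner_def lower_corner_def)

lemma op_block_eq_iff: "op_block a b c d = op_block a' b' c' d' \<longleftrightarrow> a = a' \<and> b = b' \<and> c = c' \<and> d = d'"
proof
  assume eq: "op_block a b c d = op_block a' b' c' d'"
  have "a x = a' x \<and> c x = c' x" "b y = b' y \<and> d y = d' y" for x y
    using arg_cong[OF eq, of "\<lambda>m. cblinfun_apply m (x, 0)"]
      arg_cong[OF eq, of "\<lambda>m. cblinfun_apply m (0, y)"] by simp_all
  then show "a = a' \<and> b = b' \<and> c = c' \<and> d = d'" by (auto intro: cblinfun_eqI)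
qed simp

lemma op_block_compose:
  "op_block a b c d o\<^sub>C\<^sub>L op_block a' b' c' d' = op_block (a o\<^sub>C\<^sub>L a' + b o\<^sub>C\<^sub>L c') (a o\<^sub>C\<^sub>L b' + b o\<^sub>C\<^sub>L d')
    (c o\<^sub>C\<^sub>L a' + d o\<^sub>C\<^sub>L c') (c o\<^sub>C\<^sub>L b' + d o\<^sub>C\<^sub>L d')"
  by (rule cblinfun_eqI) (simp add: cblinfun_apply_simps)

lemma op_block_linear:
  "op_block a b c d + op_block a' b' c' d' = op_block (a + a') (b + b') (c + c') (d + d')"
  "op_block a b c d - op_block a' b' c' d' = op_block (a - a') (b - b') (c - c') (d - d')"
  "- op_block a b c d = op_block (- a) (- b) (- c) (- d)"
  "k *\<^sub>C op_block a b c d = op_block (k *\<^sub>C a) (k *\<^sub>C b) (k *\<^sub>C c) (k *\<^sub>C d)"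
  "op_block 0 0 0 0 = 0"
  by (rule cblinfun_eqI; simp add: scaleC_prod_def scaleC_add_right zero_prod_def)+

lemma op_block_id: "cblinfun_id = op_block cblinfun_id 0 0 cblinfun_id"
  by (rule cblinfun_eqI) simp

lemmas op_block_simps = op_block_compose op_block_linear adj_op_block op_block_eq_iff

lemma upper_eq_compose: "upper t = inl_op o\<^sub>C\<^sub>L t o\<^sub>C\<^sub>L snd_op"
  by (rule cblinfun_eqI) (simp add: upper_def)

lemma bounded_linear_upper: "bounded_linear upper"
  unfolding upper_eq_compose[abs_def]
  by (rule bounded_linear_compose[OF bounded_linear_compose_left bounded_linear_compose_right])

lemma bounded_linear_upper_corner: "bounded_linear upper_corner"
  unfolding upper_corner_def[abs_def]
  by (rule bounded_linear_compose[OF bounded_linear_compose_left bounded_linear_compose_right])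

lemma bounded_linear_lower_corner: "bounded_linear lower_corner"
  unfolding lower_corner_def[abs_def]
  by (rule bounded_linear_compose[OF bounded_linear_compose_left bounded_linear_compose_right])

lemma norm_upper_corner_le: "norm (upper_corner m) \<le> norm m"
  unfolding upper_corner_def by (rule norm_compose3_le[OF norm_fst_op norm_inr_op])
lemma norm_lower_corner_le: "norm (lower_corner m) \<le> norm m"
  unfolding lower_corner_def by (rule norm_compose3_le[OF norm_snd_op norm_inl_op])
lemma norm_upper_le: "norm (upper t) \<le> norm t"
  unfolding upper_eq_compose by (rule norm_compose3_le[OF norm_inl_op norm_snd_op])

lemma upper_linear: "upper (s + t) = upper s + upper t" "upper (c *\<^sub>C t) = c *\<^sub>C upper t" "upper 0 = 0"
  by (simp_all add: upper_def op_block_linear)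

lemma upper_corner_upper [simp]: "upper_corner (upper t) = t" by (simp add: upper_def)

lemma upper_corner_linear: "upper_corner (m + n) = upper_corner m + upper_corner n"
  "upper_corner (c *\<^sub>C m) = c *\<^sub>C upper_corner m"
  by (simp_all add: upper_corner_def compose_simps)

lemma upper_plus_adj_upper: "upper x + adj (upper y) = op_block 0 x (adj y) 0"
  by (simp add: upper_def op_block_simps)

lemma symmetry_square: "symmetry o\<^sub>C\<^sub>L symmetry = cblinfun_id"
  by (simp add: symmetry_def op_block_simps op_block_id compose_simps)
lemma adj_symmetry: "adj symmetry = symmetry"
  by (simp add: symmetry_def op_block_simps adj_minus)
lemma symmetry_upper: "symmetry o\<^sub>C\<^sub>L upper t = upper t" "upper t o\<^sub>C\<^sub>L symmetry = - upper t"
  by (simp_all add: symmetry_def upper_def op_block_simps compose_simps)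

lemma cblinfun_self_neg: "(a :: 'a::chilbert_space \<Rightarrow>\<^sub>C\<^sub>L 'b::chilbert_space) = - a \<Longrightarrow> a = 0"
  using scaleC_eq_zero_iff[of 2 a] scaleC_add_left[of 1 1 a] by (simp add: eq_neg_iff_add_eq_0)

text \<open>As \<open>symmetry\<close> is 1 \<oplus> -1, the first equation kills the lower row and
  the second the left column.\<close>

lemma upper_of_symmetry:
  fixes m :: "('k::chilbert_space \<times> 'h::chilbert_space) \<Rightarrow>\<^sub>C\<^sub>L ('k \<times> 'h)"
  assumes "symmetry o\<^sub>C\<^sub>L m = m" "m o\<^sub>C\<^sub>L symmetry = - m" shows "upper (upper_corner m) = m"
proof -
  obtain a b c d where m: "m = op_block a b c d" by (rule op_block_cases[of m])
  have "- c = c" "- d = d" "a = - a"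
    using assms by (simp_all add: m symmetry_def op_block_simps compose_simps)
  then have "a = 0" "c = 0" "d = 0" by (metis cblinfun_self_neg)+
  then show ?thesis by (simp add: m upper_def)
qed

lemma diagonal_of_symmetry:
  fixes m :: "('k::chilbert_space \<times> 'h::chilbert_space) \<Rightarrow>\<^sub>C\<^sub>L ('k \<times> 'h)"
  assumes "symmetry o\<^sub>C\<^sub>L m = m o\<^sub>C\<^sub>L symmetry"
  obtains q p where "m = op_block q 0 0 p"
proof -
  obtain a b c d where m: "m = op_block a b c d" by (rule op_block_cases[of m])
  have "b = - b" "- c = c" using assms by (simp_all add: m symmetry_def op_block_simps compose_simps)
  then have "b = 0" "c = 0" by (metis cblinfun_self_neg)+
  then show ?thesis using that m by blast
qed

section \<open>Operator norms of matrices and the cb norm\<close>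

lemma op_mat_norm_eq:
  "op_mat_norm n a = (SUP h\<in>{h. vec_norm n h \<le> 1}. vec_norm n (mat_apply n a h))"
  by (simp add: op_mat_norm_def vec_norm_def mat_apply_def)

lemma vec_norm_scaleR: "vec_norm n (\<lambda>i. r *\<^sub>R x i) = \<bar>r\<bar> * vec_norm n x"
  unfolding vec_norm_def by (simp add: L2_set_right_distrib)

lemma vec_norm_zero [simp]: "vec_norm n (\<lambda>_. 0) = 0"
  by (simp add: vec_norm_def L2_set_def)

lemma vec_norm_mat_apply_le_one:
  fixes a :: "('a::chilbert_space, 'b::chilbert_space) op_mat"
  assumes "vec_norm n h \<le> 1" shows "vec_norm n (mat_apply n a h) \<le> op_mat_norm n a"
  unfolding op_mat_norm_eq
proof (rule cSUP_upper)
  \<comment> \<open>A real supremum needs boundedness; the sum of the entry norms provides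
    it.\<close>
  show "bdd_above ((\<lambda>h. vec_norm n (mat_apply n a h)) ` {h. vec_norm n h \<le> 1})"
  proof (intro bdd_aboveI2)
    fix h :: "nat \<Rightarrow> 'a" assume "h \<in> {h. vec_norm n h \<le> 1}"
    then show "vec_norm n (mat_apply n a h) \<le> (\<Sum>i<n. \<Sum>j<n. norm (a i j)) * 1"
      by (intro order_trans[OF vec_norm_mat_apply_bound] mult_left_mono) (auto intro!: sum_nonneg)
  qed
qed (use assms in simp)

lemma op_mat_norm_nonneg: "0 \<le> op_mat_norm n a"
  using order_trans[OF vec_norm_nonneg vec_norm_mat_apply_le_one[of n "\<lambda>_. 0" a]] by simp

lemma vec_norm_mat_apply_le: "vec_norm n (mat_apply n a x) \<le> op_mat_norm n a * vec_norm n x"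
proof (cases "vec_norm n x = 0")
  case True
  then show ?thesis using vec_norm_mat_apply_bound[of n a x] by simp
next
  case False
  then have pos: "vec_norm n x > 0" using vec_norm_nonneg[of n x] by linarith
  define r where "r = 1 / vec_norm n x"
  have r: "r > 0" "r * vec_norm n x = 1" using pos by (auto simp: r_def)
  have "r * vec_norm n (mat_apply n a x) = vec_norm n (mat_apply n a (\<lambda>i. r *\<^sub>R x i))"
    using r by (simp add: scaleR_scaleC mat_apply_linear) (simp add: vec_norm_scaleR flip: scaleR_scaleC)
  also have "\<dots> \<le> op_mat_norm n a"
    by (rule vec_norm_mat_apply_le_one) (use r in \<open>simp add: vec_norm_scaleR\<close>)
  finally show ?thesis using pos by (simp add: r_def field_simps)
qed

lemma op_mat_norm_le:
  fixes a :: "('a::chilbert_space, 'b::chilbert_space) op_mat"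
  assumes "0 \<le> b" "\<And>x. vec_norm n (mat_apply n a x) \<le> b * vec_norm n x"
  shows "op_mat_norm n a \<le> b"
  unfolding op_mat_norm_eq
proof (rule cSUP_least)
  show "{h. vec_norm n h \<le> 1} \<noteq> ({} :: (nat \<Rightarrow> 'a) set)"
    by (auto intro!: exI[of _ "\<lambda>_. 0"])
  fix x :: "nat \<Rightarrow> 'a" assume "x \<in> {h. vec_norm n h \<le> 1}"
  then show "vec_norm n (mat_apply n a x) \<le> b"
    using assms(2)[of x] mult_left_mono[of "vec_norm n x" 1 b] assms(1) by simp
qed

lemma op_mat_norm_cong:
  assumes "\<And>i j. i < n \<Longrightarrow> j < n \<Longrightarrow> a i j = b i j" shows "op_mat_norm n a = op_mat_norm n b"
proof -
  have "vec_norm n (mat_apply n a x) = vec_norm n (mat_apply n b x)" for x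
    by (rule vec_norm_cong) (simp add: mat_apply_def assms)
  then show ?thesis by (simp add: op_mat_norm_eq)
qed

lemma completely_contractive_norm_le:
  assumes "completely_contractive X \<phi>" "x \<in> X" shows "norm (\<phi> x) \<le> norm x"
proof (rule norm_cblinfun_bound)
  fix h
  have one: "vec_norm (Suc 0) y = norm (y 0)" for y :: "nat \<Rightarrow> 'z::chilbert_space"
    by (simp add: vec_norm_def L2_set_def)
  have "norm (\<phi> x h) = vec_norm (Suc 0) (mat_apply (Suc 0) (\<lambda>_ _. \<phi> x) (\<lambda>_. h))" by (simp add: one mat_apply_def)
  also have "\<dots> \<le> op_mat_norm (Suc 0) (\<lambda>_ _. \<phi> x) * norm h"
    using vec_norm_mat_apply_le[of "Suc 0" "\<lambda>_ _. \<phi> x" "\<lambda>_. h"] by (simp add: one)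
  also have "\<dots> \<le> op_mat_norm (Suc 0) (\<lambda>_ _. x) * norm h"
    using assms unfolding completely_contractive_def
    by (intro mult_right_mono) (auto simp: mats_over_def dest!: spec[of _ "Suc 0"] bspec[of _ _ "\<lambda>_ _. x"])
  also have "\<dots> \<le> norm x * norm h"
    by (intro mult_right_mono op_mat_norm_le) (auto simp: one mat_apply_def norm_cblinfun_apply)
  finally show "norm (\<phi> x h) \<le> norm x * norm h" .
qed simp

lemma cb_norm_zero:
  fixes \<phi> :: "('a::chilbert_space \<Rightarrow>\<^sub>C\<^sub>L 'b::chilbert_space) \<Rightarrow> ('c::chilbert_space \<Rightarrow>\<^sub>C\<^sub>L 'd::chilbert_space)"
  assumes "\<And>x. x \<in> X \<Longrightarrow> \<phi> x = 0" shows "cb_norm X \<phi> \<le> 0"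
  unfolding cb_norm_def
proof (intro SUP_least)
  fix n a assume "a \<in> {a \<in> mats_over n X. op_mat_norm n a \<le> 1}"
  then have "op_mat_norm n (\<lambda>i j. \<phi> (a i j)) = op_mat_norm n (\<lambda>i j. 0 :: 'c \<Rightarrow>\<^sub>C\<^sub>L 'd)"
    using assms by (intro op_mat_norm_cong) (auto simp: mats_over_def)
  also have "\<dots> \<le> 0" by (rule op_mat_norm_le) (auto simp: mat_apply_def[abs_def])
  finally show "ereal (op_mat_norm n (\<lambda>i j. \<phi> (a i j))) \<le> 0" by simp
qed

lemma cb_norm_le_one:
  assumes "completely_contractive X \<phi>" shows "cb_norm X \<phi> \<le> 1"
  unfolding cb_norm_def
proof (intro SUP_least)
  fix n a assume "a \<in> {a \<in> mats_over n X. op_mat_norm n a \<le> 1}"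
  then have "op_mat_norm n (\<lambda>i j. \<phi> (a i j)) \<le> 1"
    using assms unfolding completely_contractive_def by force
  then show "ereal (op_mat_norm n (\<lambda>i j. \<phi> (a i j))) \<le> 1" by simp
qed

text \<open>Ensures that the corner of an extension has cb norm no smaller than that of
  \<phi>.\<close>

lemma cb_norm_mono:
  assumes "X \<subseteq> T" "\<And>x. x \<in> X \<Longrightarrow> \<theta> x = \<phi> x" shows "cb_norm X \<phi> \<le> cb_norm T \<theta>"
  unfolding cb_norm_def
proof (intro SUP_least)
  fix n a assume a: "a \<in> {a \<in> mats_over n X. op_mat_norm n a \<le> 1}"
  then have eq: "op_mat_norm n (\<lambda>i j. \<phi> (a i j)) = op_mat_norm n (\<lambda>i j. \<theta> (a i j))"
    using assms by (intro op_mat_norm_cong) (auto simp: mats_over_def)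
  have "a \<in> {a \<in> mats_over n T. op_mat_norm n a \<le> 1}"
    using a assms(1) by (auto simp: mats_over_def)
  then show "ereal (op_mat_norm n (\<lambda>i j. \<phi> (a i j)))
    \<le> (SUP n. SUP a\<in>{a \<in> mats_over n T. op_mat_norm n a \<le> 1}. ereal (op_mat_norm n (\<lambda>i j. \<theta> (a i j))))"
    unfolding eq by (intro SUP_upper2[of n] SUP_upper2[of a]) auto
qed

section \<open>Matrix norms expressed by positivity\<close>

text \<open>After reordering the direct summands this is the 2 by 2 operator matrix with diagonal
  \<open>r\<close> and corners a and its adjoint; hence the exchanged indices in the last
  term.\<close>

definition paulsen_mat :: "real \<Rightarrow> ('h::chilbert_space, 'k::chilbert_space) op_mat \<Rightarrow> ('k \<times> 'h, 'k \<times> 'h) op_mat"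
  where "paulsen_mat r a i j =
    (if i = j then complex_of_real r *\<^sub>C cblinfun_id else 0) + upper (a i j) + adj (upper (a j i))"

lemma vec_inner_paulsen_mat:
  fixes a :: "('h::chilbert_space, 'k::chilbert_space) op_mat" and x :: "nat \<Rightarrow> 'k \<times> 'h"
  shows
  "vec_inner n (mat_apply n (paulsen_mat r a) x) x =
    complex_of_real (r * ((vec_norm n (\<lambda>i. fst (x i)))\<^sup>2 + (vec_norm n (\<lambda>i. snd (x i)))\<^sup>2)
      + 2 * Re (vec_inner n (mat_apply n a (\<lambda>i. snd (x i))) (\<lambda>i. fst (x i))))"
proof -
  let ?k = "\<lambda>i. fst (x i)" and ?h = "\<lambda>i. snd (x i)"
  let ?z = "vec_inner n (mat_apply n a ?h) ?k"
  have app: "mat_apply n (paulsen_mat r a) x i = complex_of_real r *\<^sub>C x i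
    + ((\<Sum>j<n. a i j (?h j)), (\<Sum>j<n. adj (a j i) (?k j)))" if "i < n" for i
  proof -
    have "mat_apply n (paulsen_mat r a) x i = complex_of_real r *\<^sub>C x i
      + (\<Sum>j<n. (a i j (?h j), 0)) + (\<Sum>j<n. (0, adj (a j i) (?k j)))"
      using that unfolding mat_apply_def paulsen_mat_def
      by (simp add: sum.distrib upper_def adj_op_block if_distrib[of cblinfun_apply] if_distribR cong: if_cong)
    then show ?thesis by (simp add: prod_eq_iff fst_sum snd_sum)
  qed
  have "vec_inner n (mat_apply n (paulsen_mat r a) x) x
    = (\<Sum>i<n. complex_of_real r * cinner (?k i) (?k i) + complex_of_real r * cinner (?h i) (?h i)
        + cinner (\<Sum>j<n. a i j (?h j)) (?k i) + cinner (\<Sum>j<n. adj (a j i) (?k j)) (?h i))"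
    unfolding vec_inner_def by (intro sum.cong refl)
      (simp add: app cinner_prod_def cinner_simps scaleC_prod_def)
  also have "\<dots> = complex_of_real r * vec_inner n ?k ?k + complex_of_real r * vec_inner n ?h ?h + ?z
      + (\<Sum>i<n. cinner (\<Sum>j<n. adj (a j i) (?k j)) (?h i))"
    by (simp add: vec_inner_def mat_apply_def sum.distrib sum_distrib_left)
  also have "(\<Sum>i<n. cinner (\<Sum>j<n. adj (a j i) (?k j)) (?h i)) = vec_inner n ?k (mat_apply n a ?h)"
    by (simp add: vec_inner_def mat_apply_def cinner_sum_left cinner_sum_right cinner_adj_left)
      (rule sum.swap)
  also have "vec_inner n ?k (mat_apply n a ?h) = cnj ?z"
    by (simp add: vec_inner_def cinner_commute[symmetric])
  also have "complex_of_real r * vec_inner n ?k ?k + complex_of_real r * vec_inner n ?h ?h + ?z + cnj ?z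
    = complex_of_real (r * ((vec_norm n ?k)\<^sup>2 + (vec_norm n ?h)\<^sup>2) + 2 * Re ?z)"
    by (simp add: vec_inner_self algebra_simps complex_add_cnj)
  finally show ?thesis .
qed

text \<open>Cauchy-Schwarz bounds the corner terms by 2 r ||h|| ||k||, which the
  arithmetic-geometric mean inequality absorbs into the diagonal.\<close>

lemma paulsen_mat_positive:
  fixes a :: "('h::chilbert_space, 'k::chilbert_space) op_mat"
  assumes "op_mat_norm n a \<le> r" shows "op_mat_positive n (paulsen_mat r a)"
  unfolding op_mat_positive_iff
proof
  fix x :: "nat \<Rightarrow> 'k \<times> 'h"
  let ?k = "\<lambda>i. fst (x i)" and ?h = "\<lambda>i. snd (x i)"
  let ?z = "vec_inner n (mat_apply n a ?h) ?k"
  have r: "0 \<le> r" using op_mat_norm_nonneg[of n a] assms by simp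
  have "cmod ?z \<le> vec_norm n (mat_apply n a ?h) * vec_norm n ?k" by (rule vec_inner_cauchy_schwarz)
  also have "\<dots> \<le> r * vec_norm n ?h * vec_norm n ?k"
    using order_trans[OF vec_norm_mat_apply_le mult_right_mono[OF assms]] by (intro mult_right_mono) auto
  finally have 1: "- Re ?z \<le> r * (vec_norm n ?h * vec_norm n ?k)"
    using abs_Re_le_cmod[of ?z] by (simp add: mult.assoc)
  have "0 \<le> r * (vec_norm n ?k - vec_norm n ?h)\<^sup>2" using r by simp
  then have "2 * (r * (vec_norm n ?h * vec_norm n ?k)) \<le> r * ((vec_norm n ?k)\<^sup>2 + (vec_norm n ?h)\<^sup>2)"
    by (simp add: power2_diff algebra_simps)
  with 1 have "0 \<le> r * ((vec_norm n ?k)\<^sup>2 + (vec_norm n ?h)\<^sup>2) + 2 * Re ?z" by argo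
  then show "vec_inner n (mat_apply n (paulsen_mat r a) x) x \<in> \<real>\<^sub>\<ge>\<^sub>0"
    unfolding vec_inner_paulsen_mat complex_nonneg_Reals_iff by simp
qed

lemma op_mat_norm_le_of_paulsen_mat:
  fixes a :: "('h::chilbert_space, 'k::chilbert_space) op_mat"
  assumes pos: "op_mat_positive n (paulsen_mat r a)" and r: "0 \<le> r"
  shows "op_mat_norm n a \<le> r"
proof (rule op_mat_norm_le[OF r])
  fix x :: "nat \<Rightarrow> 'h"
  define y where "y = mat_apply n a x"
  let ?X = "vec_norm n x" and ?Y = "vec_norm n y"
  show "vec_norm n (mat_apply n a x) \<le> r * vec_norm n x"
  proof (cases "?X = 0 \<or> ?Y = 0")
    case True
    then show ?thesis using vec_norm_mat_apply_le[of n a x] r by (auto simp: y_def)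
  next
    case False
    then have nz: "?X > 0" "?Y > 0" using vec_norm_nonneg[of n x] vec_norm_nonneg[of n y] by (auto simp: less_le)
    \<comment> \<open>Scales the test vector (-c a x, x) so that both components have equal norm,
      the case of equality in the mean inequality; positivity there gives ||a x|| \<le> r
      ||x||.\<close>
    define c where "c = ?X / ?Y"
    let ?w = "\<lambda>i. (complex_of_real (- c) *\<^sub>C y i, x i)"
    have norm_cy: "vec_norm n (\<lambda>i. complex_of_real (- c) *\<^sub>C y i) = c * ?Y"
      using nz vec_norm_scaleR[of n "- c" y] by (simp add: scaleR_scaleC c_def)
    have "vec_inner n (mat_apply n (paulsen_mat r a) ?w) ?w \<in> \<real>\<^sub>\<ge>\<^sub>0"
      using pos by (simp add: op_mat_positive_iff)
    then have "0 \<le> r * ((c * ?Y)\<^sup>2 + ?X\<^sup>2) - 2 * (c * ?Y\<^sup>2)"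
      unfolding vec_inner_paulsen_mat complex_nonneg_Reals_iff
      by (simp only: fst_conv snd_conv norm_cy vec_inner_linear y_def[symmetric] vec_inner_self)
        (simp del: of_real_power flip: of_real_mult)
    also have "c * ?Y = ?X" using nz by (simp add: c_def)
    also have "c * ?Y\<^sup>2 = ?X * ?Y" using nz by (simp add: c_def power2_eq_square)
    finally have "?X * ?Y \<le> ?X * (r * ?X)" by (simp add: power2_eq_square algebra_simps)
    then show ?thesis using nz by (simp add: y_def)
  qed
qed

section \<open>The off-diagonal ternary ring\<close>

definition off_diagonal :: "('h::chilbert_space \<Rightarrow>\<^sub>C\<^sub>L 'k::chilbert_space) set \<Rightarrow> (('k \<times> 'h) \<Rightarrow>\<^sub>C\<^sub>L ('k \<times> 'h)) set"
  where "off_diagonal T = {op_block 0 x (adj y) 0 | x y. x \<in> T \<and> y \<in> T}"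

text \<open>\<theta> is given on T only, so the lower corner is carried to T by \<open>adj\<close>
  and back.\<close>

definition off_diagonal_map ::
  "(('h0::chilbert_space \<Rightarrow>\<^sub>C\<^sub>L 'k0::chilbert_space) \<Rightarrow> ('h::chilbert_space \<Rightarrow>\<^sub>C\<^sub>L 'k::chilbert_space)) \<Rightarrow>
   (('k0 \<times> 'h0) \<Rightarrow>\<^sub>C\<^sub>L ('k0 \<times> 'h0)) \<Rightarrow> (('k \<times> 'h) \<Rightarrow>\<^sub>C\<^sub>L ('k \<times> 'h))"
  where "off_diagonal_map \<theta> m = op_block 0 (\<theta> (upper_corner m)) (adj (\<theta> (adj (lower_corner m)))) 0"

lemma off_diagonalI: "x \<in> T \<Longrightarrow> y \<in> T \<Longrightarrow> op_block 0 x (adj y) 0 \<in> off_diagonal T"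
  by (auto simp: off_diagonal_def)

lemma off_diagonalE:
  assumes "m \<in> off_diagonal T" obtains x y where "m = op_block 0 x (adj y) 0" "x \<in> T" "y \<in> T"
  using assms by (auto simp: off_diagonal_def)

lemma off_diagonal_map_block [simp]:
  "off_diagonal_map \<theta> (op_block 0 x (adj y) 0) = op_block 0 (\<theta> x) (adj (\<theta> y)) 0"
  by (simp add: off_diagonal_map_def)

lemma closed_off_diagonal:
  assumes "closed T" shows "closed (off_diagonal T)"
proof -
  \<comment> \<open>The remainder is the diagonal part of the block operator; with it
    \<open>off_diagonal T\<close> becomes an intersection of preimages of closed sets under
    continuous maps.\<close>
  let ?r = "\<lambda>m. m - (upper (upper_corner m) + adj (upper (adj (lower_corner m))))"
  have eq: "off_diagonal T = upper_corner -` T \<inter> (\<lambda>m. adj (lower_corner m)) -` T \<inter> ?r -` {0}"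
  proof (intro equalityI subsetI)
    fix m assume "m \<in> off_diagonal T"
    then show "m \<in> upper_corner -` T \<inter> (\<lambda>m. adj (lower_corner m)) -` T \<inter> ?r -` {0}"
      by (auto elim!: off_diagonalE simp: upper_plus_adj_upper)
  next
    fix m assume m: "m \<in> upper_corner -` T \<inter> (\<lambda>m. adj (lower_corner m)) -` T \<inter> ?r -` {0}"
    then have "m = op_block 0 (upper_corner m) (adj (adj (lower_corner m))) 0"
      by (simp add: upper_plus_adj_upper)
    with m show "m \<in> off_diagonal T" unfolding off_diagonal_def by blast
  qed
  note bl = bounded_linear_upper_corner bounded_linear_lower_corner
    bounded_linear_compose[OF bounded_linear_adj]
    bounded_linear_compose[OF bounded_linear_upper]
  have "bounded_linear ?r"
    by (intro bounded_linear_sub bounded_linear_add bounded_linear_ident bl)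
  then show ?thesis unfolding eq
    by (intro closed_Int closed_vimage assms closed_singleton linear_continuous_on bl)
qed

lemma is_tro_simps:
  assumes "is_tro T"
  shows "csubspace T" "closed T" "x \<in> T \<Longrightarrow> y \<in> T \<Longrightarrow> z \<in> T \<Longrightarrow> x o\<^sub>C\<^sub>L (adj y o\<^sub>C\<^sub>L z) \<in> T"
  using assms by (auto simp: is_tro_def compose_assoc)

lemma csubspace_off_diagonal:
  assumes "csubspace T" shows "csubspace (off_diagonal T)"
  unfolding csubspace_def
proof (intro conjI ballI allI)
  note T = csubspace_intros[OF assms]
  show "0 \<in> off_diagonal T" using off_diagonalI[OF T(3) T(3)] by (simp add: op_block_linear)
  show "m + n \<in> off_diagonal T" if mn: "m \<in> off_diagonal T" "n \<in> off_diagonal T" for m n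
  proof -
    obtain x y x' y' where "m = op_block 0 x (adj y) 0" "n = op_block 0 x' (adj y') 0"
      and xy: "x \<in> T" "y \<in> T" "x' \<in> T" "y' \<in> T"
      using mn by (elim off_diagonalE)
    then have "m + n = op_block 0 (x + x') (adj (y + y')) 0" by (simp add: op_block_linear adj_add)
    then show ?thesis using xy by (auto intro!: off_diagonalI T)
  qed
  show "c *\<^sub>C m \<in> off_diagonal T" if m: "m \<in> off_diagonal T" for c m
  proof -
    obtain x y where "m = op_block 0 x (adj y) 0" and xy: "x \<in> T" "y \<in> T"
      using m by (elim off_diagonalE)
    then have "c *\<^sub>C m = op_block 0 (c *\<^sub>C x) (adj (cnj c *\<^sub>C y)) 0" by (simp add: op_block_linear adj_scaleC)
    then show ?thesis using xy by (auto intro!: off_diagonalI T)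
  qed
qed

text \<open>Each corner is a single TRO triple product; the factors of the lower one are reversed
  because it is written as an adjoint.\<close>

lemma off_diagonal_triple:
  "op_block 0 x (adj y) 0 o\<^sub>C\<^sub>L op_block 0 x' (adj y') 0 o\<^sub>C\<^sub>L op_block 0 x'' (adj y'') 0
    = op_block 0 (x o\<^sub>C\<^sub>L (adj y' o\<^sub>C\<^sub>L x'')) (adj (y'' o\<^sub>C\<^sub>L (adj x' o\<^sub>C\<^sub>L y))) 0"
  by (simp add: op_block_compose adj_compose compose_assoc)

lemma ternary_rep_off_diagonal:
  assumes T: "is_tro T" and \<theta>: "triple_morphism T \<theta>" and nondeg: "nondegenerate T \<theta>"
    and contr: "\<And>t. t \<in> T \<Longrightarrow> norm (\<theta> t) \<le> norm t"
  shows "ternary_rep (off_diagonal T) (off_diagonal_map \<theta>) 2"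
proof
  note sub = is_tro_simps(1)[OF T] and TI = csubspace_intros[OF is_tro_simps(1)[OF T]]
  have lin: "clinear_on T \<theta>" using \<theta> by (simp add: triple_morphism_def)
  have trip: "\<theta> (x o\<^sub>C\<^sub>L (adj y o\<^sub>C\<^sub>L z)) = \<theta> x o\<^sub>C\<^sub>L (adj (\<theta> y) o\<^sub>C\<^sub>L \<theta> z)" if "x \<in> T" "y \<in> T" "z \<in> T" for x y z
    using \<theta> that by (simp add: triple_morphism_def compose_assoc)
  show "csubspace (off_diagonal T)" by (rule csubspace_off_diagonal[OF sub])
  show "closed (off_diagonal T)" by (rule closed_off_diagonal[OF is_tro_simps(2)[OF T]])
  show "adj m \<in> off_diagonal T" "off_diagonal_map \<theta> (adj m) = adj (off_diagonal_map \<theta> m)"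
    if m: "m \<in> off_diagonal T" for m
  proof -
    obtain x y where m: "m = op_block 0 x (adj y) 0" and xy: "x \<in> T" "y \<in> T"
      using m by (elim off_diagonalE)
    have eq: "adj m = op_block 0 y (adj x) 0" by (simp add: m adj_op_block)
    show "adj m \<in> off_diagonal T" unfolding eq by (rule off_diagonalI[OF xy(2,1)])
    show "off_diagonal_map \<theta> (adj m) = adj (off_diagonal_map \<theta> m)"
      unfolding eq by (simp add: m adj_op_block)
  qed
  show "m o\<^sub>C\<^sub>L n o\<^sub>C\<^sub>L l \<in> off_diagonal T"
    "off_diagonal_map \<theta> (m o\<^sub>C\<^sub>L n o\<^sub>C\<^sub>L l) = off_diagonal_map \<theta> m o\<^sub>C\<^sub>L off_diagonal_map \<theta> n o\<^sub>C\<^sub>L off_diagonal_map \<theta> l"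
    if mnl: "m \<in> off_diagonal T" "n \<in> off_diagonal T" "l \<in> off_diagonal T" for m n l
  proof -
    obtain x y x' y' x'' y'' where m: "m = op_block 0 x (adj y) 0" and n: "n = op_block 0 x' (adj y') 0"
      and l: "l = op_block 0 x'' (adj y'') 0"
      and xy: "x \<in> T" "y \<in> T" "x' \<in> T" "y' \<in> T" "x'' \<in> T" "y'' \<in> T"
      using mnl by (elim off_diagonalE)
    show "m o\<^sub>C\<^sub>L n o\<^sub>C\<^sub>L l \<in> off_diagonal T"
      unfolding m n l off_diagonal_triple by (intro off_diagonalI is_tro_simps(3)[OF T] xy)
    show "off_diagonal_map \<theta> (m o\<^sub>C\<^sub>L n o\<^sub>C\<^sub>L l) = off_diagonal_map \<theta> m o\<^sub>C\<^sub>L off_diagonal_map \<theta> n o\<^sub>C\<^sub>L off_diagonal_map \<theta> l"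
      unfolding m n l off_diagonal_triple off_diagonal_map_block using xy by (simp add: trip)
  qed
  show "clinear_on (off_diagonal T) (off_diagonal_map \<theta>)"
    unfolding clinear_on_def
  proof (intro conjI ballI allI)
    fix m n assume mn: "m \<in> off_diagonal T" "n \<in> off_diagonal T"
    obtain x y x' y' where m: "m = op_block 0 x (adj y) 0" and n: "n = op_block 0 x' (adj y') 0"
      and xy: "x \<in> T" "y \<in> T" "x' \<in> T" "y' \<in> T"
      using mn by (elim off_diagonalE)
    show "off_diagonal_map \<theta> (m + n) = off_diagonal_map \<theta> m + off_diagonal_map \<theta> n"
      using xy by (simp add: off_diagonal_map_def m n op_block_linear clinear_on_add[OF lin] adj_add)
  next
    fix c m assume "m \<in> off_diagonal T"
    then obtain x y where m: "m = op_block 0 x (adj y) 0" and xy: "x \<in> T" "y \<in> T"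
      by (elim off_diagonalE)
    show "off_diagonal_map \<theta> (c *\<^sub>C m) = c *\<^sub>C off_diagonal_map \<theta> m"
      using xy by (simp add: off_diagonal_map_def m op_block_linear clinear_on_scaleC[OF lin] adj_scaleC)
  qed
  show "norm (off_diagonal_map \<theta> m) \<le> 2 * norm m" if m: "m \<in> off_diagonal T" for m
  proof -
    obtain x y where m: "m = op_block 0 x (adj y) 0" and xy: "x \<in> T" "y \<in> T"
      using m by (elim off_diagonalE)
    \<comment> \<open>Triangle inequality over the two corners: the origin of the constant
      2.\<close>
    have "norm (off_diagonal_map \<theta> m) \<le> norm (upper (\<theta> x)) + norm (adj (upper (\<theta> y)))"
      unfolding m off_diagonal_map_block unfolding upper_plus_adj_upper[symmetric] by (rule norm_triangle_ineq)
    also have "\<dots> \<le> norm (\<theta> x) + norm (\<theta> y)" by (simp add: add_mono norm_upper_le)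
    also have "\<dots> \<le> norm x + norm y" by (simp add: add_mono contr xy)
    also have "\<dots> \<le> norm m + norm m"
      using norm_upper_corner_le[of m] norm_lower_corner_le[of m] by (simp add: m add_mono)
    finally show ?thesis by simp
  qed
  show "(0::real) \<le> 2" by simp
  fix h assume h: "\<And>m. m \<in> off_diagonal T \<Longrightarrow> off_diagonal_map \<theta> m h = 0"
  have blk: "\<theta> x (snd h) = 0 \<and> adj (\<theta> x) (fst h) = 0" if "x \<in> T" for x
    using h[OF off_diagonalI[OF that that]] by (simp add: zero_prod_def)
  have "snd h = 0" by (rule nondegenerate_kernel[OF nondeg]) (simp add: blk)
  moreover have "fst h = 0" by (rule nondegenerate_cokernel[OF nondeg]) (simp add: blk)
  ultimately show "h = 0" by (simp add: prod_eq_iff)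
qed

lemma graded_ternary_rep_off_diagonal:
  assumes "ternary_rep (off_diagonal T) (off_diagonal_map \<theta>) C" "csubspace T"
  shows "graded_ternary_rep (off_diagonal T) (off_diagonal_map \<theta>) C symmetry"
proof -
  interpret ternary_rep "off_diagonal T" "off_diagonal_map \<theta>" C by fact
  show ?thesis
  proof
    show "symmetry o\<^sub>C\<^sub>L symmetry = cblinfun_id" by (rule symmetry_square)
    show "adj symmetry = symmetry" by (rule adj_symmetry)
    fix m assume "m \<in> off_diagonal T"
    then obtain x y where m: "m = op_block 0 x (adj y) 0" and xy: "x \<in> T" "y \<in> T"
      by (elim off_diagonalE)
    show "symmetry o\<^sub>C\<^sub>L m o\<^sub>C\<^sub>L symmetry = - m"
      by (simp add: m symmetry_def op_block_compose op_block_linear compose_simps)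
    have "symmetry o\<^sub>C\<^sub>L m = op_block 0 x (adj (- y)) 0"
      by (simp add: m symmetry_def op_block_compose compose_simps adj_minus)
    then show "symmetry o\<^sub>C\<^sub>L m \<in> off_diagonal T"
      using xy assms(2) by (auto intro!: off_diagonalI csubspace_minus)
  qed
qed

section \<open>The Paulsen system\<close>

lemma is_tro_tro_generated: "is_tro (tro_generated X)"
  unfolding tro_generated_def
proof (rule hull_in)
  fix F :: "('a \<Rightarrow>\<^sub>C\<^sub>L 'b) set set"
  assume "\<forall>S\<in>F. is_tro S"
  then show "is_tro (\<Inter>F)"
    by (auto simp: is_tro_def csubspace_def intro!: closed_Inter)
qed

lemma cstar_algebra_cstar_generated: "is_cstar_algebra (cstar_generated S)"
  unfolding cstar_generated_def
proof (rule hull_in)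
  fix F :: "('a \<Rightarrow>\<^sub>C\<^sub>L 'a) set set"
  assume "\<forall>S\<in>F. is_cstar_algebra S"
  then show "is_cstar_algebra (\<Inter>F)"
    by (auto simp: is_cstar_algebra_def csubspace_def intro!: closed_Inter)
qed

lemma cstar_generated_least: "S \<subseteq> M \<Longrightarrow> is_cstar_algebra M \<Longrightarrow> cstar_generated S \<subseteq> M"
  unfolding cstar_generated_def by (rule hull_minimal)

lemma subset_cstar_generated: "S \<subseteq> cstar_generated S"
  unfolding cstar_generated_def by (rule hull_subset)

lemma paulsen_systemI: "x \<in> X \<Longrightarrow> y \<in> X \<Longrightarrow>
  op_block (\<alpha> *\<^sub>C cblinfun_id) x (adj y) (\<beta> *\<^sub>C cblinfun_id) \<in> paulsen_system X"
  unfolding paulsen_system_def by blast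

lemma paulsen_systemE:
  assumes "s \<in> paulsen_system X"
  obtains \<alpha> \<beta> x y where "s = op_block (\<alpha> *\<^sub>C cblinfun_id) x (adj y) (\<beta> *\<^sub>C cblinfun_id)" "x \<in> X" "y \<in> X"
  using assms unfolding paulsen_system_def by blast

text \<open>The diagonal scalars are spanned by the identity and \<open>symmetry\<close>. The
  formula holds in source and target alike, so a linear map respecting these two is settled by its
  off-diagonal values.\<close>

lemma paulsen_block_decomposition:
  "op_block (\<alpha> *\<^sub>C cblinfun_id) x (adj y) (\<beta> *\<^sub>C cblinfun_id)
    = ((\<alpha> + \<beta>) / 2) *\<^sub>C cblinfun_id + ((\<alpha> - \<beta>) / 2) *\<^sub>C symmetry + op_block 0 x (adj y) 0"
proof -
  have "(\<alpha> + \<beta>) / 2 + (\<alpha> - \<beta>) / 2 = \<alpha>" "(\<alpha> + \<beta>) / 2 - (\<alpha> - \<beta>) / 2 = \<beta>"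
    by (simp_all add: field_simps)
  then show ?thesis
    by (simp add: op_block_id symmetry_def op_block_linear scaleC_minus
        flip: scaleC_add_left scaleC_diff_left diff_conv_add_uminus)
qed

lemma operator_system_paulsen:
  assumes X: "csubspace X" shows "operator_system (paulsen_system X)"
  unfolding operator_system_def csubspace_def
proof (intro conjI ballI allI)
  note XI = csubspace_intros[OF X]
  show "0 \<in> paulsen_system X"
    using paulsen_systemI[OF XI(3) XI(3), of 0 0] by (simp add: op_block_linear)
  show "cblinfun_id \<in> paulsen_system X"
    using paulsen_systemI[OF XI(3) XI(3), of 1 1] by (simp flip: op_block_id)
  fix s assume s: "s \<in> paulsen_system X"
  obtain \<alpha> \<beta> x y where s: "s = op_block (\<alpha> *\<^sub>C cblinfun_id) x (adj y) (\<beta> *\<^sub>C cblinfun_id)"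
    and xy: "x \<in> X" "y \<in> X" using s by (rule paulsen_systemE)
  have "adj s = op_block (cnj \<alpha> *\<^sub>C cblinfun_id) y (adj x) (cnj \<beta> *\<^sub>C cblinfun_id)"
    by (simp add: s adj_op_block adj_scaleC)
  then show "adj s \<in> paulsen_system X" using xy by (simp add: paulsen_systemI)
  show "c *\<^sub>C s \<in> paulsen_system X" for c
  proof -
    have "c *\<^sub>C s = op_block ((c * \<alpha>) *\<^sub>C cblinfun_id) (c *\<^sub>C x) (adj (cnj c *\<^sub>C y)) ((c * \<beta>) *\<^sub>C cblinfun_id)"
      by (simp add: s op_block_linear adj_scaleC scaleC_scaleC)
    then show ?thesis using xy by (simp add: paulsen_systemI XI)
  qed
  fix t assume t: "t \<in> paulsen_system X"
  obtain \<alpha>' \<beta>' x' y' where t: "t = op_block (\<alpha>' *\<^sub>C cblinfun_id) x' (adj y') (\<beta>' *\<^sub>C cblinfun_id)"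
    and xy': "x' \<in> X" "y' \<in> X" using t by (rule paulsen_systemE)
  have "s + t = op_block ((\<alpha> + \<alpha>') *\<^sub>C cblinfun_id) (x + x') (adj (y + y')) ((\<beta> + \<beta>') *\<^sub>C cblinfun_id)"
    by (simp add: s t op_block_linear adj_add scaleC_add_left)
  then show "s + t \<in> paulsen_system X" using xy xy' by (simp add: paulsen_systemI XI)
qed

text \<open>Scalars in a diagonal entry are determined only on a nonzero space; a nonzero operator
  guarantees this at both ends.\<close>

lemma nonzero_imp_id_nonzero:
  fixes x :: "'a::chilbert_space \<Rightarrow>\<^sub>C\<^sub>L 'b::chilbert_space"
  assumes "x \<noteq> 0"
  shows "(cblinfun_id :: 'a \<Rightarrow>\<^sub>C\<^sub>L 'a) \<noteq> 0" "(cblinfun_id :: 'b \<Rightarrow>\<^sub>C\<^sub>L 'b) \<noteq> 0"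
proof -
  have "x o\<^sub>C\<^sub>L cblinfun_id \<noteq> x o\<^sub>C\<^sub>L 0" "cblinfun_id o\<^sub>C\<^sub>L x \<noteq> 0 o\<^sub>C\<^sub>L x" using assms by simp_all
  then show "(cblinfun_id :: 'a \<Rightarrow>\<^sub>C\<^sub>L 'a) \<noteq> 0" "(cblinfun_id :: 'b \<Rightarrow>\<^sub>C\<^sub>L 'b) \<noteq> 0" by fastforce+
qed

lemma scaleC_cancel_right:
  assumes "(x::'a::complex_vector) \<noteq> 0" shows "a *\<^sub>C x = b *\<^sub>C x \<longleftrightarrow> a = b"
proof
  assume "a *\<^sub>C x = b *\<^sub>C x"
  then have "(a - b) *\<^sub>C x = 0" by (simp only: scaleC_diff_left diff_self)
  then show "a = b" using assms by (simp add: scaleC_eq_zero_iff)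
qed simp

lemma paulsen_map_eq:
  fixes X :: "('h0::chilbert_space \<Rightarrow>\<^sub>C\<^sub>L 'k0::chilbert_space) set"
  assumes "(cblinfun_id :: 'h0 \<Rightarrow>\<^sub>C\<^sub>L 'h0) \<noteq> 0" "(cblinfun_id :: 'k0 \<Rightarrow>\<^sub>C\<^sub>L 'k0) \<noteq> 0"
    and "x \<in> X" "y \<in> X"
  shows "paulsen_map X \<phi> (op_block (\<alpha> *\<^sub>C cblinfun_id) x (adj y) (\<beta> *\<^sub>C cblinfun_id))
    = op_block (\<alpha> *\<^sub>C cblinfun_id) (\<phi> x) (adj (\<phi> y)) (\<beta> *\<^sub>C cblinfun_id)"
proof -
  have id: "a *\<^sub>C (cblinfun_id :: 'h0 \<Rightarrow>\<^sub>C\<^sub>L 'h0) = b *\<^sub>C cblinfun_id \<longleftrightarrow> a = b"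
    "a *\<^sub>C (cblinfun_id :: 'k0 \<Rightarrow>\<^sub>C\<^sub>L 'k0) = b *\<^sub>C cblinfun_id \<longleftrightarrow> a = b" for a b
    by (rule scaleC_cancel_right; rule assms)+
  have adj: "adj a = adj b \<longleftrightarrow> a = b" for a b :: "'h0 \<Rightarrow>\<^sub>C\<^sub>L 'k0" by (metis adj_adj)
  show ?thesis
    unfolding paulsen_map_def
    by (rule the_equality) (use assms(3,4) in \<open>auto simp: op_block_eq_iff id adj\<close>)
qed

lemma clinear_on_subset: "clinear_on A f \<Longrightarrow> S \<subseteq> A \<Longrightarrow> clinear_on S f"
  unfolding clinear_on_def by blast

lemma completely_positive_subset: "completely_positive A f \<Longrightarrow> S \<subseteq> A \<Longrightarrow> completely_positive S f"
  unfolding completely_positive_def mats_over_def by blast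

lemma ucp_subset: "ucp A f \<Longrightarrow> S \<subseteq> A \<Longrightarrow> ucp S f"
  unfolding ucp_def using clinear_on_subset completely_positive_subset by blast

lemma completely_positive_cong:
  assumes "completely_positive S f" "\<And>s. s \<in> S \<Longrightarrow> f s = f' s" shows "completely_positive S f'"
  unfolding completely_positive_def
proof (intro allI ballI impI)
  fix n a assume a: "a \<in> mats_over n S" "op_mat_positive n a"
  then have "op_mat_positive n (\<lambda>i j. f (a i j))" using assms(1) by (simp add: completely_positive_def)
  moreover have "mat_apply n (\<lambda>i j. f (a i j)) h i = mat_apply n (\<lambda>i j. f' (a i j)) h i" if "i < n" for h i
    using a(1) that assms(2) by (simp add: mat_apply_def mats_over_def)
  then have "vec_inner n (mat_apply n (\<lambda>i j. f (a i j)) h) h = vec_inner n (mat_apply n (\<lambda>i j. f' (a i j)) h) h" for h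
    by (intro vec_inner_cong) auto
  ultimately show "op_mat_positive n (\<lambda>i j. f' (a i j))" by (simp add: op_mat_positive_iff)
qed

lemma ucp_cong:
  assumes "ucp S f" "csubspace S" "cblinfun_id \<in> S" "\<And>s. s \<in> S \<Longrightarrow> f s = f' s" shows "ucp S f'"
proof -
  have "clinear_on S f'"
    using assms unfolding ucp_def clinear_on_def by (metis csubspace_add csubspace_scaleC)
  then show ?thesis using assms completely_positive_cong[of S f f'] by (simp add: ucp_def)
qed

text \<open>Reduces a UCP extension of the Paulsen map to what the corner argument uses:
  \<open>symmetry\<close> is preserved and the upper corners over T are available.\<close>

locale symmetric_ucp_map = ucp_map C \<Psi>
  for C :: "(('k0::chilbert_space \<times> 'h0::chilbert_space) \<Rightarrow>\<^sub>C\<^sub>L ('k0 \<times> 'h0)) set"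
    and \<Psi> :: "(('k0 \<times> 'h0) \<Rightarrow>\<^sub>C\<^sub>L ('k0 \<times> 'h0)) \<Rightarrow> (('k::chilbert_space \<times> 'h::chilbert_space) \<Rightarrow>\<^sub>C\<^sub>L ('k \<times> 'h))" +
  fixes T :: "('h0 \<Rightarrow>\<^sub>C\<^sub>L 'k0) set"
  assumes upper_C: "t \<in> T \<Longrightarrow> upper t \<in> C" and symmetry_C: "symmetry \<in> C"
    and map_symmetry: "\<Psi> symmetry = symmetry"
begin

definition corner :: "('h0 \<Rightarrow>\<^sub>C\<^sub>L 'k0) \<Rightarrow> ('h \<Rightarrow>\<^sub>C\<^sub>L 'k)"
  where "corner t = upper_corner (\<Psi> (upper t))"

text \<open>The defect of \<open>symmetry\<close> with itself is \<Psi>(1) minus the square of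
  \<open>symmetry\<close>, which is 0.\<close>

lemma symmetry_multiplicative: "symmetry \<in> multiplicative_domain"
  by (rule multiplicative_domainI)
    (simp_all add: symmetry_C defect_def adj_symmetry map_symmetry symmetry_square unital)

text \<open>The two relations in \<open>symmetry_upper\<close> survive \<Psi> by
  \<open>symmetry_multiplicative\<close>, and \<open>upper_of_symmetry\<close> then determines the
  shape of the image.\<close>

lemma map_upper:
  assumes t: "t \<in> T" shows "\<Psi> (upper t) = upper (corner t)"
proof -
  have mult: "\<Psi> (y o\<^sub>C\<^sub>L symmetry) = \<Psi> y o\<^sub>C\<^sub>L symmetry" "\<Psi> (symmetry o\<^sub>C\<^sub>L y) = symmetry o\<^sub>C\<^sub>L \<Psi> y" if "y \<in> C" for y
    using symmetry_multiplicative that by (auto simp: multiplicative_domain_def map_symmetry)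
  have "upper (upper_corner (\<Psi> (upper t))) = \<Psi> (upper t)"
    by (rule upper_of_symmetry)
      (simp_all add: mult[symmetric] upper_C t symmetry_upper clinear_on_minus[OF linear])
  then show ?thesis by (simp add: corner_def)
qed

lemma clinear_on_corner: "clinear_on T corner"
  by (auto simp: clinear_on_def corner_def upper_linear upper_corner_linear upper_C
      clinear_on_add[OF linear] clinear_on_scaleC[OF linear])

text \<open>Paulsen's trick: the norm bound r on a becomes positivity of
  \<open>paulsen_mat r a\<close>, which \<Psi> preserves, and the image is the
  \<open>paulsen_mat\<close> of the corner map with the same r.\<close>

lemma completely_contractive_corner: "completely_contractive T corner"
  unfolding completely_contractive_def
proof (intro allI ballI)
  fix n a assume "a \<in> mats_over n T"
  then have a: "a i j \<in> T" if "i < n" "j < n" for i j using that by (simp add: mats_over_def)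
  let ?r = "op_mat_norm n a"
  let ?p = "paulsen_mat ?r a" and ?q = "paulsen_mat ?r (\<lambda>i j. corner (a i j))"
  have "?p \<in> mats_over n C"
    by (auto simp: mats_over_def paulsen_mat_def intro!: A_intros upper_C a)
  then have "op_mat_positive n (\<lambda>i j. \<Psi> (?p i j))"
    using cp paulsen_mat_positive[of n a ?r] by (auto simp: completely_positive_def)
  moreover have "\<Psi> (?p i j) = ?q i j" if ij: "i < n" "j < n" for i j
  proof -
    have up: "upper (a i j) \<in> C" "adj (upper (a j i)) \<in> C" using ij a by (auto intro: upper_C adj_A)
    have s: "(if i = j then complex_of_real ?r *\<^sub>C cblinfun_id else 0) \<in> C"
      "\<Psi> (if i = j then complex_of_real ?r *\<^sub>C cblinfun_id else 0) = (if i = j then complex_of_real ?r *\<^sub>C cblinfun_id else 0)"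
      by (auto intro!: A_intros simp: clinear_on_scaleC[OF linear] clinear_on_zero[OF linear csubspace_A] id_A unital)
    show ?thesis
      unfolding paulsen_mat_def
      using ij by (simp only: clinear_on_add[OF linear] csubspace_add[OF csubspace_A] up s map_upper[OF a] adj_map upper_C[OF a])
  qed
  then have "mat_apply n (\<lambda>i j. \<Psi> (?p i j)) x i = mat_apply n ?q x i" if "i < n" for x i
    using that by (simp add: mat_apply_def)
  then have "vec_inner n (mat_apply n (\<lambda>i j. \<Psi> (?p i j)) x) x = vec_inner n (mat_apply n ?q x) x" for x
    by (intro vec_inner_cong) auto
  ultimately have "op_mat_positive n ?q" by (simp add: op_mat_positive_iff)
  then show "op_mat_norm n (\<lambda>i j. corner (a i j)) \<le> op_mat_norm n a"
    by (rule op_mat_norm_le_of_paulsen_mat) (rule op_mat_norm_nonneg)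
qed

end

text \<open>Contractivity of UCP maps gives closedness. The purpose is to spread agreement from
  generators to the generated algebra.\<close>

lemma closed_agreement:
  assumes "ucp_map C \<Phi>" "ucp_map C \<Psi>"
    and rep: "star_representation C \<Phi>" "star_representation C \<Psi>"
  shows "is_cstar_algebra {m \<in> C. \<Phi> m = \<Psi> m}"
proof -
  interpret \<Phi>: ucp_map C \<Phi> by fact
  interpret \<Psi>: ucp_map C \<Psi> by fact
  let ?E = "{m \<in> C. \<Phi> m = \<Psi> m}"
  have "closed ?E"
    unfolding closed_sequential_limits
  proof (intro allI impI, elim conjE)
    fix x l assume x: "\<forall>n. x n \<in> ?E" and l: "x \<longlonglongrightarrow> l"
    then have xC: "x n \<in> C" for n by simp
    have lC: "l \<in> C" using closed_sequentially[OF \<Phi>.closed_A] xC l by blast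
    have "(\<lambda>n. \<Phi> (x n)) \<longlonglongrightarrow> \<Psi> l" using \<Psi>.map_tendsto[OF xC l lC] x by simp
    then have "\<Phi> l = \<Psi> l" using \<Phi>.map_tendsto[OF xC l lC] LIMSEQ_unique by blast
    with lC show "l \<in> ?E" by simp
  qed
  moreover have "csubspace ?E"
    unfolding csubspace_def
    by (simp add: clinear_on_add[OF \<Phi>.linear] clinear_on_add[OF \<Psi>.linear] clinear_on_scaleC[OF \<Phi>.linear]
        clinear_on_scaleC[OF \<Psi>.linear] clinear_on_zero[OF \<Phi>.linear \<Phi>.csubspace_A]
        clinear_on_zero[OF \<Psi>.linear \<Phi>.csubspace_A] csubspace_zero[OF \<Phi>.csubspace_A]
        csubspace_add[OF \<Phi>.csubspace_A] csubspace_scaleC[OF \<Phi>.csubspace_A])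
  ultimately show ?thesis
    unfolding is_cstar_algebra_def
    using rep by (auto simp: star_representation_def \<Phi>.compose_A \<Phi>.adj_A)
qed

lemma paulsen_subset:
  assumes "csubspace M" "cblinfun_id \<in> M" "symmetry \<in> M" "off_diagonal X \<subseteq> M"
  shows "paulsen_system X \<subseteq> M"
  using assms
  by (auto elim!: paulsen_systemE simp: paulsen_block_decomposition
      intro!: csubspace_add[OF assms(1)] csubspace_scaleC[OF assms(1)] off_diagonalI)

text \<open>The set of all t whose \<open>upper t\<close> lies in the generated algebra is itself a
  TRO containing X, since \<open>upper\<close> respects triple products.\<close>

lemma upper_tro_generated:
  assumes X: "csubspace X" and t: "t \<in> tro_generated X"
  shows "upper t \<in> cstar_generated (paulsen_system X)"
proof -
  let ?C = "cstar_generated (paulsen_system X)"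
  have C: "is_cstar_algebra ?C" by (rule cstar_algebra_cstar_generated)
  have sub: "csubspace ?C" and "closed ?C" using C by (auto simp: is_cstar_algebra_def)
  have "is_tro {t. upper t \<in> ?C}"
    unfolding is_tro_def
  proof (intro conjI ballI)
    show "csubspace {t. upper t \<in> ?C}"
      by (simp add: csubspace_def upper_linear csubspace_zero[OF sub] csubspace_add[OF sub] csubspace_scaleC[OF sub])
    show "closed {t. upper t \<in> ?C}"
      using closed_vimage[OF \<open>closed ?C\<close> linear_continuous_on[OF bounded_linear_upper]] by (simp add: vimage_def)
    fix x y z :: "'a \<Rightarrow>\<^sub>C\<^sub>L 'b"
    assume "x \<in> {t. upper t \<in> ?C}" "y \<in> {t. upper t \<in> ?C}" "z \<in> {t. upper t \<in> ?C}"
    then have "upper x o\<^sub>C\<^sub>L adj (upper y) o\<^sub>C\<^sub>L upper z \<in> ?C"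
      using C by (auto simp: is_cstar_algebra_def)
    moreover have "upper x o\<^sub>C\<^sub>L adj (upper y) o\<^sub>C\<^sub>L upper z = upper (x o\<^sub>C\<^sub>L adj y o\<^sub>C\<^sub>L z)"
      by (simp add: upper_def adj_op_block op_block_compose)
    ultimately show "x o\<^sub>C\<^sub>L adj y o\<^sub>C\<^sub>L z \<in> {t. upper t \<in> ?C}" by simp
  qed
  moreover have "X \<subseteq> {t. upper t \<in> ?C}"
  proof
    fix x assume "x \<in> X"
    from paulsen_systemI[OF this csubspace_zero[OF X], of 0 0]
    show "x \<in> {t. upper t \<in> ?C}" using subset_cstar_generated by (auto simp: upper_def)
  qed
  ultimately have "tro_generated X \<subseteq> {t. upper t \<in> ?C}"
    unfolding tro_generated_def by (intro hull_minimal)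
  with t show ?thesis by auto
qed

theorem theorem3p1:
  fixes X T :: "('h0::chilbert_space \<Rightarrow>\<^sub>C\<^sub>L 'k0::chilbert_space) set"
    and \<phi> :: "('h0 \<Rightarrow>\<^sub>C\<^sub>L 'k0) \<Rightarrow> ('h::chilbert_space \<Rightarrow>\<^sub>C\<^sub>L 'k::chilbert_space)"
  assumes "operator_space X"
    and "T = tro_generated X"
    and "rectangular_operator_state X \<phi>"
    and "rectangular_boundary_rep X T \<phi>"
  shows "boundary_rep (paulsen_system X) (paulsen_map X \<phi>)"
proof -
  let ?S = "paulsen_system X" and ?C = "cstar_generated (paulsen_system X)"
  have X: "csubspace X" using assms(1) by (simp add: operator_space_def)
  have T: "is_tro T" by (simp add: assms(2) is_tro_tro_generated)
  have subT: "csubspace T" using is_tro_simps(1)[OF T] .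
  have XT: "X \<subseteq> T" unfolding assms(2) tro_generated_def by (rule hull_subset)
  have \<phi>: "clinear_on X \<phi>" "nondegenerate X \<phi>" "completely_contractive X \<phi>" "cb_norm X \<phi> = 1"
    using assms(3) by (auto simp: rectangular_operator_state_def)
  \<comment> \<open>cb norm 1 rules out \<phi> = 0, so all four Hilbert spaces are nonzero;
    \<open>paulsen_map_eq\<close> and the irreducibility claim rely on this.\<close>
  have "\<exists>x\<in>X. \<phi> x \<noteq> 0" using cb_norm_zero[of X \<phi>] \<phi>(4) by auto
  then obtain x0 where x0: "x0 \<in> X" "\<phi> x0 \<noteq> 0" by blast
  then have "x0 \<noteq> 0" using clinear_on_zero[OF \<phi>(1) X] by auto
  note idX = nonzero_imp_id_nonzero[OF this] and id\<phi> = nonzero_imp_id_nonzero[OF x0(2)]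
  note pmap = paulsen_map_eq[OF idX]
  have C: "is_cstar_algebra ?C" by (rule cstar_algebra_cstar_generated)
  have subC: "csubspace ?C" by (rule cstar_algebra_csubspace[OF C])
  have SC: "?S \<subseteq> ?C" by (rule subset_cstar_generated)
  have opsys: "operator_system ?S" by (rule operator_system_paulsen[OF X])
  have idS: "cblinfun_id \<in> ?S" using opsys by (simp add: operator_system_def)
  have symS: "symmetry \<in> ?S"
    using paulsen_systemI[OF csubspace_zero[OF X] csubspace_zero[OF X], of 1 "-1"]
    by (simp add: symmetry_def scaleC_minus_left)
  have symmap: "paulsen_map X \<phi> symmetry = symmetry"
    using pmap[OF csubspace_zero[OF X] csubspace_zero[OF X], of \<phi> 1 "-1"] clinear_on_zero[OF \<phi>(1) X]
    by (simp add: symmetry_def scaleC_minus_left)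
  have upperC: "upper t \<in> ?C" if "t \<in> T" for t
    using upper_tro_generated[OF X] that by (simp add: assms(2))
  have offC: "off_diagonal T \<subseteq> ?C"
  proof
    fix m assume "m \<in> off_diagonal T"
    then obtain x y where m: "m = op_block 0 x (adj y) 0" and xy: "x \<in> T" "y \<in> T" by (elim off_diagonalE)
    have "adj (upper y) \<in> ?C" using C upperC[OF xy(2)] by (simp add: is_cstar_algebra_def)
    then show "m \<in> ?C" unfolding m upper_plus_adj_upper[symmetric]
      by (intro csubspace_add[OF subC] upperC xy)
  qed
  have offX: "off_diagonal X \<subseteq> off_diagonal T" using XT by (auto simp: off_diagonal_def)

  \<comment> \<open>A representation of the generated algebra extending the Paulsen map\<close>
  obtain \<theta> where ext: "state_extension X T \<phi> \<theta>" and irr: "irreducible_triple_rep T \<theta>"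
    using assms(4) by (auto simp: rectangular_boundary_rep_def)
  have \<theta>: "triple_morphism T \<theta>" "nondegenerate T \<theta>" "completely_contractive T \<theta>" "\<And>x. x \<in> X \<Longrightarrow> \<theta> x = \<phi> x"
    using ext irr by (auto simp: state_extension_def rectangular_operator_state_def irreducible_triple_rep_def)
  have \<theta>0: "\<theta> 0 = 0" using \<theta>(1) clinear_on_zero[OF _ subT] by (auto simp: triple_morphism_def)
  interpret G: graded_ternary_rep "off_diagonal T" "off_diagonal_map \<theta>" 2 symmetry
    by (intro graded_ternary_rep_off_diagonal ternary_rep_off_diagonal T \<theta> subT
        completely_contractive_norm_le[OF \<theta>(3)])
  define \<Phi> where "\<Phi> = G.graded_rep"
  have SG: "?S \<subseteq> G.graded_algebra"
  proof (rule paulsen_subset)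
    show "csubspace G.graded_algebra" by (rule cstar_algebra_csubspace[OF G.cstar_graded_algebra])
  qed (use G.graded_algebra_W G.graded_algebra_even G.even_multiplier_g G.even_multiplier_intros(4) offX in auto)
  have CG: "?C \<subseteq> G.graded_algebra" by (rule cstar_generated_least[OF SG G.cstar_graded_algebra])
  have linG: "clinear_on G.graded_algebra \<Phi>"
    using G.star_representation_graded_rep by (simp add: star_representation_def \<Phi>_def)
  have rep\<Phi>: "star_representation ?C \<Phi>"
    using G.star_representation_graded_rep CG by (auto simp: star_representation_def clinear_on_def \<Phi>_def subset_iff)
  have \<Phi>id: "\<Phi> cblinfun_id = cblinfun_id" by (simp add: \<Phi>_def G.graded_rep_id)
  have \<Phi>off: "\<Phi> m = off_diagonal_map \<theta> m" if "m \<in> off_diagonal T" for m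
    using G.graded_algebra_W[OF that] by (simp add: \<Phi>_def)
  \<comment> \<open>\<open>symmetry\<close> on the target satisfies the intertwining relation that
    characterizes the image of \<open>symmetry\<close>, so \<open>G.rep_eqI\<close> identifies the
    two.\<close>
  have \<Phi>sym: "\<Phi> symmetry = symmetry"
  proof -
    have "\<Phi> symmetry = G.multiplier_rep symmetry"
      using G.graded_algebra_even[OF G.even_multiplier_g] by (simp add: \<Phi>_def)
    also have "\<dots> = symmetry"
    proof (rule G.rep_eqI)
      show "symmetry \<in> G.multipliers" using G.even_multiplier_g by (simp add: G.even_multiplier_def)
      fix m assume "m \<in> off_diagonal T"
      then obtain x y where m: "m = op_block 0 x (adj y) 0" and xy: "x \<in> T" "y \<in> T" by (elim off_diagonalE)
      have "\<theta> (- y) = - \<theta> y" using \<theta>(1) xy clinear_on_minus by (auto simp: triple_morphism_def)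
      then show "symmetry o\<^sub>C\<^sub>L off_diagonal_map \<theta> m = off_diagonal_map \<theta> (symmetry o\<^sub>C\<^sub>L m)"
        by (simp add: off_diagonal_map_def m symmetry_def op_block_compose compose_simps adj_minus)
    qed
    finally show ?thesis .
  qed
  have \<Phi>S: "\<Phi> s = paulsen_map X \<phi> s" if sS: "s \<in> ?S" for s
  proof -
    obtain \<alpha> \<beta> x y where s: "s = op_block (\<alpha> *\<^sub>C cblinfun_id) x (adj y) (\<beta> *\<^sub>C cblinfun_id)"
      and xy: "x \<in> X" "y \<in> X" using sS by (rule paulsen_systemE)
    have off: "op_block 0 x (adj y) 0 \<in> off_diagonal T" using xy XT by (auto intro!: off_diagonalI)
    have in_G: "cblinfun_id \<in> G.graded_algebra" "symmetry \<in> G.graded_algebra" "op_block 0 x (adj y) 0 \<in> G.graded_algebra"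
      using idS symS SG G.graded_algebra_W[OF off] by auto
    note subG = cstar_algebra_csubspace[OF G.cstar_graded_algebra]
    have "\<Phi> s = ((\<alpha> + \<beta>) / 2) *\<^sub>C cblinfun_id + ((\<alpha> - \<beta>) / 2) *\<^sub>C symmetry + op_block 0 (\<phi> x) (adj (\<phi> y)) 0"
      unfolding s paulsen_block_decomposition
      by (simp add: clinear_on_add[OF linG] clinear_on_scaleC[OF linG] csubspace_add[OF subG]
          csubspace_scaleC[OF subG] in_G \<Phi>id \<Phi>sym \<Phi>off[OF off] \<theta>(4) xy)
    also have "\<dots> = op_block (\<alpha> *\<^sub>C cblinfun_id) (\<phi> x) (adj (\<phi> y)) (\<beta> *\<^sub>C cblinfun_id)"
      by (rule paulsen_block_decomposition[symmetric])
    finally show ?thesis by (simp add: s pmap xy)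
  qed
  obtain K where "\<forall>m\<in>G.graded_algebra. norm (\<Phi> m) \<le> K * norm m"
    using G.graded_rep_bounded unfolding \<Phi>_def by blast
  then have "completely_positive ?C \<Phi>"
    using CG idS SC by (intro star_representation_completely_positive[OF C _ rep\<Phi> \<Phi>id, of K]) auto
  then have ucp\<Phi>: "ucp ?C \<Phi>"
    using clinear_on_subset[OF linG CG] by (simp add: ucp_def \<Phi>id)
  have ucpS: "ucp ?S (paulsen_map X \<phi>)"
    using opsys by (intro ucp_cong[OF ucp_subset[OF ucp\<Phi> SC]]) (auto simp: operator_system_def \<Phi>S)

  \<comment> \<open>Irreducibility\<close>
  have irr\<Phi>: "irreducible_star_rep ?C \<Phi>"
    unfolding irreducible_star_rep_def
  proof (intro conjI allI impI rep\<Phi>)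
    show "(cblinfun_id :: ('k \<times> 'h) \<Rightarrow>\<^sub>C\<^sub>L ('k \<times> 'h)) \<noteq> 0"
    proof
      assume "(cblinfun_id :: ('k \<times> 'h) \<Rightarrow>\<^sub>C\<^sub>L ('k \<times> 'h)) = 0"
      then have "op_block cblinfun_id 0 0 cblinfun_id = (op_block 0 0 0 0 :: ('k \<times> 'h) \<Rightarrow>\<^sub>C\<^sub>L ('k \<times> 'h))"
        by (simp add: op_block_linear flip: op_block_id)
      then show False using id\<phi> by (simp add: op_block_eq_iff)
    qed
    fix p :: "('k \<times> 'h) \<Rightarrow>\<^sub>C\<^sub>L ('k \<times> 'h)"
    assume p: "is_projection p \<and> (\<forall>a\<in>?C. p o\<^sub>C\<^sub>L \<Phi> a = \<Phi> a o\<^sub>C\<^sub>L p)"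
    \<comment> \<open>Commuting with \<open>\<Phi> symmetry = symmetry\<close> makes
      \<open>p\<close> block diagonal; its blocks then intertwine \<theta>.\<close>
    have "symmetry o\<^sub>C\<^sub>L p = p o\<^sub>C\<^sub>L symmetry" using p symS SC \<Phi>sym by force
    then obtain q r where pqr: "p = op_block q 0 0 r" by (rule diagonal_of_symmetry)
    have "is_projection r" "is_projection q"
      using p by (auto simp: is_projection_def pqr op_block_compose adj_op_block op_block_eq_iff)
    moreover have "q o\<^sub>C\<^sub>L \<theta> t = \<theta> t o\<^sub>C\<^sub>L r" if t: "t \<in> T" for t
    proof -
      have "upper t \<in> off_diagonal T"
        using off_diagonalI[OF t csubspace_zero[OF subT]] by (simp add: upper_def)
      then have "\<Phi> (upper t) = op_block 0 (\<theta> t) 0 0"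
        by (simp add: \<Phi>off off_diagonal_map_def upper_def \<theta>0)
      then have "p o\<^sub>C\<^sub>L op_block 0 (\<theta> t) 0 0 = op_block 0 (\<theta> t) 0 0 o\<^sub>C\<^sub>L p"
        using p upperC[OF t] by metis
      then show ?thesis by (simp add: pqr op_block_compose op_block_eq_iff)
    qed
    ultimately have "r = 0 \<and> q = 0 \<or> r = cblinfun_id \<and> q = cblinfun_id"
      using irr unfolding irreducible_triple_rep_def by blast
    then show "p = 0 \<or> p = cblinfun_id" by (auto simp: pqr op_block_linear simp flip: op_block_id)
  qed

  \<comment> \<open>Uniqueness of the UCP extension\<close>
  have unique: "\<Psi> a = \<Phi> a" if \<Psi>: "ucp_extension ?S (paulsen_map X \<phi>) \<Psi>" and a: "a \<in> ?C" for \<Psi> a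
  proof -
    have ucp\<Psi>: "ucp ?C \<Psi>" and \<Psi>S: "\<And>s. s \<in> ?S \<Longrightarrow> \<Psi> s = paulsen_map X \<phi> s"
      using \<Psi> by (auto simp: ucp_extension_def)
    interpret \<Psi>: symmetric_ucp_map ?C \<Psi> T
      by unfold_locales (use C idS SC symS ucp\<Psi> upperC \<Psi>S symmap in auto)
    have corner_X: "\<Psi>.corner x = \<phi> x" if "x \<in> X" for x
    proof -
      have "upper x = op_block (0 *\<^sub>C cblinfun_id) x (adj 0) (0 *\<^sub>C cblinfun_id)" by (simp add: upper_def)
      then have "\<Psi> (upper x) = op_block (0 *\<^sub>C cblinfun_id) (\<phi> x) (adj (\<phi> 0)) (0 *\<^sub>C cblinfun_id)"
        using paulsen_systemI[OF that csubspace_zero[OF X]] that csubspace_zero[OF X]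
        by (simp only: \<Psi>S pmap)
      then show ?thesis by (simp add: \<Psi>.corner_def)
    qed
    \<comment> \<open>Nondegeneracy and cb norm at least 1 are inherited from \<phi>, to which the
      corner restricts on X.\<close>
    have "nondegenerate T \<Psi>.corner"
      using \<phi>(2) XT corner_X unfolding nondegenerate_def by (metis subsetD)
    moreover have "cb_norm T \<Psi>.corner = 1"
      using cb_norm_le_one[OF \<Psi>.completely_contractive_corner] cb_norm_mono[OF XT, of \<Psi>.corner \<phi>] corner_X \<phi>(4)
      by (auto intro: order_antisym)
    ultimately have "state_extension X T \<phi> \<Psi>.corner"
      using \<Psi>.clinear_on_corner \<Psi>.completely_contractive_corner corner_X
      by (simp add: state_extension_def rectangular_operator_state_def)
    \<comment> \<open>The unique extension property enters here, applied to the corner of an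
      arbitrary extension.\<close>
    then have "triple_morphism T \<Psi>.corner"
      using assms(4) by (simp add: rectangular_boundary_rep_def unique_extension_property_def)
    then interpret R: ternary_rep "off_diagonal T" "off_diagonal_map \<Psi>.corner" 2
      by (intro ternary_rep_off_diagonal T \<open>nondegenerate T \<Psi>.corner\<close>
          completely_contractive_norm_le[OF \<Psi>.completely_contractive_corner])
    interpret R: ternary_restriction "off_diagonal T" "off_diagonal_map \<Psi>.corner" 2 ?C \<Psi>
    proof
      fix m assume "m \<in> off_diagonal T"
      then obtain x y where m: "m = op_block 0 x (adj y) 0" and xy: "x \<in> T" "y \<in> T" by (elim off_diagonalE)
      have "\<Psi> (upper x + adj (upper y)) = upper (\<Psi>.corner x) + adj (upper (\<Psi>.corner y))"
        using xy by (simp add: clinear_on_add[OF \<Psi>.linear] upperC \<Psi>.adj_A \<Psi>.adj_map \<Psi>.map_upper)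
      then show "\<Psi> m = off_diagonal_map \<Psi>.corner m" by (simp add: m upper_plus_adj_upper)
    qed (rule offC)
    have "?S \<subseteq> \<Psi>.multiplicative_domain"
    proof (rule paulsen_subset)
      show "csubspace \<Psi>.multiplicative_domain" by (rule cstar_algebra_csubspace[OF \<Psi>.cstar_multiplicative_domain])
      show "cblinfun_id \<in> \<Psi>.multiplicative_domain"
        by (rule \<Psi>.multiplicative_domainI) (simp_all add: \<Psi>.id_A \<Psi>.defect_def \<Psi>.unital)
    qed (use \<Psi>.symmetry_multiplicative R.W_multiplicative offX in auto)
    then have "?C \<subseteq> \<Psi>.multiplicative_domain"
      by (rule cstar_generated_least[OF _ \<Psi>.cstar_multiplicative_domain])
    then have "star_representation ?C \<Psi>"
      by (auto simp: star_representation_def \<Psi>.linear \<Psi>.adj_map \<Psi>.multiplicative_domain_def)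
    moreover have "ucp_map ?C \<Phi>" "ucp_map ?C \<Psi>"
      by unfold_locales (use C idS SC ucp\<Phi> ucp\<Psi> in auto)
    ultimately have "is_cstar_algebra {m \<in> ?C. \<Phi> m = \<Psi> m}"
      using rep\<Phi> by (intro closed_agreement)
    then have "?C \<subseteq> {m \<in> ?C. \<Phi> m = \<Psi> m}"
      using SC \<Phi>S \<Psi>S by (intro cstar_generated_least) auto
    with a show ?thesis by auto
  qed
  have "ucp_extension ?S (paulsen_map X \<phi>) \<Phi>" using ucp\<Phi> \<Phi>S by (simp add: ucp_extension_def)
  then show ?thesis
    unfolding boundary_rep_def using opsys ucpS irr\<Phi> unique by blast
qed

end
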